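(* Let \(G\) be a loopless \(6\)-regular triangulation of the torus (multiple edges allowed). Then \(\operatorname{ch}(G) - \chi(G) \leq 2\).
   Context: All graphs are finite. A proper coloring of a graph assigns to each vertex a color in \(\mathbb{N}=\{0,1,2,\dots\}\) so that adjacent vertices receive distinct colors; \(\chi(G)\) is the least \(k\) for which a proper coloring with at most \(k\) colors exists. A list assignment gives each vertex \(v\) a set \(L_v \subset \mathbb{N}\); \(G\) is \(L\)-choosable if there is a proper coloring with the color of \(v\) in \(L_v\) for every \(v\); \(G\) is \(k\)-choosable if it is \(L\)-choosable for every list assignment with \(|L_v| \leq k\) for all \(v\); the choice number \(\operatorname{ch}(G)\) is the least such \(k\). Multiple edges do not affect either quantity. A triangulation of the torus is a graph embedded in the torus in which every face is a triangle; it is \(6\)-regular if every vertex has degree \(6\).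
   Formalization: G is taken to be k-choosable if it is L-choosable for every list assignment with |L_v| ≥ k (infinite lists included), not |L_v| ≤ k: with ≤, empty lists would be allowed, no nonempty graph would be k-choosable for any k, and ch(G) would be undefined. *)

theory Defs
  imports "HOL-Analysis.Analysis"
begin

section \<open>Multigraphs, colourings and list colourings\<close>

text \<open>An edge with two ends is a link; an edge with one end is a loop.\<close>

record ('v, 'e) multigraph =
  verts :: "'v set"
  edges :: "'e set"
  ends :: "'e \<Rightarrow> 'v set"

definition finite_multigraph :: "('v, 'e) multigraph \<Rightarrow> bool" where
  "finite_multigraph G \<longleftrightarrow>
     finite (verts G) \<and> finite (edges G) \<and>
     (\<forall>e\<in>edges G. ends G e \<subseteq> verts G \<and> card (ends G e) \<in> {1, 2})"

definition loopless :: "('v, 'e) multigraph \<Rightarrow> bool" where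
  "loopless G \<longleftrightarrow> (\<forall>e\<in>edges G. card (ends G e) \<noteq> 1)"

text \<open>Parallel edges are counted with multiplicity, and a loop counts twice.\<close>

definition degree :: "('v, 'e) multigraph \<Rightarrow> 'v \<Rightarrow> nat" where
  "degree G v = card {e \<in> edges G. v \<in> ends G e} + card {e \<in> edges G. ends G e = {v}}"

definition regular :: "nat \<Rightarrow> ('v, 'e) multigraph \<Rightarrow> bool" where
  "regular d G \<longleftrightarrow> (\<forall>v\<in>verts G. degree G v = d)"

definition proper_coloring :: "('v, 'e) multigraph \<Rightarrow> ('v \<Rightarrow> nat) \<Rightarrow> bool" where
  "proper_coloring G c \<longleftrightarrow> (\<forall>e\<in>edges G. \<forall>u v. ends G e = {u, v} \<longrightarrow> c u \<noteq> c v)"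

definition chromatic_number :: "('v, 'e) multigraph \<Rightarrow> nat" where
  "chromatic_number G = (LEAST k. \<exists>c. proper_coloring G c \<and> card (c ` verts G) \<le> k)"

definition list_choosable :: "('v, 'e) multigraph \<Rightarrow> ('v \<Rightarrow> nat set) \<Rightarrow> bool" where
  "list_choosable G L \<longleftrightarrow> (\<exists>c. proper_coloring G c \<and> (\<forall>v\<in>verts G. c v \<in> L v))"

text \<open>Lists of size at least \<open>k\<close>; infinite lists, whose \<^const>\<open>card\<close> is 0, are included.\<close>

definition choosable :: "nat \<Rightarrow> ('v, 'e) multigraph \<Rightarrow> bool" where
  "choosable k G \<longleftrightarrow>
     (\<forall>L. (\<forall>v\<in>verts G. infinite (L v) \<or> k \<le> card (L v)) \<longrightarrow> list_choosable G L)"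

definition choice_number :: "('v, 'e) multigraph \<Rightarrow> nat" where
  "choice_number G = (LEAST k. choosable k G)"


section \<open>Graphs embedded in a surface\<close>

text \<open>
  The vertex \<open>v\<close> is drawn as the point \<open>pos v\<close> and the edge \<open>e\<close> as the curve \<open>\<gamma> e\<close>. A
  \<^const>\<open>simple_path\<close> may be closed, which happens exactly for loops.
\<close>

definition edge_interior :: "('e \<Rightarrow> real \<Rightarrow> 'a::topological_space) \<Rightarrow> 'e \<Rightarrow> 'a set" where
  "edge_interior \<gamma> e = \<gamma> e ` {0<..<1}"

definition embedded_in ::
  "'a::topological_space set \<Rightarrow> ('v, 'e) multigraph \<Rightarrow> ('v \<Rightarrow> 'a) \<Rightarrow> ('e \<Rightarrow> real \<Rightarrow> 'a) \<Rightarrow> bool"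
  where
  "embedded_in S G pos \<gamma> \<longleftrightarrow>
     inj_on pos (verts G) \<and> pos ` verts G \<subseteq> S \<and>
     (\<forall>e\<in>edges G. simple_path (\<gamma> e) \<and> path_image (\<gamma> e) \<subseteq> S \<and>
        {pathstart (\<gamma> e), pathfinish (\<gamma> e)} = pos ` ends G e) \<and>
     (\<forall>e\<in>edges G. edge_interior \<gamma> e \<inter> pos ` verts G = {}) \<and>
     (\<forall>e\<in>edges G. \<forall>f\<in>edges G. e \<noteq> f \<longrightarrow> edge_interior \<gamma> e \<inter> edge_interior \<gamma> f = {})"

definition faces ::
  "'a::topological_space set \<Rightarrow> ('v, 'e) multigraph \<Rightarrow> ('v \<Rightarrow> 'a) \<Rightarrow> ('e \<Rightarrow> real \<Rightarrow> 'a) \<Rightarrow> 'a set set"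
  where
  "faces S G pos \<gamma> = components (S - (pos ` verts G \<union> (\<Union>e\<in>edges G. path_image (\<gamma> e))))"

text \<open>
  A face is a triangle if it is an open disc whose boundary walk consists of three edges: it is
  the homeomorphic image of the interior of a closed triangle under a map that extends
  continuously to the boundary, sending corners to vertices and open sides homeomorphically onto
  open edges. The extension need not be injective on the boundary, since in a general multigraph
  a facial walk may repeat vertices or edges.
\<close>

definition triangular_face ::
  "('v, 'e) multigraph \<Rightarrow> ('v \<Rightarrow> 'a) \<Rightarrow> ('e \<Rightarrow> real \<Rightarrow> 'a) \<Rightarrow> 'a::topological_space set \<Rightarrow> bool"
  where
  "triangular_face G pos \<gamma> F \<longleftrightarrow>
     (\<exists>\<phi> :: complex \<Rightarrow> 'a.
        continuous_on (convex hull {0, 1, \<i>}) \<phi> \<and>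
        (\<exists>\<psi>. homeomorphism (interior (convex hull {0, 1, \<i>})) F \<phi> \<psi>) \<and>
        \<phi> ` {0, 1, \<i>} \<subseteq> pos ` verts G \<and>
        (\<forall>p\<in>{0, 1, \<i>}. \<forall>q\<in>{0, 1, \<i>}. p \<noteq> q \<longrightarrow>
           (\<exists>e\<in>edges G. \<exists>\<psi>. homeomorphism (open_segment p q) (edge_interior \<gamma> e) \<phi> \<psi>)))"

definition triangulates ::
  "'a::topological_space set \<Rightarrow> ('v, 'e) multigraph \<Rightarrow> ('v \<Rightarrow> 'a) \<Rightarrow> ('e \<Rightarrow> real \<Rightarrow> 'a) \<Rightarrow> bool"
  where
  "triangulates S G pos \<gamma> \<longleftrightarrow>
     finite_multigraph G \<and> embedded_in S G pos \<gamma> \<and>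
     (\<forall>F\<in>faces S G pos \<gamma>. triangular_face G pos \<gamma> F)"

definition torus :: "(complex \<times> complex) set" where
  "torus = sphere 0 1 \<times> sphere 0 1"

end

theory Submission
  imports Defs "HOL-Complex_Analysis.Complex_Analysis"
begin

text \<open>
  A face is a triangle with three distinct corners, so the chromatic number is at least 3, and
  choice number 7 is immediate from the degrees. If 4 colours suffice, then every component has a
  vertex with at most 5 neighbours or an induced diamond, either of which can be coloured last, so
  lists of size 6 suffice. The main case is chromatic number 3, where lists of size 5 must suffice.

  Lifting the faces to the universal cover of the torus and comparing winding numbers of their
  boundary curves shows that every edge lies on exactly two faces, consistently oriented. The
  resulting rotation system is 6-regular and triangular, so translations along its straight lines
  commute, and in the presence of a 3-colouring each component is a quotient of the triangular
  lattice by a lattice of colour-preserving translations. In such a quotient it is enough to find an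
  induced subgraph that can be coloured from lists of size one less than the degrees: the remaining
  vertices can be peeled off so that each has two neighbours coloured after it. If there are no
  short periods, the closed neighbourhood of a triangle is such a subgraph; otherwise two adjacent
  3-cycles (an octahedron) or four consecutive double layers are, or all vertices have at most 4
  neighbours. These configurations are handled by the Alon--Tarsi method.
\<close>

section \<open>An Alon--Tarsi criterion for list colourings\<close>

text \<open>The definition of a triangulation looks at each face separately. That an edge borders
  two faces, that these traverse it in opposite directions and that the faces at a vertex form one
  cycle has to be extracted from point-set topology. Looplessness is the lever: the corners of a
  face are distinct, so the closed face is embedded and its lift to the plane is bounded by a Jordan
  curve. Winding number 1 there fixes an orientation that deck translations respect, hence one that
  is coherent over the torus.

  With lists of size 5 and at most six neighbours per vertex, an induced subgraph coloured last
  keeps lists of at least its degrees minus one. The Alon--Tarsi count (list sizes minus one add up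
  to the number of edges) then asks for exactly twice as many edges as vertices. The octahedron (12
  edges, 6 vertices), the double layers (16, 8) and the triangle patch (24, 12) meet this with no
  colour to spare, and a period that identifies points of one of them calls for another. With lists
  of size 6 the subgraph keeps lists of its full degrees, and four vertices are enough.\<close>

fun at_coeff :: "(nat \<times> nat) list \<Rightarrow> nat list \<Rightarrow> int" where
  "at_coeff [] k = (if \<forall>x\<in>set k. x = 0 then 1 else 0)"
| "at_coeff ((u, v) # E) k =
     (if k ! u = 0 then 0 else at_coeff E (k[u := k ! u - 1]))
     - (if k ! v = 0 then 0 else at_coeff E (k[v := k ! v - 1]))"

text \<open>These are the weights of the divided difference over \<open>S\<close>, the functional
  that reads off the top coefficient of a polynomial of degree below \<open>card S\<close>. Newton's
  recursion builds them: the divided difference of \<open>p\<close> over \<open>insert b S\<close>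
  is that of \<open>(p(a) - p(b)) / (a - b)\<close> over \<open>S\<close>.\<close>

lemma divided_difference_weights:
  fixes S :: "real set"
  assumes "finite S" "S \<noteq> {}"
  shows "\<exists>w. \<forall>k<card S. (\<Sum>a\<in>S. w a * a ^ k) = (if Suc k = card S then 1 else 0)"
  using assms
proof (induction S rule: finite_ne_induct)
  case (singleton b)
  show ?case by (rule exI[of _ "\<lambda>_. 1"]) auto
next
  case (insert b S)
  then obtain w where
    w: "\<And>k. k < card S \<Longrightarrow> (\<Sum>a\<in>S. w a * a ^ k) = (if Suc k = card S then 1 else 0)" by blast
  \<comment> \<open>The weight at \<open>b\<close> is the one that makes all new weights add up to
    0.\<close>
  define w' where "w' a = (if a = b then - (\<Sum>a\<in>S. w a / (a - b)) else w a / (a - b))" for a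
  have "(\<Sum>a\<in>insert b S. w' a * a ^ k) = (if Suc k = card (insert b S) then 1 else 0)"
    if k: "k < card (insert b S)" for k
  proof -
    have "(\<Sum>a\<in>insert b S. w' a * a ^ k) = w' b * b ^ k + (\<Sum>a\<in>S. w' a * a ^ k)"
      using insert by simp
    also have "(\<Sum>a\<in>S. w' a * a ^ k) = (\<Sum>a\<in>S. w a / (a - b) * a ^ k)"
      using insert by (intro sum.cong) (auto simp: w'_def)
    also have "w' b * b ^ k + \<dots> = (\<Sum>a\<in>S. w a / (a - b) * (a ^ k - b ^ k))"
      by (simp add: w'_def sum_distrib_right right_diff_distrib sum_subtractf)
    also have "\<dots> = (\<Sum>a\<in>S. w a * (\<Sum>i<k. b ^ (k - Suc i) * a ^ i))"
    proof (rule sum.cong)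
      fix a assume "a \<in> S"
      then have "a \<noteq> b" using insert by auto
      then show "w a / (a - b) * (a ^ k - b ^ k) = w a * (\<Sum>i<k. b ^ (k - Suc i) * a ^ i)"
        by (simp add: power_diff_sumr2)
    qed simp
    also have "\<dots> = (\<Sum>i<k. b ^ (k - Suc i) * (\<Sum>a\<in>S. w a * a ^ i))"
      by (simp add: sum_distrib_left sum.swap[of _ S] mult_ac)
    also have "\<dots> = (\<Sum>i<k. b ^ (k - Suc i) * (if Suc i = card S then 1 else 0))"
      using k insert by (intro sum.cong) (auto simp: w)
    also have "\<dots> = (if k = card S then 1 else 0)"
    proof (cases "k = card S")
      case True
      have "(\<Sum>i<k. b ^ (k - Suc i) * (if Suc i = card S then 1 else 0))
          = (\<Sum>i<k. if i = k - 1 then 1 else 0 :: real)"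
        using True by (intro sum.cong) auto
      then show ?thesis using True insert
        by (simp add: card_gt_0_iff)
    next
      case False
      then have "k < card S" using k insert by simp
      then show ?thesis by (auto intro!: sum.neutral)
    qed
    finally show ?thesis using insert by simp
  qed
  then show ?case by blast
qed

text \<open>
  The weighted sum over all colourings from the lists does not depend on the lists: it is the
  coefficient of the monomial with exponents \<open>d\<close> in the graph polynomial.
\<close>

lemma weighted_colour_sum:
  fixes L :: "nat \<Rightarrow> real set" and w :: "nat \<Rightarrow> real \<Rightarrow> real"
  assumes L: "\<And>i. i < n \<Longrightarrow> finite (L i)"
    and w: "\<And>i k. i < n \<Longrightarrow> k \<le> d i \<Longrightarrow> (\<Sum>a\<in>L i. w i a * a ^ k) = (if k = d i then 1 else 0)"
    and "\<And>u v. (u, v) \<in> set E \<Longrightarrow> u < n \<and> v < n"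
    and "(\<Sum>i<n. m i) + length E = (\<Sum>i<n. d i)"
  shows "(\<Sum>c\<in>PiE {..<n} L. (\<Prod>i<n. w i (c i) * c i ^ m i) * (\<Prod>(u, v)\<leftarrow>E. c u - c v))
    = (if \<forall>i<n. m i \<le> d i then of_int (at_coeff E (map (\<lambda>i. d i - m i) [0..<n])) else 0)"
  using assms(3,4)
proof (induction E arbitrary: m)
  case Nil
  have "(\<Sum>c\<in>PiE {..<n} L. (\<Prod>i<n. w i (c i) * c i ^ m i)) = (\<Prod>i<n. \<Sum>a\<in>L i. w i a * a ^ m i)"
    using L by (subst prod_sum_PiE) auto
  also have "\<dots> = (if \<forall>i<n. m i \<le> d i then 1 else 0)"
  proof (cases "\<forall>i<n. m i = d i")
    case True
    then show ?thesis using w by auto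
  next
    case False
    \<comment> \<open>Both exponent vectors have the same total, so unless they agree some exponent
      lies strictly below \<open>d i\<close>, and the weights at that vertex annihilate it.\<close>
    have "\<exists>i<n. m i < d i"
    proof (rule ccontr)
      assume "\<not> ?thesis"
      then have le: "\<And>i. i < n \<Longrightarrow> d i \<le> m i" by auto
      from False obtain j where "j < n" "d j < m j" using le by force
      then have "(\<Sum>i<n. d i) < (\<Sum>i<n. m i)" using le by (intro sum_strict_mono_ex1) auto
      then show False using Nil by simp
    qed
    then obtain i where i: "i < n" "m i < d i" by blast
    then have z: "(\<Prod>i<n. \<Sum>a\<in>L i. w i a * a ^ m i) = 0"
      using w[of i "m i"] by (intro prod_zero) auto
    have "\<not> (\<forall>i<n. m i \<le> d i)"
    proof
      assume "\<forall>i<n. m i \<le> d i"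
      then have "(\<Sum>i<n. m i) < (\<Sum>i<n. d i)" using i by (intro sum_strict_mono_ex1) auto
      then show False using Nil by simp
    qed
    then show ?thesis using z by (simp only: if_not_P if_False)
  qed
  finally have "(\<Sum>c\<in>PiE {..<n} L. (\<Prod>i<n. w i (c i) * c i ^ m i)) = (if \<forall>i<n. m i \<le> d i then 1 else 0)" .
  moreover have "d i \<le> m i" if "\<forall>i<n. m i \<le> d i" "i < n" for i
  proof (rule ccontr)
    assume "\<not> ?thesis"
    then have "m i < d i" by simp
    then have "(\<Sum>i<n. m i) < (\<Sum>i<n. d i)" using that by (intro sum_strict_mono_ex1) auto
    then show False using Nil by simp
  qed
  ultimately show ?case by auto
next
  case (Cons e E)
  obtain u v where e: "e = (u, v)" by fastforce
  have uv: "u < n" "v < n" using Cons.prems e by auto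
  \<comment> \<open>Multiplying by the colour of \<open>x\<close> raises the exponent of
    \<open>x\<close> by one. In this way the induction moves the factor \<open>c u - c v\<close>
    into the monomial.\<close>
  have up: "(\<Prod>i<n. w i (c i) * c i ^ (m(x := Suc (m x))) i) = c x * (\<Prod>i<n. w i (c i) * c i ^ m i)"
    if "x < n" for x c
  proof -
    have "(\<Prod>i<n. w i (c i) * c i ^ (m(x := Suc (m x))) i)
        = (\<Prod>i<n. (if i = x then c x else 1) * (w i (c i) * c i ^ m i))"
      by (intro prod.cong) auto
    then show ?thesis using that by (simp add: prod.distrib)
  qed
  define W where "W m E = (\<Sum>c\<in>PiE {..<n} L. (\<Prod>i<n. w i (c i) * c i ^ m i) * (\<Prod>(u, v)\<leftarrow>E. c u - c v))"
    for m and E :: "(nat \<times> nat) list"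
  define K where "K m = map (\<lambda>i. d i - m i) [0..<n]" for m
  have IH: "W m' E = (if \<forall>i<n. m' i \<le> d i then of_int (at_coeff E (K m')) else 0)"
    if "(\<Sum>i<n. m' i) + length E = (\<Sum>i<n. d i)" for m'
    unfolding W_def K_def
  proof (rule Cons.IH)
    show "u < n \<and> v < n" if "(u, v) \<in> set E" for u v
      using Cons.prems(1)[of u v] that by simp
  qed (rule that)
  have step: "W (m(x := Suc (m x))) E = (if \<forall>i<n. m i \<le> d i then
      of_int (if K m ! x = 0 then 0 else at_coeff E ((K m)[x := K m ! x - 1])) else 0)"
    if x: "x < n" for x
  proof -
    let ?m = "m(x := Suc (m x))"
    have "(\<Sum>i<n. ?m i) = (\<Sum>i<n. m i + (if i = x then 1 else 0))"
      by (intro sum.cong) auto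
    then have "(\<Sum>i<n. ?m i) + length E = (\<Sum>i<n. d i)"
      using x Cons.prems(2) by (simp add: sum.distrib)
    note IH' = IH[OF this]
    have Kx: "K m ! x = d x - m x" using x by (simp add: K_def)
    have "(K m)[x := K m ! x - 1] = K ?m"
      using x unfolding Kx by (intro nth_equalityI) (auto simp: K_def nth_list_update)
    moreover have "(\<forall>i<n. ?m i \<le> d i) \<longleftrightarrow> (\<forall>i<n. m i \<le> d i) \<and> m x < d x"
    proof
      assume *: "\<forall>i<n. ?m i \<le> d i"
      then have "Suc (m x) \<le> d x" using x by (metis fun_upd_same)
      moreover have "m i \<le> d i" if "i < n" for i
        using *[rule_format, OF that] by (cases "i = x") simp_all
      ultimately show "(\<forall>i<n. m i \<le> d i) \<and> m x < d x" by auto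
    qed auto
    ultimately have "W ?m E = (if (\<forall>i<n. m i \<le> d i) \<and> m x < d x then
        of_int (at_coeff E ((K m)[x := K m ! x - 1])) else 0)"
      unfolding IH' by (simp only:)
    then show ?thesis by (simp only: Kx) auto
  qed
  have "W m (e # E) = W (m(u := Suc (m u))) E - W (m(v := Suc (m v))) E"
    unfolding W_def sum_subtractf[symmetric] up[OF uv(1)] up[OF uv(2)]
    by (intro sum.cong) (simp_all add: e left_diff_distrib right_diff_distrib mult_ac)
  also have "\<dots> = (if \<forall>i<n. m i \<le> d i then of_int (at_coeff (e # E) (K m)) else 0)"
    unfolding step[OF uv(1)] step[OF uv(2)] e at_coeff.simps
    by (cases "\<forall>i<n. m i \<le> d i") (simp_all only: of_int_diff if_P if_not_P diff_self simp_thms)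
  finally show ?case unfolding W_def K_def .
qed

text \<open>Shrink the lists to exactly \<open>d ! i + 1\<close> colours. If no proper choice
  existed, every term of the weighted sum would contain a vanishing factor \<open>c u - c v\<close>,
  although the sum equals the nonzero coefficient.\<close>

theorem alon_tarsi:
  fixes L :: "nat \<Rightarrow> nat set"
  assumes "at_coeff E d \<noteq> 0" "length E = sum_list d"
    and E: "\<And>u v. (u, v) \<in> set E \<Longrightarrow> u < length d \<and> v < length d"
    and L: "\<And>i. i < length d \<Longrightarrow> finite (L i) \<and> d ! i < card (L i)"
  shows "\<exists>c. (\<forall>i<length d. c i \<in> L i) \<and> (\<forall>(u, v)\<in>set E. c u \<noteq> c v)"
proof (rule ccontr)
  assume none: "\<not> ?thesis"
  let ?n = "length d"
  have "\<forall>i. \<exists>K. i < ?n \<longrightarrow> K \<subseteq> L i \<and> card K = Suc (d ! i)"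
    using L by (meson Suc_leI obtain_subset_with_card_n)
  then obtain K where K: "\<And>i. i < ?n \<Longrightarrow> K i \<subseteq> L i \<and> card (K i) = Suc (d ! i)" by metis
  let ?R = "\<lambda>i. real ` K i"
  have cR: "finite (?R i)" "card (?R i) = Suc (d ! i)" if "i < ?n" for i
    using K[OF that] by (auto simp: card_image card_eq_0_iff intro!: card_ge_0_finite)
  have "\<forall>i. \<exists>w. i < ?n \<longrightarrow> (\<forall>k<card (?R i). (\<Sum>a\<in>?R i. w a * a ^ k) = (if Suc k = card (?R i) then 1 else 0))"
    using divided_difference_weights cR by (metis card.empty nat.distinct(1))
  then obtain w where w: "\<And>i k. i < ?n \<Longrightarrow> k < card (?R i) \<Longrightarrow>
      (\<Sum>a\<in>?R i. w i a * a ^ k) = (if Suc k = card (?R i) then 1 else 0)" by metis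
  have "(\<Sum>c\<in>PiE {..<?n} ?R. (\<Prod>i<?n. w i (c i) * c i ^ 0) * (\<Prod>(u, v)\<leftarrow>E. c u - c v))
    = of_int (at_coeff E d)"
  proof -
    have s: "sum_list d = (\<Sum>i<?n. d ! i)" by (simp add: sum_list_sum_nth lessThan_atLeast0)
    show ?thesis
      using weighted_colour_sum[of ?n ?R "\<lambda>i. d ! i" w E "\<lambda>_. 0"] cR w E assms(2) s
      by (simp add: map_nth)
  qed
  moreover have "(\<Prod>(u, v)\<leftarrow>E. c u - c v) = 0" if c: "c \<in> PiE {..<?n} ?R" for c
  proof -
    have "\<forall>i. \<exists>a. i < ?n \<longrightarrow> a \<in> K i \<and> c i = real a" using c by (fastforce simp: PiE_iff)
    then obtain b where b: "\<And>i. i < ?n \<Longrightarrow> b i \<in> K i \<and> c i = real (b i)" by metis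
    then have "\<forall>i<?n. b i \<in> L i" using K by blast
    then obtain u v where "(u, v) \<in> set E" "b u = b v" using none by blast
    then have "(u, v) \<in> set E" "c u - c v = 0" using b E by auto
    then show ?thesis by (force simp: prod_list_zero_iff)
  qed
  ultimately show False using assms(1) by simp
qed

text \<open>
  The same coefficient computed edge by edge on a list of exponent vectors in which equal vectors
  are merged; a vector is dropped once it asks for more edges at a vertex than remain there.
\<close>

fun merge_term :: "nat list \<Rightarrow> int \<Rightarrow> (nat list \<times> int) list \<Rightarrow> (nat list \<times> int) list" where
  "merge_term k x [] = [(k, x)]"
| "merge_term k x ((k', x') # S) =
     (if k = k' then (if x + x' = 0 then S else (k', x + x') # S) else (k', x') # merge_term k x S)"

fun edges_at :: "nat \<Rightarrow> (nat \<times> nat) list \<Rightarrow> nat" where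
  "edges_at w [] = 0"
| "edges_at w ((u, v) # E) = (if w = u \<or> w = v then Suc (edges_at w E) else edges_at w E)"

definition add_term :: "(nat \<times> nat) list \<Rightarrow> nat \<Rightarrow> nat \<Rightarrow> nat list \<Rightarrow> int \<Rightarrow>
    (nat list \<times> int) list \<Rightarrow> (nat list \<times> int) list" where
  "add_term E u v k x S =
     (if edges_at u E < k ! u \<or> edges_at v E < k ! v then S else merge_term k x S)"

definition take_edge :: "(nat \<times> nat) list \<Rightarrow> nat \<Rightarrow> nat \<Rightarrow> nat \<Rightarrow> nat list \<Rightarrow> int \<Rightarrow>
    (nat list \<times> int) list \<Rightarrow> (nat list \<times> int) list" where
  "take_edge E u v w k x S =
     (if k ! w = 0 then S else add_term E u v (k[w := k ! w - 1]) x S)"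

fun take_edges :: "(nat \<times> nat) list \<Rightarrow> nat \<Rightarrow> nat \<Rightarrow>
    (nat list \<times> int) list \<Rightarrow> (nat list \<times> int) list" where
  "take_edges E u v [] = []"
| "take_edges E u v ((k, x) # S) =
     take_edge E u v u k x (take_edge E u v v k (- x) (take_edges E u v S))"

fun at_table :: "(nat \<times> nat) list \<Rightarrow> (nat list \<times> int) list \<Rightarrow> int" where
  "at_table [] S = (\<Sum>(k, x)\<leftarrow>S. if \<forall>a\<in>set k. a = 0 then x else 0)"
| "at_table ((u, v) # E) S = at_table E (take_edges E u v S)"

lemma merge_term_sum:
  "(\<Sum>(k, x)\<leftarrow>merge_term k0 x0 S. x * f k) = x0 * f k0 + (\<Sum>(k, x)\<leftarrow>S. x * f k :: int)"
proof (induction k0 x0 S rule: merge_term.induct)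
  case (2 k x k' x' S)
  have "x * f k' + x' * f k' = 0" if "x + x' = 0"
    using that by (simp add: distrib_right[symmetric])
  with 2 show ?case by (auto simp: algebra_simps)
qed simp

lemma at_coeff_eq_0:
  assumes "edges_at w E < k ! w" "w < length k"
  shows "at_coeff E k = 0"
  using assms
proof (induction E k rule: at_coeff.induct)
  case (1 k)
  then show ?case by (force simp: in_set_conv_nth)
next
  case (2 u v E k)
  have "at_coeff E (k[x := k ! x - 1]) = 0" if "k ! x \<noteq> 0" "x = u \<or> x = v" for x
  proof -
    have "edges_at w E < k[x := k ! x - 1] ! w"
    proof (cases "w = x")
      case True
      then have "Suc (edges_at w E) < k ! w" using 2(3) that by auto
      then show ?thesis using True 2(4) by simp
    next
      case False
      have "edges_at w E < k ! w" using 2(3) by (simp split: if_split_asm)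
      then show ?thesis using False by simp
    qed
    moreover have "w < length (k[x := k ! x - 1])" using 2(4) by simp
    ultimately show ?thesis using 2(1)[of] 2(2) that by blast
  qed
  then show ?case by simp
qed

lemma take_edge_sum:
  assumes "u < length k" "v < length k"
  shows "(\<Sum>(k, x)\<leftarrow>take_edge E u v w k x0 S. x * at_coeff E k)
    = (if k ! w = 0 then 0 else x0 * at_coeff E (k[w := k ! w - 1])) + (\<Sum>(k, x)\<leftarrow>S. x * at_coeff E k)"
  using assms at_coeff_eq_0[of u E "k[w := k ! w - 1]"] at_coeff_eq_0[of v E "k[w := k ! w - 1]"]
  by (auto simp: take_edge_def add_term_def merge_term_sum)

lemma merge_term_keys: "fst ` set (merge_term k x S) \<subseteq> insert k (fst ` set S)"
  by (induction k x S rule: merge_term.induct) auto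

lemma take_edge_keys:
  "\<forall>k'\<in>fst ` set (take_edge E u v w k x S). length k' = length k \<or> k' \<in> fst ` set S"
  using merge_term_keys[of "k[w := k ! w - 1]" x S] by (auto simp: take_edge_def add_term_def)

text \<open>Processing an edge preserves the sum over the table of entries times coefficients:
  merging only collects equal terms, and dropped terms contribute 0.\<close>

lemma at_table_eq:
  assumes "\<And>u v. (u, v) \<in> set E \<Longrightarrow> u < n \<and> v < n" "\<forall>k\<in>fst ` set S. length k = n"
  shows "at_table E S = (\<Sum>(k, x)\<leftarrow>S. x * at_coeff E k)"
  using assms
proof (induction E S rule: at_table.induct)
  case (1 S)
  show ?case by (induction S) auto
next
  case (2 u v E S)
  let ?F = "take_edges E u v"
  have uv: "u < n" "v < n" using 2(2) by auto
  have F: "(\<forall>k\<in>fst ` set (?F S). length k = n) \<and>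
      (\<Sum>(k, x)\<leftarrow>?F S. x * at_coeff E k) = (\<Sum>(k, x)\<leftarrow>S. x * at_coeff ((u, v) # E) k)"
    using 2(3)
  proof (induction S)
    case (Cons p S)
    obtain k x where p: "p = (k, x)" by fastforce
    have len: "length k = n" using Cons.prems p by auto
    let ?B = "take_edge E u v v k (- x) (?F S)"
    have "\<forall>k\<in>fst ` set (?F S). length k = n" using Cons by auto
    then have "\<forall>k\<in>fst ` set (take_edge E u v u k x ?B). length k = n"
      using take_edge_keys[of E u v u k x ?B] take_edge_keys[of E u v v k "- x" "?F S"] len by blast
    then show ?case
      using Cons uv len by (simp add: p take_edge_sum algebra_simps)
  qed simp
  have "at_table E (?F S) = (\<Sum>(k, x)\<leftarrow>?F S. x * at_coeff E k)"
    by (rule "2.IH") (use F "2.prems"(1) in auto)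
  then show ?case using F by simp
qed

section \<open>Small configurations that are colourable from given list sizes\<close>

definition list_choosable_config :: "(nat \<times> nat) list \<Rightarrow> nat list \<Rightarrow> bool" where
  "list_choosable_config E f \<longleftrightarrow> (\<forall>L. (\<forall>i<length f. finite (L i) \<and> f ! i \<le> card (L i)) \<longrightarrow>
     (\<exists>c. (\<forall>i<length f. c i \<in> (L i :: nat set)) \<and> (\<forall>(u, v)\<in>set E. c u \<noteq> c v)))"

text \<open>The equation of lengths is the degree condition of \<open>alon_tarsi\<close>, written
  without truncated subtraction; positivity of \<open>f\<close> makes \<open>x - 1\<close> a true
  predecessor.\<close>

definition at_check :: "(nat \<times> nat) list \<Rightarrow> nat list \<Rightarrow> bool" where
  "at_check E f \<longleftrightarrow> (\<forall>(u, v)\<in>set E. u < length f \<and> v < length f) \<and> (\<forall>x\<in>set f. 0 < x) \<and>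
     length E + length f = sum_list f \<and> at_table E [(map (\<lambda>x. x - 1) f, 1)] \<noteq> 0"

lemma at_check_sound:
  assumes "at_check E f"
  shows "list_choosable_config E f"
proof -
  let ?d = "map (\<lambda>x. x - 1) f"
  have pos: "\<forall>x\<in>set f. 0 < x" using assms by (simp add: at_check_def)
  then have "sum_list ?d + length f = sum_list f" by (induction f) auto
  moreover have "at_coeff E ?d \<noteq> 0"
    using assms at_table_eq[of E "length f" "[(?d, 1)]"] by (fastforce simp: at_check_def)
  ultimately have AT: "\<exists>c. (\<forall>i<length f. c i \<in> L i) \<and> (\<forall>(u, v)\<in>set E. c u \<noteq> c v)"
    if "\<And>i. i < length f \<Longrightarrow> finite (L i) \<and> ?d ! i < card (L i)" for L :: "nat \<Rightarrow> nat set"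
    using alon_tarsi[of E ?d L] that assms by (force simp: at_check_def)
  show ?thesis
    unfolding list_choosable_config_def
  proof (intro allI impI)
    fix L :: "nat \<Rightarrow> nat set"
    assume L: "\<forall>i<length f. finite (L i) \<and> f ! i \<le> card (L i)"
    have "f ! i - 1 < f ! i" if "i < length f" for i
      using pos that nth_mem by (metis diff_less zero_less_one)
    then show "\<exists>c. (\<forall>i<length f. c i \<in> L i) \<and> (\<forall>(u, v)\<in>set E. c u \<noteq> c v)"
      using L by (intro AT) (fastforce intro: less_le_trans)
  qed
qed

text \<open>The edges are listed in an order that keeps the tables short.\<close>

lemma diamond_choosable:
  "list_choosable_config [(0, 1), (0, 2), (0, 3), (1, 2), (1, 3)] [3, 2, 2, 2]"
  by (rule at_check_sound) code_simp

text \<open>The nonadjacent pairs are 0 and 1, 2 and 3, 4 and 5. All degrees are 4.\<close>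

lemma octahedron_choosable:
  "list_choosable_config
     [(0, 3), (3, 4), (3, 5), (0, 4), (0, 5), (0, 2), (2, 4), (2, 5), (1, 4), (1, 2), (1, 3), (1, 5)]
     [3, 3, 3, 3, 3, 3]"
  by (rule at_check_sound) code_simp

text \<open>The layers are {0, 1}, {2, 3}, {4, 5} and {6, 7}. Consecutive layers are completely
  joined, layers two apart are joined by a perfect matching, so degrees are 3 in the outer and 5 in
  the inner layers.\<close>

lemma double_layers_choosable:
  "list_choosable_config
     [(0, 3), (0, 2), (0, 4), (2, 4), (3, 4), (3, 7), (4, 7), (5, 7), (4, 6), (5, 6), (2, 6),
      (3, 5), (2, 5), (1, 3), (1, 2), (1, 5)]
     [2, 2, 4, 4, 4, 4, 2, 2]"
  by (rule at_check_sound) code_simp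

text \<open>Vertices 0, 1, 2 form the central triangle and have degree 6. Vertices 3, 4, 5 see two
  of them and have degree 4; the others see one of them and have degree 3.\<close>

lemma triangle_patch_choosable:
  "list_choosable_config
     [(6, 7), (7, 0), (6, 0), (3, 6), (7, 5), (10, 11), (10, 2), (11, 2), (11, 4), (5, 10), (5, 0),
      (5, 2), (0, 2), (3, 0), (0, 1), (4, 2), (1, 2), (4, 1), (3, 1), (4, 8), (9, 3), (8, 9),
      (9, 1), (8, 1)]
     [5, 5, 5, 3, 3, 3, 2, 2, 2, 2, 2, 2]"
  by (rule at_check_sound) code_simp

section \<open>Extending list colourings\<close>

definition list_colourable :: "('v \<Rightarrow> 'v set) \<Rightarrow> 'v set \<Rightarrow> ('v \<Rightarrow> nat set) \<Rightarrow> bool" where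
  "list_colourable N X L \<longleftrightarrow>
     (\<exists>c. (\<forall>v\<in>X. c v \<in> L v) \<and> (\<forall>u\<in>X. \<forall>v\<in>X. v \<in> N u \<longrightarrow> c u \<noteq> c v))"

text \<open>Outside \<open>X\<close> the vertices are coloured in the reverse of the order in which they are added.\<close>

lemma list_colourable_extend:
  fixes N :: "'v \<Rightarrow> 'v set"
  assumes V: "finite V" "X \<subseteq> V"
    and N: "\<And>u v. u \<in> V \<Longrightarrow> v \<in> N u \<Longrightarrow> u \<in> N v" "\<And>v. v \<in> V \<Longrightarrow> v \<notin> N v"
      "\<And>v. v \<in> V \<Longrightarrow> N v \<subseteq> V"
    and grow: "\<And>Y. X \<subseteq> Y \<Longrightarrow> Y \<subset> V \<Longrightarrow> \<exists>v\<in>V - Y. card (N v - Y) < k"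
    and base: "\<And>L. (\<And>v. v \<in> X \<Longrightarrow> finite (L v) \<and> k \<le> card (L v) + card (N v - X)) \<Longrightarrow>
      list_colourable N X L"
    and L: "\<And>v. v \<in> V \<Longrightarrow> finite (L v) \<and> k \<le> card (L v)"
  shows "list_colourable N V L"
proof -
  \<comment> \<open>In \<open>good Y\<close> each vertex of \<open>Y\<close> may have lost one
    colour for every neighbour outside \<open>Y\<close>, since those neighbours are coloured before
    it.\<close>
  define good where "good Y \<longleftrightarrow> (\<forall>L. (\<forall>v\<in>Y. finite (L v) \<and> k \<le> card (L v) + card (N v - Y)) \<longrightarrow>
    list_colourable N Y L)" for Y
  have finN: "finite (N v)" if "v \<in> V" for v using N(3)[OF that] V(1) finite_subset by blast
  have "good V" if "X \<subseteq> Y" "Y \<subseteq> V" "good Y" for Y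
    using that
  proof (induction "card (V - Y)" arbitrary: Y rule: less_induct)
    case less
    show ?case
    proof (cases "Y = V")
      case False
      then obtain v where v: "v \<in> V - Y" "card (N v - Y) < k" using grow[of Y] less.prems by blast
      have Nv: "N v - insert v Y = N v - Y" using N(2)[of v] v by auto
      have YV: "x \<in> V" if "x \<in> insert v Y" for x using that v less.prems by blast
      have "good (insert v Y)"
        unfolding good_def
      proof (intro allI impI)
        fix L :: "'v \<Rightarrow> nat set"
        assume L: "\<forall>x\<in>insert v Y. finite (L x) \<and> k \<le> card (L x) + card (N x - insert v Y)"
        then have "card (L v) \<noteq> 0" using v Nv by auto
        then obtain a where a: "a \<in> L v" by fastforce
        let ?L = "\<lambda>x. if x \<in> N v then L x - {a} else L x"
        have "finite (?L x) \<and> k \<le> card (?L x) + card (N x - Y)" if x: "x \<in> Y" for x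
        proof (cases "x \<in> N v")
          case True
          then have L': "?L x = L x - {a}" by (rule if_P)
          from True have "v \<in> N x" using N(1)[of v x] v(1) by blast
          then have "N x - Y = insert v (N x - insert v Y)" using v(1) by blast
          moreover have "finite (N x - insert v Y)" using finN YV x by blast
          moreover have "v \<notin> N x - insert v Y" by blast
          ultimately have "card (N x - Y) = Suc (card (N x - insert v Y))"
            using card_insert_disjoint by metis
          moreover have "card (L x) \<le> Suc (card (L x - {a}))"
            by (simp only: card_Diff_singleton_if split: if_split) arith
          moreover have "finite (L x) \<and> k \<le> card (L x) + card (N x - insert v Y)"
            using L x by blast
          ultimately show ?thesis unfolding L' by (metis add_Suc add_Suc_right add_le_mono1 finite_Diff order_trans)
        next
          case False
          then have L': "?L x = L x" by (rule if_not_P)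
          from False have "v \<notin> N x" using N(1)[of x v] YV x by blast
          then have "N x - Y = N x - insert v Y" by blast
          moreover have "finite (L x) \<and> k \<le> card (L x) + card (N x - insert v Y)"
            using L x by blast
          ultimately show ?thesis unfolding L' by metis
        qed
        then have "list_colourable N Y ?L"
          by (intro \<open>good Y\<close>[unfolded good_def, rule_format]) blast
        then obtain c where c: "\<And>x. x \<in> Y \<Longrightarrow> c x \<in> ?L x"
          "\<And>x y. x \<in> Y \<Longrightarrow> y \<in> Y \<Longrightarrow> y \<in> N x \<Longrightarrow> c x \<noteq> c y"
          unfolding list_colourable_def by blast
        have ca: "c x \<noteq> a" if "x \<in> Y" "x \<in> N v" for x using c(1)[OF that(1)] that by auto
        have "(c(v := a)) x \<in> L x" if "x \<in> insert v Y" for x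
          using that a c(1)[of x] by (cases "x = v") (auto split: if_split_asm)
        moreover have "(c(v := a)) x \<noteq> (c(v := a)) y"
          if xy: "x \<in> insert v Y" "y \<in> insert v Y" "y \<in> N x" for x y
        proof -
          have "x \<in> N y" using N(1)[OF YV[OF xy(1)] xy(3)] .
          moreover have "v \<notin> N v" using N(2)[of v] v by blast
          ultimately show ?thesis
            using xy c(2)[of x y] ca[of x] ca[of y] by (cases "x = v"; cases "y = v") auto
        qed
        ultimately show "list_colourable N (insert v Y) L" unfolding list_colourable_def by blast
      qed
      moreover have "V - insert v Y \<subset> V - Y" using v by blast
      then have "card (V - insert v Y) < card (V - Y)" using V(1) by (simp add: psubset_card_mono)
      ultimately show ?thesis using less.hyps[of "insert v Y"] less.prems(1,2) v by blast
    next
      case True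
      then show ?thesis using less.prems(3) by simp
    qed
  qed
  moreover have "good X" unfolding good_def using base by blast
  ultimately have "good V" using V by blast
  then show ?thesis using L unfolding good_def by (meson trans_le_add1)
qed

lemma list_colourable_degenerate:
  assumes "finite V"
    and "\<And>u v. u \<in> V \<Longrightarrow> v \<in> N u \<Longrightarrow> u \<in> N v" "\<And>v. v \<in> V \<Longrightarrow> v \<notin> N v"
      "\<And>v. v \<in> V \<Longrightarrow> N v \<subseteq> V"
    and "\<And>v. v \<in> V \<Longrightarrow> card (N v) < k"
    and "\<And>v. v \<in> V \<Longrightarrow> finite (L v) \<and> k \<le> card (L v)"
  shows "list_colourable N V L"
proof (rule list_colourable_extend[where X = "{}" and k = k])
  fix Y assume "Y \<subset> V"
  then obtain v where v: "v \<in> V - Y" by blast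
  have "finite (N v)" using assms(1,4) v finite_subset by blast
  then have "card (N v - Y) \<le> card (N v)" by (simp add: card_mono)
  then show "\<exists>v\<in>V - Y. card (N v - Y) < k" using v assms(5)[of v] by force
next
  fix L show "list_colourable N {} L" by (simp add: list_colourable_def)
qed (use assms(1-4,6) in blast)+

text \<open>Transfers a configuration on indices to the vertices placed by \<open>F\<close>. It
  suffices that \<open>E\<close> contains every adjacency among them (\<open>adj\<close>) and that
  outside neighbours cannot remove too many colours (\<open>size\<close>).\<close>

lemma config_list_colourable:
  fixes F :: "nat \<Rightarrow> 'v"
  assumes "list_choosable_config E f"
    and inj: "inj_on F {..<length f}"
    and adj: "\<And>i j. i < length f \<Longrightarrow> j < length f \<Longrightarrow> F j \<in> N (F i) \<Longrightarrow> (i, j) \<in> set E \<or> (j, i) \<in> set E"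
    and size: "\<And>i. i < length f \<Longrightarrow> f ! i + card (N (F i) - F ` {..<length f}) \<le> k"
    and L: "\<And>v. v \<in> F ` {..<length f} \<Longrightarrow>
      finite (L v) \<and> k \<le> card (L v) + card (N v - F ` {..<length f})"
  shows "list_colourable N (F ` {..<length f}) L"
proof -
  let ?n = "length f"
  have "finite (L (F i)) \<and> f ! i \<le> card (L (F i))" if "i < ?n" for i
    using size[OF that] L[of "F i"] that by fastforce
  then obtain c where c: "\<forall>i<?n. c i \<in> L (F i)" "\<forall>(u, v)\<in>set E. c u \<noteq> c v"
    using assms(1)[unfolded list_choosable_config_def, rule_format, of "\<lambda>i. L (F i)"] by blast
  let ?c = "\<lambda>v. c (the_inv_into {..<?n} F v)"
  have F: "?c (F i) = c i" if "i < ?n" for i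
    using that by (simp add: the_inv_into_f_f[OF inj])
  have "c i \<noteq> c j" if "i < ?n" "j < ?n" "F j \<in> N (F i)" for i j
    using adj[OF that] c(2) by fastforce
  then show ?thesis
    unfolding list_colourable_def by (intro exI[of _ ?c]) (auto simp: F c(1))
qed

lemma list_colourable_components:
  assumes "finite V"
    and N: "\<And>u v. v \<in> N u \<Longrightarrow> u \<in> N v"
    and C: "\<And>v. v \<in> V \<Longrightarrow> \<exists>C\<subseteq>V. v \<in> C \<and> (\<forall>u\<in>C. N u \<subseteq> C) \<and> list_colourable N C L"
  shows "list_colourable N V L"
proof -
  have "\<exists>U\<subseteq>V. W \<subseteq> U \<and> (\<forall>u\<in>U. N u \<subseteq> U) \<and> list_colourable N U L" if "finite W" "W \<subseteq> V" for W
    using that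
  proof (induction W rule: finite_induct)
    case empty
    then show ?case by (intro exI[of _ "{}"]) (simp add: list_colourable_def)
  next
    case (insert w W)
    then obtain U where U: "U \<subseteq> V" "W \<subseteq> U" "\<forall>u\<in>U. N u \<subseteq> U" "list_colourable N U L" by blast
    obtain D where D: "D \<subseteq> V" "w \<in> D" "\<forall>u\<in>D. N u \<subseteq> D" "list_colourable N D L"
      using C[of w] insert by blast
    obtain c where c: "\<forall>v\<in>U. c v \<in> L v" "\<forall>u\<in>U. \<forall>v\<in>U. v \<in> N u \<longrightarrow> c u \<noteq> c v"
      using U(4) unfolding list_colourable_def by blast
    obtain d where d: "\<forall>v\<in>D. d v \<in> L v" "\<forall>u\<in>D. \<forall>v\<in>D. v \<in> N u \<longrightarrow> d u \<noteq> d v"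
      using D(4) unfolding list_colourable_def by blast
    have "list_colourable N (U \<union> D) L"
      unfolding list_colourable_def
    proof (intro exI[of _ "\<lambda>v. if v \<in> U then c v else d v"] conjI ballI impI)
      fix u v assume uv: "u \<in> U \<union> D" "v \<in> U \<union> D" "v \<in> N u"
      \<comment> \<open>Closure of \<open>U\<close> under neighbours, in both directions by
        symmetry, keeps adjacent vertices in the same branch.\<close>
      then have "u \<in> U \<longleftrightarrow> v \<in> U" using U(3) N by blast
      then show "(if u \<in> U then c u else d u) \<noteq> (if v \<in> U then c v else d v)"
        using uv c(2) d(2) by auto
    qed (use c(1) d(1) in auto)
    then show ?case using U D by (intro exI[of _ "U \<union> D"]) auto
  qed
  from this[of V] show ?thesis using assms(1) by (metis order_antisym order_refl)
qed

section \<open>Quotients of the triangular lattice\<close>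

definition hex_dirs :: "(int \<times> int) list" where
  "hex_dirs = [(1, 0), (-1, 0), (0, 1), (0, -1), (1, 1), (-1, -1)]"

text \<open>\<open>P\<close> projects the triangular lattice, with edge directions (1, 0), (0, 1),
  (1, 1) and their negatives, onto a graph. By \<open>period\<close> its fibres are the cosets of a
  group of translations, and by \<open>colour\<close> these preserve the 3-colouring by coordinate
  sum modulo 3.\<close>

locale lattice_quotient =
  fixes N :: "'v \<Rightarrow> 'v set" and P :: "int \<times> int \<Rightarrow> 'v"
  assumes nbrs: "N (P z) = (\<lambda>g. P (z + g)) ` set hex_dirs"
    and period: "P z = P z' \<Longrightarrow> P (z + w) = P (z' + w)"
    and colour: "P z = P z' \<Longrightarrow> 3 dvd fst (z - z') + snd (z - z')"
begin

definition per :: "int \<times> int \<Rightarrow> bool" where "per d \<longleftrightarrow> P d = P 0"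

lemma P_eq_iff: "P z = P z' \<longleftrightarrow> per (z - z')"
  using period[of z z' "- z'"] period[of "z - z'" 0 z'] by (auto simp: per_def)

lemma per_uminus: "per (- d) \<longleftrightarrow> per d"
  using P_eq_iff[of 0 d] P_eq_iff[of d 0] by auto

lemma per_add: "per d \<Longrightarrow> per (d + e) \<longleftrightarrow> per e"
  using period[of d 0 e] by (simp add: per_def)

lemma per_colour: "per d \<Longrightarrow> 3 dvd fst d + snd d"
  using colour[of d 0] by (simp add: per_def)

lemma dirs_neg: "g \<in> set hex_dirs \<Longrightarrow> - g \<in> set hex_dirs"
  by (auto simp: hex_dirs_def)

lemma nbr_not_per: "g \<in> set hex_dirs \<Longrightarrow> \<not> per g"
  using per_colour[of g] by (auto simp: hex_dirs_def)

lemma nbrs_irrefl: "P z \<notin> N (P z)"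
  using P_eq_iff[of z "z + g" for g] nbr_not_per dirs_neg by (force simp: nbrs)

lemma nbrs_sym: "P z \<in> N (P z') \<Longrightarrow> P z' \<in> N (P z)"
proof -
  assume "P z \<in> N (P z')"
  then obtain g where g: "g \<in> set hex_dirs" "P z = P (z' + g)" by (auto simp: nbrs)
  then have "P (z + - g) = P z'" using period[of z "z' + g" "- g"] by simp
  then show ?thesis using dirs_neg[OF g(1)] by (auto simp: nbrs intro!: image_eqI[of _ _ "- g"])
qed

lemma card_nbrs: "card (N (P z)) \<le> 6"
  using card_image_le[of "set hex_dirs" "\<lambda>g. P (z + g)"] unfolding nbrs
  by (simp add: hex_dirs_def)

text \<open>Every triangle with two vertices in \<open>Y\<close> would lie in \<open>Y\<close>, and so would the whole lattice.\<close>

lemma lattice_grow: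
  assumes "P z \<in> Y" "P (z + (1, 0)) \<in> Y" "Y \<subset> range P"
  shows "\<exists>v\<in>range P - Y. card (N v - Y) < 5"
proof (rule ccontr)
  assume none: "\<not> ?thesis"
  \<comment> \<open>A vertex outside \<open>Y\<close> with two adjacent, hence distinct, neighbours
    in \<open>Y\<close> would have at most four neighbours outside \<open>Y\<close>.\<close>
  have tri: "P z \<in> Y" if "g \<in> set hex_dirs" "h \<in> set hex_dirs" "h - g \<in> set hex_dirs"
    "P (z + g) \<in> Y" "P (z + h) \<in> Y" for z g h
  proof (rule ccontr)
    assume "P z \<notin> Y"
    have "P (z + g) \<noteq> P (z + h)"
      using nbr_not_per[OF that(3)] P_eq_iff[of "z + h" "z + g"] by (metis add_diff_cancel_left)
    then have "card {P (z + g), P (z + h)} = 2" by simp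
    moreover have "N (P z) - Y \<subseteq> N (P z) - {P (z + g), P (z + h)}" using that by blast
    then have "card (N (P z) - Y) \<le> card (N (P z) - {P (z + g), P (z + h)})"
      by (intro card_mono) (auto simp: nbrs)
    moreover have "{P (z + g), P (z + h)} \<subseteq> N (P z)" using that by (auto simp: nbrs)
    ultimately have "card (N (P z) - Y) \<le> card (N (P z)) - 2"
      by (simp add: card_Diff_subset nbrs)
    then show False using none \<open>P z \<notin> Y\<close> card_nbrs[of z] by force
  qed
  define Q where "Q z \<longleftrightarrow> P z \<in> Y \<and> P (z + (1, 0)) \<in> Y" for z
  have up: "Q (x + 1, y) \<and> Q (x, y + 1)" and down: "Q (x - 1, y) \<and> Q (x, y - 1)" if "Q (x, y)" for x y
  proof -
    have 0: "P (x, y) \<in> Y" "P (x + 1, y) \<in> Y" using that by (auto simp: Q_def)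
    have 1: "P (x + 1, y + 1) \<in> Y"
      using tri[of "(-1, -1)" "(0, -1)" "(x + 1, y + 1)"] 0 by (simp add: hex_dirs_def algebra_simps)
    have 2: "P (x, y + 1) \<in> Y"
      using tri[of "(0, -1)" "(1, 0)" "(x, y + 1)"] 0 1 by (simp add: hex_dirs_def algebra_simps)
    have 3: "P (x + 2, y + 1) \<in> Y"
      using tri[of "(-1, -1)" "(-1, 0)" "(x + 2, y + 1)"] 0 1 by (simp add: hex_dirs_def algebra_simps)
    have 4: "P (x + 2, y) \<in> Y"
      using tri[of "(-1, 0)" "(0, 1)" "(x + 2, y)"] 0 3 by (simp add: hex_dirs_def algebra_simps)
    have 5: "P (x, y - 1) \<in> Y"
      using tri[of "(0, 1)" "(1, 1)" "(x, y - 1)"] 0 by (simp add: hex_dirs_def algebra_simps)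
    have 6: "P (x - 1, y - 1) \<in> Y"
      using tri[of "(1, 0)" "(1, 1)" "(x - 1, y - 1)"] 0 5 by (simp add: hex_dirs_def algebra_simps)
    have 7: "P (x - 1, y) \<in> Y"
      using tri[of "(0, -1)" "(1, 0)" "(x - 1, y)"] 0 6 by (simp add: hex_dirs_def algebra_simps)
    have 8: "P (x + 1, y - 1) \<in> Y"
      using tri[of "(0, 1)" "(-1, 0)" "(x + 1, y - 1)"] 0 5 by (simp add: hex_dirs_def algebra_simps)
    show "Q (x + 1, y) \<and> Q (x, y + 1)" using 0 1 2 4 by (simp add: Q_def add.commute)
    show "Q (x - 1, y) \<and> Q (x, y - 1)" using 0 5 7 8 by (simp add: Q_def add.commute)
  qed
  have x: "Q (i, snd z)" for i
    by (induction i rule: int_induct[where k = "fst z"])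
      (use assms up down in \<open>auto simp: Q_def\<close>)
  have "Q (i, j)" for i j
    by (induction j rule: int_induct[where k = "snd z"]) (use x up down in auto)
  then have "range P \<subseteq> Y" by (auto simp: Q_def)
  then show False using assms by blast
qed

end

section \<open>Induced configurations in a lattice quotient\<close>

definition sub2 :: "int \<times> int \<Rightarrow> int \<times> int \<Rightarrow> int \<times> int" where
  "sub2 z w = (fst z - fst w, snd z - snd w)"

definition add2 :: "int \<times> int \<Rightarrow> int \<times> int \<Rightarrow> int \<times> int" where
  "add2 z w = (fst z + fst w, snd z + snd w)"

text \<open>It is settled whether \<open>d\<close> is a period: a coordinate sum not divisible by 3
  excludes it by \<open>per_colour\<close>, and any other \<open>d\<close> has to be listed as a
  period in \<open>qs\<close> or as a nonperiod in \<open>rs\<close>.\<close>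

definition known :: "(int \<times> int) list \<Rightarrow> (int \<times> int) list \<Rightarrow> int \<times> int \<Rightarrow> bool" where
  "known qs rs d \<longleftrightarrow> \<not> 3 dvd fst d + snd d \<or> d \<in> set qs \<or> d \<in> set rs"

definition known_adjacency where
  "known_adjacency E qs rs i j d \<longleftrightarrow>
     known qs rs d \<and> (d \<in> set qs \<longrightarrow> (i, j) \<in> set E \<or> (j, i) \<in> set E)"

text \<open>
  The configuration \<open>(E, f)\<close> is an induced subgraph at the points \<open>F\<close>, given that \<open>qs\<close> are
  periods and \<open>rs\<close> are not.
\<close>

definition placement_check where
  "placement_check E f F qs rs \<longleftrightarrow> length F = length f \<and>
     (\<forall>i\<in>set [0..<length f]. \<forall>j\<in>set [0..<length f].
        known qs rs (sub2 (F ! i) (F ! j)) \<and> (i = j \<or> sub2 (F ! i) (F ! j) \<notin> set qs) \<and>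
        (\<forall>g\<in>set hex_dirs. known_adjacency E qs rs i j (sub2 (add2 (F ! i) g) (F ! j)))) \<and>
     (\<forall>i\<in>set [0..<length f]. f ! i + length (filter (\<lambda>g. \<forall>j\<in>set [0..<length f].
        sub2 (add2 (F ! i) g) (F ! j) \<notin> set qs) hex_dirs) \<le> 5) \<and>
     (\<exists>i\<in>set [0..<length f]. \<exists>j\<in>set [0..<length f]. F ! j = add2 (F ! i) (1, 0))"

context lattice_quotient
begin

text \<open>Equality and adjacency of placed vertices amount to certain differences being periods,
  and the check settles all of them. The rest of the quotient is then added by
  \<open>lattice_grow\<close>, starting from a placed edge in direction (1, 0).\<close>

lemma placement_colourable:
  assumes config: "list_choosable_config E f" and chk: "placement_check E f F qs rs"
    and qs: "\<And>d. d \<in> set qs \<Longrightarrow> per d" and rs: "\<And>d. d \<in> set rs \<Longrightarrow> \<not> per d"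
    and fin: "finite (range P)"
    and L: "\<And>v. v \<in> range P \<Longrightarrow> finite (L v) \<and> 5 \<le> card (L v)"
  shows "list_colourable N (range P) L"
proof -
  let ?n = "length f" and ?F = "\<lambda>i. P (F ! i)"
  let ?X = "?F ` {..<?n}"
  have ops: "sub2 z w = z - w" "add2 z w = z + w" for z w
    by (auto simp: sub2_def add2_def minus_prod_def plus_prod_def)
  have kn: "per d \<longleftrightarrow> d \<in> set qs" if "known qs rs d" for d
    using that qs[of d] rs[of d] per_colour[of d] unfolding known_def by blast
  have pair: "known qs rs (F ! i - F ! j)" "i = j \<or> F ! i - F ! j \<notin> set qs"
    "\<And>g. g \<in> set hex_dirs \<Longrightarrow> known qs rs (F ! i + g - F ! j) \<and>
       (F ! i + g - F ! j \<in> set qs \<longrightarrow> (i, j) \<in> set E \<or> (j, i) \<in> set E)"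
    if "i < ?n" "j < ?n" for i j
  proof -
    have "i \<in> set [0..<?n]" "j \<in> set [0..<?n]" using that by auto
    then show "known qs rs (F ! i - F ! j)" "i = j \<or> F ! i - F ! j \<notin> set qs"
      "\<And>g. g \<in> set hex_dirs \<Longrightarrow> known qs rs (F ! i + g - F ! j) \<and>
        (F ! i + g - F ! j \<in> set qs \<longrightarrow> (i, j) \<in> set E \<or> (j, i) \<in> set E)"
      using chk unfolding placement_check_def ops known_adjacency_def by blast+
  qed
  have c1: "i = j" if "i < ?n" "j < ?n" "?F i = ?F j" for i j
    using pair(1,2)[OF that(1,2)] kn[of "F ! i - F ! j"] that(3) unfolding P_eq_iff by blast
  have c2: "(P (F ! i + g) = ?F j \<longleftrightarrow> F ! i + g - F ! j \<in> set qs) \<and>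
      (P (F ! i + g) = ?F j \<longrightarrow> (i, j) \<in> set E \<or> (j, i) \<in> set E)"
    if "i < ?n" "j < ?n" "g \<in> set hex_dirs" for i j g
    using pair(3)[OF that] kn[of "F ! i + g - F ! j"] unfolding P_eq_iff by blast
  show ?thesis
  proof (rule list_colourable_extend[where X = ?X and k = 5])
    show "finite (range P)" by fact
    show "?X \<subseteq> range P" by auto
  next
    show "\<exists>v\<in>range P - Y. card (N v - Y) < 5" if "?X \<subseteq> Y" "Y \<subset> range P" for Y
    proof -
      obtain i j where "i < ?n" "j < ?n" "F ! j = F ! i + (1, 0)"
        using chk unfolding placement_check_def ops by auto
      then show ?thesis using lattice_grow[of "F ! i" Y] that by force
    qed
  next
    fix L :: "'v \<Rightarrow> nat set"
    assume L: "\<And>v. v \<in> ?X \<Longrightarrow> finite (L v) \<and> 5 \<le> card (L v) + card (N v - ?X)"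
    show "list_colourable N ?X L"
    proof (rule config_list_colourable[OF config, where k = 5])
      show "inj_on ?F {..<?n}" using c1 by (auto intro: inj_onI)
      show "(i, j) \<in> set E \<or> (j, i) \<in> set E" if "i < ?n" "j < ?n" "?F j \<in> N (?F i)" for i j
        using that c2[OF that(1,2)] by (auto simp: nbrs)
      show "f ! i + card (N (?F i) - ?X) \<le> 5" if i: "i < ?n" for i
      proof -
        let ?G = "filter (\<lambda>g. \<forall>j\<in>set [0..<?n]. F ! i + g - F ! j \<notin> set qs) hex_dirs"
        have "N (?F i) - ?X \<subseteq> (\<lambda>g. P (F ! i + g)) ` set ?G"
        proof
          fix v assume v: "v \<in> N (?F i) - ?X"
          then obtain g where g: "g \<in> set hex_dirs" "v = P (F ! i + g)" by (auto simp: nbrs)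
          moreover have "F ! i + g - F ! j \<notin> set qs" if "j < ?n" for j
            using c2[OF i that g(1)] v g that by blast
          ultimately show "v \<in> (\<lambda>g. P (F ! i + g)) ` set ?G" by auto
        qed
        then have "card (N (?F i) - ?X) \<le> card ((\<lambda>g. P (F ! i + g)) ` set ?G)"
          by (intro card_mono) auto
        also have "\<dots> \<le> card (set ?G)" by (rule card_image_le) simp
        also have "\<dots> \<le> length ?G" by (rule card_length)
        finally have "card (N (?F i) - ?X) \<le> length ?G" .
        moreover have "f ! i + length ?G \<le> 5"
        proof -
          have "i \<in> set [0..<?n]" using i by auto
          then show ?thesis using chk unfolding placement_check_def ops by blast
        qed
        ultimately show ?thesis by linarith
      qed
    qed (fact L)
  next
    show "u \<in> N v" if "u \<in> range P" "v \<in> N u" for u v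
    proof -
      from that obtain z g where "u = P z" "v = P (z + g)" "g \<in> set hex_dirs" by (auto simp: nbrs)
      then show ?thesis using nbrs_sym[of "z + g" z] that by simp
    qed
    show "v \<notin> N v" if "v \<in> range P" for v using that nbrs_irrefl by auto
    show "N v \<subseteq> range P" if "v \<in> range P" for v using that nbrs by auto
    show "finite (L v) \<and> 5 \<le> card (L v)" if "v \<in> range P" for v using that by (rule L)
  qed
qed

text \<open>The period identifies the neighbours in directions (1, 0) and (0, 1), and likewise the
  opposite ones. At most four neighbours remain, so greedy colouring works.\<close>

lemma list_colourable_if_per:
  assumes "per (1, -1)" and fin: "finite (range P)"
    and L: "\<And>v. v \<in> range P \<Longrightarrow> finite (L v) \<and> 5 \<le> card (L v)"
  shows "list_colourable N (range P) L"
proof (rule list_colourable_degenerate[where k = 5])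
  show "card (N v) < 5" if "v \<in> range P" for v
  proof -
    from that obtain z where z: "v = P z" by blast
    have "P (z + (1, 0)) = P (z + (0, 1))" "P (z + (0, -1)) = P (z + (-1, 0))"
      using assms(1) by (simp_all add: P_eq_iff)
    then have "N v = {P (z + (1, 0)), P (z + (-1, 0)), P (z + (1, 1)), P (z + (-1, -1))}"
      unfolding z nbrs by (auto simp: hex_dirs_def)
    also have "card \<dots> \<le> 4" by (simp add: card_insert_if)
    finally show ?thesis by simp
  qed
  show "u \<in> N v" if "u \<in> range P" "v \<in> N u" for u v
  proof -
    from that obtain z g where "u = P z" "v = P (z + g)" "g \<in> set hex_dirs" by (auto simp: nbrs)
    then show ?thesis using nbrs_sym[of "z + g" z] that by simp
  qed
  show "v \<notin> N v" if "v \<in> range P" for v using that nbrs_irrefl by auto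
  show "N v \<subseteq> range P" if "v \<in> range P" for v using that nbrs by auto
qed (fact fin, rule L)

end

section \<open>The rotation of order three\<close>

definition turn :: "int \<times> int \<Rightarrow> int \<times> int" where "turn z = (- snd z, fst z - snd z)"

lemma turn_add: "turn (z + w) = turn z + turn w"
  by (simp add: turn_def plus_prod_def)

lemma turn_turn_turn: "turn (turn (turn z)) = z"
  by (simp add: turn_def)

context lattice_quotient
begin

lemma range_turn: "range (\<lambda>z. P (turn z)) = range P"
proof -
  have "surj turn" by (rule surjI[of _ "\<lambda>z. turn (turn z)"]) (rule turn_turn_turn)
  then show ?thesis by (metis image_image)
qed

text \<open>\<open>turn\<close> carries (1, 0) to (0, 1) to (-1, -1). It is the rotation of the
  lattice by 120 degrees, so it permutes the edge directions, and it preserves divisibility of the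
  coordinate sum by 3.\<close>

lemma lattice_quotient_turn: "lattice_quotient N (\<lambda>z. P (turn z))"
proof
  fix z z' w
  have "turn ` set hex_dirs = set hex_dirs" by (auto simp: hex_dirs_def turn_def)
  then show "N (P (turn z)) = (\<lambda>g. P (turn (z + g))) ` set hex_dirs"
    unfolding turn_add nbrs by (metis (no_types, lifting) image_cong image_image)
  assume eq: "P (turn z) = P (turn z')"
  then show "P (turn (z + w)) = P (turn (z' + w))" unfolding turn_add by (rule period)
  have "3 dvd fst (turn z - turn z') + snd (turn z - turn z')" using eq by (rule colour)
  then show "3 dvd fst (z - z') + snd (z - z')" by (simp add: turn_def) presburger
qed

lemma per_turn: "lattice_quotient.per (\<lambda>z. P (turn z)) d \<longleftrightarrow> per (turn d)"
proof -
  have "turn 0 = 0" by (simp add: turn_def zero_prod_def)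
  then show ?thesis unfolding lattice_quotient.per_def[OF lattice_quotient_turn] per_def by (simp only:)
qed

end

context lattice_quotient
begin

text \<open>A period may be assumed to point in one chosen direction out of three. \<open>Q\<close>
  stands for hypotheses on the set of vertices, which a change of coordinates leaves alone.\<close>

lemma list_colourable_by_turning:
  assumes main: "\<And>P :: int \<times> int \<Rightarrow> 'v. lattice_quotient N P \<Longrightarrow> lattice_quotient.per P d \<Longrightarrow>
      finite (range P) \<Longrightarrow> Q (range P) \<Longrightarrow> list_colourable N (range P) L"
    and "per d \<or> per (turn d) \<or> per (turn (turn d))" and "finite (range P)" "Q (range P)"
  shows "list_colourable N (range P) L"
proof -
  interpret P1: lattice_quotient N "\<lambda>z. P (turn z)" by (rule lattice_quotient_turn)
  have L2: "lattice_quotient N (\<lambda>z. P (turn (turn z)))" by (rule P1.lattice_quotient_turn)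
  have r2: "range (\<lambda>z. P (turn (turn z))) = range P" using P1.range_turn range_turn by simp
  from assms(2) consider "per d" | "P1.per d" | "lattice_quotient.per (\<lambda>z. P (turn (turn z))) d"
    unfolding per_turn P1.per_turn by blast
  then show ?thesis
  proof cases
    case 1
    then show ?thesis using main lattice_quotient_axioms assms(3,4) by blast
  next
    case 2
    show ?thesis
      using main[OF P1.lattice_quotient_axioms 2] assms(3,4) unfolding range_turn by blast
  next
    case 3
    show ?thesis using main[OF L2 3] assms(3,4) unfolding r2 by blast
  qed
qed

end

section \<open>Case distinction by short periods\<close>

lemma octahedron_placement: "placement_check
    [(0, 3), (3, 4), (3, 5), (0, 4), (0, 5), (0, 2), (2, 4), (2, 5), (1, 4), (1, 2), (1, 3), (1, 5)]
    [3, 3, 3, 3, 3, 3]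
    [(0, 0), (2, 1), (1, 0), (0, 1), (2, 0), (1, 1)]
    [(0, 0), (3, 0), (-3, 0)]
    [(1, -1), (-1, 1), (1, 2), (-1, -2), (2, 1), (-2, -1), (2, -2), (-2, 2), (4, 2), (-4, -2)]"
  by code_simp

lemma double_layers_placement: "placement_check
    [(0, 3), (0, 2), (0, 4), (2, 4), (3, 4), (3, 7), (4, 7), (5, 7), (4, 6), (5, 6), (2, 6),
      (3, 5), (2, 5), (1, 3), (1, 2), (1, 5)]
    [2, 2, 4, 4, 4, 4, 2, 2]
    [(0, 0), (1, -1), (1, 0), (2, -1), (1, 1), (2, 0), (2, 1), (3, 0)]
    [(0, 0), (2, -2), (-2, 2)]
    [(1, -1), (-1, 1), (1, 2), (-1, -2), (2, 1), (-2, -1), (3, 0), (-3, 0), (0, 3), (0, -3), (3, 3), (-3, -3)]"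
  by code_simp

lemma triangle_patch_placement: "placement_check
     [(6, 7), (7, 0), (6, 0), (3, 6), (7, 5), (10, 11), (10, 2), (11, 2), (11, 4), (5, 10), (5, 0),
      (5, 2), (0, 2), (3, 0), (0, 1), (4, 2), (1, 2), (4, 1), (3, 1), (4, 8), (9, 3), (8, 9),
      (9, 1), (8, 1)]
     [5, 5, 5, 3, 3, 3, 2, 2, 2, 2, 2, 2]
     [(0, 0), (1, 0), (1, 1), (0, -1), (2, 1), (0, 1), (-1, -1), (-1, 0), (2, 0), (1, -1), (1, 2), (2, 2)]
     [(0, 0)]
     [(1, -1), (-1, 1), (1, 2), (-1, -2), (2, 1), (-2, -1), (3, 0), (-3, 0), (0, 3), (0, -3), (3, 3), (-3, -3),
      (2, -2), (-2, 2), (2, 4), (-2, -4), (4, 2), (-4, -2)]"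
  by code_simp

context lattice_quotient
begin

text \<open>Up to sign the three periods form one orbit of \<open>turn\<close>.\<close>

lemma list_colourable_if_two_equal_dirs:
  assumes "per (1, -1) \<or> per (1, 2) \<or> per (2, 1)" and fin: "finite (range P)"
    and L: "\<forall>v\<in>range P. finite (L v) \<and> 5 \<le> card (L v)"
  shows "list_colourable N (range P) L"
proof (rule list_colourable_by_turning[where d = "(1, -1)" and
      Q = "\<lambda>R. \<forall>v\<in>R. finite (L v) \<and> 5 \<le> card (L v)"])
  show "per (1, -1) \<or> per (turn (1, -1)) \<or> per (turn (turn (1, -1)))"
    using assms(1) per_uminus[of "(2, 1)"] by (auto simp: turn_def)
  show "list_colourable N (range P) L"
    if "lattice_quotient N P" "lattice_quotient.per P (1, -1)" "finite (range P)"
      "\<forall>v\<in>range P. finite (L v) \<and> 5 \<le> card (L v)"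
    for P :: "int \<times> int \<Rightarrow> 'v"
    using lattice_quotient.list_colourable_if_per[OF that(1-3)] that(4) by blast
qed (rule fin, rule L)

text \<open>Lines in direction (1, 0) close up to 3-cycles, and two adjacent lines form the
  octahedron.\<close>

lemma list_colourable_if_order_3:
  assumes p: "per (3, 0)" and fin: "finite (range P)"
    and L: "\<forall>v\<in>range P. finite (L v) \<and> 5 \<le> card (L v)"
  shows "list_colourable N (range P) L"
proof (cases "per (1, -1) \<or> per (1, 2) \<or> per (2, 1)")
  case True
  then show ?thesis using list_colourable_if_two_equal_dirs fin L by blast
next
  case False
  show ?thesis
  proof (rule placement_colourable[OF octahedron_choosable octahedron_placement _ _ fin])
    show "per d" if "d \<in> set [(0, 0), (3, 0), (-3, 0)]" for d
      using that p per_uminus[of "(3, 0)"] by (auto simp: per_def zero_prod_def)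
    \<comment> \<open>Modulo (3, 0) the points (2, -2) and (4, 2) are (-1, -2) and (1, 2), which are
      already excluded.\<close>
    show "\<not> per d" if "d \<in> set [(1, -1), (-1, 1), (1, 2), (-1, -2), (2, 1), (-2, -1), (2, -2),
        (-2, 2), (4, 2), (-4, -2)]" for d
      using that False per_uminus[of "(1, -1)"] per_uminus[of "(1, 2)"] per_uminus[of "(2, 1)"]
        per_uminus[of "(2, -2)"] per_uminus[of "(4, 2)"]
        per_add[OF p, of "(-1, -2)"] per_add[OF p, of "(1, 2)"] by auto
  qed (use L in blast)
qed

lemma list_colourable_if_order_3':
  assumes "per (3, 0) \<or> per (0, 3) \<or> per (3, 3)" and fin: "finite (range P)"
    and L: "\<forall>v\<in>range P. finite (L v) \<and> 5 \<le> card (L v)"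
  shows "list_colourable N (range P) L"
proof (rule list_colourable_by_turning[where d = "(3, 0)" and
      Q = "\<lambda>R. \<forall>v\<in>R. finite (L v) \<and> 5 \<le> card (L v)"])
  show "per (3, 0) \<or> per (turn (3, 0)) \<or> per (turn (turn (3, 0)))"
    using assms(1) per_uminus[of "(3, 3)"] by (auto simp: turn_def)
  show "list_colourable N (range P) L"
    if "lattice_quotient N P" "lattice_quotient.per P (3, 0)" "finite (range P)"
      "\<forall>v\<in>range P. finite (L v) \<and> 5 \<le> card (L v)"
    for P :: "int \<times> int \<Rightarrow> 'v"
    using lattice_quotient.list_colourable_if_order_3[OF that] .
qed (rule fin, rule L)

text \<open>The points of a fixed coordinate sum form a line in direction (1, -1) on which the
  colour is constant. This period leaves at most two vertices on it; four consecutive lines carry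
  the double layers.\<close>

lemma list_colourable_if_order_2:
  assumes p: "per (2, -2)" and fin: "finite (range P)"
    and L: "\<forall>v\<in>range P. finite (L v) \<and> 5 \<le> card (L v)"
  shows "list_colourable N (range P) L"
proof (cases "per (1, -1) \<or> per (1, 2) \<or> per (2, 1) \<or> per (3, 0) \<or> per (0, 3) \<or> per (3, 3)")
  case True
  then show ?thesis
    using list_colourable_if_two_equal_dirs list_colourable_if_order_3' fin L by blast
next
  case False
  show ?thesis
  proof (rule placement_colourable[OF double_layers_choosable double_layers_placement _ _ fin])
    show "per d" if "d \<in> set [(0, 0), (2, -2), (-2, 2)]" for d
      using that p per_uminus[of "(2, -2)"] by (auto simp: per_def zero_prod_def)
    show "\<not> per d" if "d \<in> set [(1, -1), (-1, 1), (1, 2), (-1, -2), (2, 1), (-2, -1), (3, 0),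
        (-3, 0), (0, 3), (0, -3), (3, 3), (-3, -3)]" for d
      using that False per_uminus[of "(1, -1)"] per_uminus[of "(1, 2)"] per_uminus[of "(2, 1)"]
        per_uminus[of "(3, 0)"] per_uminus[of "(0, 3)"] per_uminus[of "(3, 3)"] by auto
  qed (use L in blast)
qed

theorem list_colourable_5:
  assumes fin: "finite (range P)" and L: "\<forall>v\<in>range P. finite (L v) \<and> 5 \<le> card (L v)"
  shows "list_colourable N (range P) L"
proof (cases "per (2, -2) \<or> per (2, 4) \<or> per (4, 2)")
  case True
  show ?thesis
  proof (rule list_colourable_by_turning[where d = "(2, -2)" and
        Q = "\<lambda>R. \<forall>v\<in>R. finite (L v) \<and> 5 \<le> card (L v)"])
    show "per (2, -2) \<or> per (turn (2, -2)) \<or> per (turn (turn (2, -2)))"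
      using True per_uminus[of "(4, 2)"] by (auto simp: turn_def)
    show "list_colourable N (range P) L"
      if "lattice_quotient N P" "lattice_quotient.per P (2, -2)" "finite (range P)"
        "\<forall>v\<in>range P. finite (L v) \<and> 5 \<le> card (L v)"
      for P :: "int \<times> int \<Rightarrow> 'v"
      using lattice_quotient.list_colourable_if_order_2[OF that] .
  qed (rule fin, rule L)
next
  case no_order_2: False
  show ?thesis
  proof (cases "per (1, -1) \<or> per (1, 2) \<or> per (2, 1) \<or> per (3, 0) \<or> per (0, 3) \<or> per (3, 3)")
    case True
    then show ?thesis
      using list_colourable_if_two_equal_dirs list_colourable_if_order_3' fin L by blast
  next
    case False
    show ?thesis
    proof (rule placement_colourable[OF triangle_patch_choosable triangle_patch_placement _ _ fin])
      show "per d" if "d \<in> set [(0, 0)]" for d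
        using that by (auto simp: per_def zero_prod_def)
      \<comment> \<open>The list covers every nonzero displacement with coordinate sum divisible by
        3 from a point of the patch to another point of the patch or to a neighbour of one.\<close>
      show "\<not> per d" if "d \<in> set [(1, -1), (-1, 1), (1, 2), (-1, -2), (2, 1), (-2, -1), (3, 0),
          (-3, 0), (0, 3), (0, -3), (3, 3), (-3, -3), (2, -2), (-2, 2), (2, 4), (-2, -4),
          (4, 2), (-4, -2)]" for d
        using that False no_order_2 per_uminus[of "(1, -1)"] per_uminus[of "(1, 2)"]
          per_uminus[of "(2, 1)"] per_uminus[of "(3, 0)"] per_uminus[of "(0, 3)"]
          per_uminus[of "(3, 3)"] per_uminus[of "(2, -2)"] per_uminus[of "(2, 4)"]
          per_uminus[of "(4, 2)"] by auto
    qed (use L in blast)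
  qed
qed

end

section \<open>Combinatorial maps with triangular faces\<close>

lemma int_pair_induct:
  fixes Q :: "int \<times> int \<Rightarrow> bool"
  assumes "Q 0" and "\<And>w. Q w \<longleftrightarrow> Q (w + (1, 0))" and "\<And>w. Q w \<longleftrightarrow> Q (w + (0, 1))"
  shows "Q w"
proof -
  have x: "Q (i, 0)" for i
  proof (induction i rule: int_induct[where k = 0])
    case base
    then show ?case using assms(1) by (simp add: zero_prod_def)
  next
    case (step1 i)
    then show ?case using assms(2)[of "(i, 0)"] by simp
  next
    case (step2 i)
    then show ?case using assms(2)[of "(i - 1, 0)"] by simp
  qed
  have "Q (i, j)" for i j
  proof (induction j rule: int_induct[where k = 0])
    case base
    then show ?case by (rule x)
  next
    case (step1 j)
    then show ?case using assms(3)[of "(i, j)"] by simp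
  next
    case (step2 j)
    then show ?case using assms(3)[of "(i, j - 1)"] by simp
  qed
  then show ?thesis by (cases w) simp
qed

definition int_funpow :: "('d \<Rightarrow> 'd) \<Rightarrow> ('d \<Rightarrow> 'd) \<Rightarrow> int \<Rightarrow> 'd \<Rightarrow> 'd" where
  "int_funpow f g i = (if 0 \<le> i then f ^^ nat i else g ^^ nat (- i))"

lemma int_funpow_closed:
  assumes "\<And>d. d \<in> D \<Longrightarrow> f d \<in> D" "\<And>d. d \<in> D \<Longrightarrow> g d \<in> D" "d \<in> D"
  shows "int_funpow f g i d \<in> D"
proof -
  have "(f ^^ n) d \<in> D" "(g ^^ n) d \<in> D" for n by (induction n) (auto simp: assms)
  then show ?thesis by (simp add: int_funpow_def)
qed

lemma int_funpow_add1:
  assumes "\<And>d. d \<in> D \<Longrightarrow> g d \<in> D" "\<And>d. d \<in> D \<Longrightarrow> f (g d) = d" "d \<in> D"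
  shows "int_funpow f g (i + 1) d = f (int_funpow f g i d)"
proof (cases "0 \<le> i")
  case True
  then have "nat (i + 1) = Suc (nat i)" by simp
  then show ?thesis using True by (simp add: int_funpow_def)
next
  case False
  define n where "n = nat (- i) - 1"
  have n: "nat (- i) = Suc n" "nat (- (i + 1)) = n" using False by (auto simp: n_def)
  have gD: "(g ^^ n) d \<in> D" for n by (induction n) (auto simp: assms)
  have "int_funpow f g (i + 1) d = (g ^^ n) d"
    using n False by (cases "i + 1 = 0") (auto simp: int_funpow_def)
  also have "\<dots> = f (int_funpow f g i d)"
    using assms(2)[OF gD] n False by (simp add: int_funpow_def)
  finally show ?thesis .
qed

text \<open>\<open>next_dart\<close> walks around a triangular face and \<open>opp\<close> reverses
  a dart. \<open>one_cycle\<close> says that the darts at a vertex form a single orbit of the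
  rotation, which rules out pinched vertices.\<close>

locale triangular_map =
  fixes D :: "'d set" and vert :: "'d \<Rightarrow> 'v" and opp next_dart :: "'d \<Rightarrow> 'd"
  assumes fin: "finite D"
    and opp: "d \<in> D \<Longrightarrow> opp d \<in> D" "d \<in> D \<Longrightarrow> opp (opp d) = d"
    and next_dart: "d \<in> D \<Longrightarrow> next_dart d \<in> D"
      "d \<in> D \<Longrightarrow> next_dart (next_dart (next_dart d)) = d"
    and vert_next: "d \<in> D \<Longrightarrow> vert (next_dart d) = vert (opp d)"
    and no_loop: "d \<in> D \<Longrightarrow> vert (opp d) \<noteq> vert d"
    and one_cycle: "Q \<subseteq> {d \<in> D. vert d = v} \<Longrightarrow> Q \<noteq> {} \<Longrightarrow>
      (\<And>d. d \<in> Q \<Longrightarrow> opp (next_dart (next_dart d)) \<in> Q) \<Longrightarrow> Q = {d \<in> D. vert d = v}"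
    and degree_6: "d \<in> D \<Longrightarrow> card {e \<in> D. vert e = vert d} = 6"
begin

definition rot where "rot d = opp (next_dart (next_dart d))"
definition unrot where "unrot d = next_dart (opp d)"

lemma rot [simp]: "d \<in> D \<Longrightarrow> rot d \<in> D" "d \<in> D \<Longrightarrow> unrot d \<in> D"
  "d \<in> D \<Longrightarrow> rot (unrot d) = d" "d \<in> D \<Longrightarrow> unrot (rot d) = d"
  "d \<in> D \<Longrightarrow> opp d \<in> D" "d \<in> D \<Longrightarrow> opp (opp d) = d"
  by (simp_all add: rot_def unrot_def opp next_dart)

lemma vert_rot [simp]: "d \<in> D \<Longrightarrow> vert (rot d) = vert d" "d \<in> D \<Longrightarrow> vert (unrot d) = vert d"
  using vert_next[of "next_dart (next_dart d)"] vert_next[of "opp d"]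
  by (simp_all add: rot_def unrot_def opp next_dart)

text \<open>The composite of \<open>opp\<close> and \<open>rot\<close> is conjugate to the square of
  \<open>next_dart\<close>, so it has order three. This is that relation, solved for the conjugate
  of \<open>rot\<close> by \<open>opp\<close>.\<close>

lemma opp_rot_opp: "d \<in> D \<Longrightarrow> opp (rot (opp d)) = unrot (opp (unrot d))"
  by (simp add: rot_def unrot_def opp next_dart)

lemma opp_unrot_opp: "d \<in> D \<Longrightarrow> opp (unrot (opp d)) = rot (opp (rot d))"
  by (simp add: rot_def unrot_def opp next_dart)

lemma rot_pow [simp]: "d \<in> D \<Longrightarrow> (rot ^^ k) d \<in> D" "d \<in> D \<Longrightarrow> vert ((rot ^^ k) d) = vert d"
  by (induction k) auto

lemma rot_pow_inj: "d \<in> D \<Longrightarrow> e \<in> D \<Longrightarrow> (rot ^^ k) d = (rot ^^ k) e \<Longrightarrow> d = e"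
proof (induction k)
  case (Suc k)
  then have "unrot (rot ((rot ^^ k) d)) = unrot (rot ((rot ^^ k) e))" by simp
  then show ?case using Suc by simp
qed simp

text \<open>The least positive period of \<open>rot\<close> at \<open>d\<close> is the size of its
  orbit, and by \<open>one_cycle\<close> the orbit consists of all six darts at the vertex.\<close>

lemma rot_orbit:
  assumes d: "d \<in> D"
  shows "{e \<in> D. vert e = vert d} = (\<lambda>k. (rot ^^ k) d) ` {..<6}" and "(rot ^^ 6) d = d"
    and "0 < k \<Longrightarrow> k < 6 \<Longrightarrow> (rot ^^ k) d \<noteq> d"
proof -
  let ?O = "range (\<lambda>k. (rot ^^ k) d)"
  have O: "?O = {e \<in> D. vert e = vert d}"
  proof (rule one_cycle)
    show "opp (next_dart (next_dart e)) \<in> ?O" if "e \<in> ?O" for e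
    proof -
      from that obtain k where "e = (rot ^^ k) d" by auto
      then have "opp (next_dart (next_dart e)) = (rot ^^ Suc k) d" by (simp add: rot_def)
      then show ?thesis by blast
    qed
  qed (use d in auto)
  have "\<not> inj (\<lambda>k. (rot ^^ k) d)"
  proof
    assume "inj (\<lambda>k. (rot ^^ k) d)"
    then have "infinite ?O" by (rule range_inj_infinite)
    then show False using O fin by simp
  qed
  then obtain i j where ij: "i < j" "(rot ^^ i) d = (rot ^^ j) d"
    using linorder_injI[of "\<lambda>k. (rot ^^ k) d"] by blast
  have "(rot ^^ i) ((rot ^^ (j - i)) d) = (rot ^^ j) d"
    using ij(1) funpow_add[of i "j - i" rot] by simp
  then have "(rot ^^ i) d = (rot ^^ i) ((rot ^^ (j - i)) d)" using ij(2) by simp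
  then have ex: "(rot ^^ (j - i)) d = d" "0 < j - i"
    using rot_pow_inj[of d "(rot ^^ (j - i)) d" i] d ij(1) by auto
  define n where "n = (LEAST n. 0 < n \<and> (rot ^^ n) d = d)"
  have n: "0 < n" "(rot ^^ n) d = d" using LeastI[of "\<lambda>n. 0 < n \<and> (rot ^^ n) d = d"] ex
    unfolding n_def by blast+
  have least: "(rot ^^ k) d \<noteq> d" if "0 < k" "k < n" for k
    using not_less_Least[of k "\<lambda>n. 0 < n \<and> (rot ^^ n) d = d"] that unfolding n_def by blast
  have md: "(rot ^^ k) d = (rot ^^ (k mod n)) d" for k
    using funpow_mod_eq[OF n(2), of k] by simp
  have img: "?O = (\<lambda>k. (rot ^^ k) d) ` {..<n}"
  proof
    show "?O \<subseteq> (\<lambda>k. (rot ^^ k) d) ` {..<n}"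
    proof
      fix e assume "e \<in> ?O"
      then obtain k where "e = (rot ^^ (k mod n)) d" using md by blast
      then show "e \<in> (\<lambda>k. (rot ^^ k) d) ` {..<n}" using n(1) by auto
    qed
  qed auto
  have "inj_on (\<lambda>k. (rot ^^ k) d) {..<n}"
  proof (rule linorder_inj_onI)
    fix i j assume ij: "i < j" "i \<in> {..<n}" "j \<in> {..<n}"
    show "(rot ^^ i) d \<noteq> (rot ^^ j) d"
    proof
      assume eq: "(rot ^^ i) d = (rot ^^ j) d"
      have "(rot ^^ i) ((rot ^^ (j - i)) d) = (rot ^^ j) d"
        using ij(1) funpow_add[of i "j - i" rot] by simp
      then have "(rot ^^ (j - i)) d = d"
        using rot_pow_inj[of d "(rot ^^ (j - i)) d" i] d eq by simp
      moreover have "0 < j - i" "j - i < n" using ij by auto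
      ultimately show False using least[of "j - i"] by blast
    qed
  qed auto
  then have "card ?O = n" unfolding img by (simp add: card_image)
  then have "n = 6" using O degree_6[OF d] by simp
  then show "{e \<in> D. vert e = vert d} = (\<lambda>k. (rot ^^ k) d) ` {..<6}" "(rot ^^ 6) d = d"
    "0 < k \<Longrightarrow> k < 6 \<Longrightarrow> (rot ^^ k) d \<noteq> d"
    using O img n least by auto
qed

lemma rot6: "d \<in> D \<Longrightarrow> rot (rot (rot (rot (rot (rot d))))) = d"
  using rot_orbit(2)[of d] by (simp add: numeral_eq_Suc)

lemma unrot3: "d \<in> D \<Longrightarrow> unrot (unrot (unrot d)) = rot (rot (rot d))"
  using rot6[of "unrot (unrot (unrot d))"] by simp

lemma unrot2: "d \<in> D \<Longrightarrow> unrot (unrot d) = rot (rot (rot (rot d)))"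
  using rot6[of "unrot (unrot d)"] by simp

lemma rot2_neq: "d \<in> D \<Longrightarrow> rot (rot d) \<noteq> d"
  using rot_orbit(3)[of d 2] by (simp add: numeral_eq_Suc)

definition nbrs where "nbrs v = {vert (opp d) | d. d \<in> D \<and> vert d = v}"

lemma nbrs_dart: "d \<in> D \<Longrightarrow> nbrs (vert d) = (\<lambda>k. vert (opp ((rot ^^ k) d))) ` {..<6}"
proof -
  assume d: "d \<in> D"
  have "nbrs (vert d) = (\<lambda>e. vert (opp e)) ` {e \<in> D. vert e = vert d}"
    by (auto simp: nbrs_def)
  then show ?thesis unfolding rot_orbit(1)[OF d] by (simp add: image_image)
qed

lemma nbrs_sym: "u \<in> nbrs v" if "v \<in> nbrs u"
proof -
  from that obtain d where d: "d \<in> D" "vert d = u" "v = vert (opp d)" by (auto simp: nbrs_def)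
  then have "opp d \<in> D" "vert (opp d) = v" "u = vert (opp (opp d))" by simp_all
  then show ?thesis unfolding nbrs_def by blast
qed

lemma nbrs_irrefl: "v \<notin> nbrs v"
proof
  assume "v \<in> nbrs v"
  then obtain d where "d \<in> D" "vert d = v" "v = vert (opp d)" by (auto simp: nbrs_def)
  then show False using no_loop[of d] by simp
qed

lemma nbrs_subset: "nbrs v \<subseteq> vert ` D"
  unfolding nbrs_def using opp by auto

lemma finite_nbrs: "finite (nbrs v)"
  using nbrs_subset fin finite_subset by blast

lemma card_nbrs: "card (nbrs v) \<le> 6"
proof (cases "v \<in> vert ` D")
  case True
  then obtain d where d: "d \<in> D" "v = vert d" by blast
  have "card ((\<lambda>k. vert (opp ((rot ^^ k) d))) ` {..<6 :: nat}) \<le> card {..<6 :: nat}"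
    by (rule card_image_le) simp
  then show ?thesis using nbrs_dart[OF d(1)] d(2) by simp
next
  case False
  then have "nbrs v = {}" by (auto simp: nbrs_def)
  then show ?thesis by simp
qed

text \<open>
  Each of these moves a dart by one edge and keeps its direction: \<open>ta\<close> along the dart itself, \<open>tb\<close>
  and \<open>tc\<close> along its images under \<open>rot\<^sup>2\<close> and \<open>rot\<^sup>4\<close>; \<open>ia\<close> and \<open>ib\<close> are the inverses.
\<close>

definition ta where "ta d = rot (rot (rot (opp d)))"
definition tb where "tb d = rot (opp (rot (rot d)))"
definition ia where "ia d = opp (unrot (unrot (unrot d)))"
definition ib where "ib d = unrot (unrot (opp (unrot d)))"
definition tc where "tc d = unrot (opp (unrot (unrot d)))"

lemma translation_maps [simp]:
  assumes "d \<in> D"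
  shows "ta d \<in> D" "tb d \<in> D" "ia d \<in> D" "ib d \<in> D" "tc d \<in> D"
    "ta (ia d) = d" "tb (ib d) = d" "ia (ta d) = d" "ib (tb d) = d"
  using assms by (simp_all add: ta_def tb_def ia_def ib_def tc_def)

lemma translation_eq_iff:
  "d \<in> D \<Longrightarrow> e \<in> D \<Longrightarrow> ta d = ta e \<longleftrightarrow> d = e" "d \<in> D \<Longrightarrow> e \<in> D \<Longrightarrow> tb d = tb e \<longleftrightarrow> d = e"
  by (metis translation_maps(8)) (metis translation_maps(9))

lemma ta_tb: "d \<in> D \<Longrightarrow> ta (tb d) = rot (rot (opp (rot d)))"
  by (simp add: ta_def tb_def opp_rot_opp)

text \<open>Both orders cross a rhombus made of two triangles and have the effect of a single step
  along its diagonal \<open>rot d\<close>. The triangle relation and \<open>rot6\<close> make the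
  darts at the far corner agree.\<close>

lemma tb_ta: "d \<in> D \<Longrightarrow> tb (ta d) = ta (tb d)"
proof -
  assume d: "d \<in> D"
  have "rot (rot (rot (rot (rot (opp d))))) = unrot (opp d)"
    using rot6[of "unrot (opp d)"] d by simp
  then have "tb (ta d) = rot (opp (unrot (opp d)))" by (simp add: tb_def ta_def)
  then show ?thesis using d by (simp add: opp_unrot_opp ta_tb)
qed

text \<open>Steps in three directions 120 degrees apart lead back to the start.\<close>

lemma tc_ta_tb: "d \<in> D \<Longrightarrow> tc (ta (tb d)) = d" "d \<in> D \<Longrightarrow> ta (tb (tc d)) = d"
  by (simp add: ta_tb tc_def) (simp add: ta_tb tc_def)

lemma rot2_tb: "d \<in> D \<Longrightarrow> rot (rot (tb d)) = ta (rot (rot d))"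
  by (simp add: ta_def tb_def)

lemma rot2_ta: "d \<in> D \<Longrightarrow> rot (rot (ta d)) = tc (rot (rot d))"
  using rot6[of "unrot (opp d)"] by (simp add: ta_def tc_def)

section \<open>The developing map of the triangular lattice\<close>

definition dev :: "'d \<Rightarrow> int \<times> int \<Rightarrow> 'd" where
  "dev d z = int_funpow ta ia (fst z) (int_funpow tb ib (snd z) d)"

lemma dev_closed [simp]: "d \<in> D \<Longrightarrow> dev d z \<in> D"
  unfolding dev_def by (intro int_funpow_closed) simp_all

lemma dev_0 [simp]: "dev d 0 = d" "dev d (0, 0) = d"
  by (simp_all add: dev_def int_funpow_def)

lemma dev_a: "d \<in> D \<Longrightarrow> dev d (z + (1, 0)) = ta (dev d z)"
  unfolding dev_def by (simp add: int_funpow_add1[where D = D] int_funpow_closed[where D = D])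

lemma tb_ia: "d \<in> D \<Longrightarrow> tb (ia d) = ia (tb d)"
  using tb_ta[of "ia d"] by simp

text \<open>The powers of \<open>ta\<close> are applied last in \<open>dev\<close>, so a step in the
  second coordinate has to be commuted past them.\<close>

lemma dev_b: "d \<in> D \<Longrightarrow> dev d (z + (0, 1)) = tb (dev d z)"
proof -
  assume d: "d \<in> D"
  have pow: "(ta ^^ n) (tb e) = tb ((ta ^^ n) e) \<and> (ta ^^ n) e \<in> D \<and>
      (ia ^^ n) (tb e) = tb ((ia ^^ n) e) \<and> (ia ^^ n) e \<in> D"
    if "e \<in> D" for n e
    using that by (induction n) (auto simp: tb_ta tb_ia)
  have "int_funpow tb ib (snd z) d \<in> D" by (intro int_funpow_closed) (use d in simp_all)
  then show ?thesis
    unfolding dev_def using d pow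
    by (simp add: int_funpow_add1[where D = D]) (simp add: int_funpow_def)
qed

lemma dev_ab: "d \<in> D \<Longrightarrow> dev d (z + (1, 1)) = ta (tb (dev d z))"
  using dev_b[of d z] dev_a[of d "z + (0, 1)"] by (simp add: add.assoc)

lemma dev_ia: "d \<in> D \<Longrightarrow> dev d (z + (-1, 0)) = ia (dev d z)"
  using dev_a[of d "z + (-1, 0)"] by (simp add: add.assoc flip: zero_prod_def)

lemma dev_ib: "d \<in> D \<Longrightarrow> dev d (z + (0, -1)) = ib (dev d z)"
  using dev_b[of d "z + (0, -1)"] by (simp add: add.assoc flip: zero_prod_def)

lemma dev_c: "d \<in> D \<Longrightarrow> dev d (z + (-1, -1)) = tc (dev d z)"
  using dev_ab[of d "z + (-1, -1)"] tc_ta_tb(1)[of "dev d (z + (-1, -1))"]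
  by (simp add: add.assoc flip: zero_prod_def)

lemma lessThan_6: "{..<6 :: nat} = {0, 1, 2, 3, 4, 5}"
  by auto

lemma dev_heads:
  assumes "d \<in> D"
  shows "vert (opp (dev d z)) = vert (dev d (z + (1, 0)))"
    "vert (opp (rot (dev d z))) = vert (dev d (z + (1, 1)))"
    "vert (opp (rot (rot (dev d z)))) = vert (dev d (z + (0, 1)))"
    "vert (opp (rot (rot (rot (dev d z))))) = vert (dev d (z + (-1, 0)))"
    "vert (opp (rot (rot (rot (rot (dev d z)))))) = vert (dev d (z + (-1, -1)))"
    "vert (opp (rot (rot (rot (rot (rot (dev d z))))))) = vert (dev d (z + (0, -1)))"
proof -
  let ?e = "dev d z"
  have e: "?e \<in> D" using assms by simp
  have r5: "rot (rot (rot (rot (rot ?e)))) = unrot ?e" using rot6[of "unrot ?e"] e by simp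
  show "vert (opp ?e) = vert (dev d (z + (1, 0)))"
    using assms e by (simp add: dev_a ta_def)
  show "vert (opp (rot ?e)) = vert (dev d (z + (1, 1)))"
    using assms e by (simp add: dev_ab ta_tb)
  show "vert (opp (rot (rot ?e))) = vert (dev d (z + (0, 1)))"
    using assms e by (simp add: dev_b tb_def)
  show "vert (opp (rot (rot (rot ?e)))) = vert (dev d (z + (-1, 0)))"
    using assms e by (simp add: dev_ia ia_def unrot3)
  show "vert (opp (rot (rot (rot (rot ?e))))) = vert (dev d (z + (-1, -1)))"
    using assms e by (simp add: dev_c tc_def unrot2)
  show "vert (opp (rot (rot (rot (rot (rot ?e)))))) = vert (dev d (z + (0, -1)))"
    using assms e by (simp add: r5 dev_ib ib_def)
qed

lemma nbrs_dev:
  assumes d: "d \<in> D"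
  shows "nbrs (vert (dev d z)) = (\<lambda>g. vert (dev d (z + g))) ` set hex_dirs"
proof -
  have "nbrs (vert (dev d z)) = (\<lambda>k. vert (opp ((rot ^^ k) (dev d z)))) ` {0, 1, 2, 3, 4, 5}"
    using nbrs_dart[of "dev d z"] d unfolding lessThan_6 by simp
  also have "\<dots> = (\<lambda>g. vert (dev d (z + g))) ` set hex_dirs"
    using dev_heads[OF d, of z] by (simp add: hex_dirs_def numeral_eq_Suc insert_commute)
  finally show ?thesis .
qed

end

section \<open>Maps with a proper 3-colouring\<close>

locale three_coloured_map = triangular_map D vert opp next_dart
  for D :: "'d set" and vert :: "'d \<Rightarrow> 'v" and opp next_dart +
  fixes c :: "'v \<Rightarrow> nat"
  assumes proper: "d \<in> D \<Longrightarrow> c (vert d) \<noteq> c (vert (opp d))"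
    and three: "card (c ` vert ` D) \<le> 3"
begin

lemma colour_nbr: "v \<in> nbrs u \<Longrightarrow> c u \<noteq> c v"
  using proper by (auto simp: nbrs_def)

lemma third_colour:
  assumes "{x, y, u, v} \<subseteq> c ` vert ` D" "u \<noteq> v" "x \<notin> {u, v}" "y \<notin> {u, v}"
  shows "x = y"
proof (rule ccontr)
  assume "x \<noteq> y"
  then have "card {x, y, u, v} = 4" using assms by simp
  moreover have "card {x, y, u, v} \<le> card (c ` vert ` D)"
    using assms(1) fin by (intro card_mono) auto
  ultimately show False using three by simp
qed

context
  fixes d0 assumes d0: "d0 \<in> D"
begin

abbreviation col :: "int \<Rightarrow> int \<Rightarrow> nat" where "col x y \<equiv> c (vert (dev d0 (x, y)))"

lemma col_in: "col x y \<in> c ` vert ` D"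
  using d0 by (intro imageI) simp

lemma col_nbr: "(i, j) \<in> set hex_dirs \<Longrightarrow> col x y \<noteq> col (x + i) (y + j)"
  using colour_nbr[of "vert (dev d0 (x + i, y + j))" "vert (dev d0 (x, y))"] nbrs_dev[OF d0, of "(x, y)"]
  by force

text \<open>The two points are opposite corners of a rhombus of two triangles. Both avoid the
  colours of the two ends of the common edge, and only one colour is left.\<close>

lemma col_diag: "col (x + 1) y = col x (y + 1)"
  by (rule third_colour[of _ _ "col x y" "col (x + 1) (y + 1)"])
    (use col_in col_nbr[of 1 1 x y] col_nbr[of 1 0 x y] col_nbr[of 0 1 x y]
      col_nbr[of 0 1 "x + 1" y] col_nbr[of 1 0 x "y + 1"] in \<open>auto simp: hex_dirs_def\<close>)

lemma col_sum: "col x y = col (x + y) 0"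
proof (induction y arbitrary: x rule: int_induct[where k = 0])
  case (step1 y)
  then show ?case using col_diag[of x y] step1(2)[of "x + 1"] by (simp add: algebra_simps)
next
  case (step2 y)
  then show ?case using col_diag[of "x - 1" "y - 1"] step2(2)[of "x - 1"] by (simp add: algebra_simps)
qed simp

lemma col_neq: "col n 0 \<noteq> col (n + 1) 0" "col n 0 \<noteq> col (n + 2) 0"
  using col_nbr[of 1 0 n 0] col_nbr[of 1 1 n 0] col_sum[of "n + 1" 1]
  by (simp_all add: hex_dirs_def algebra_simps)

lemma col_add_3: "col (n + 3) 0 = col n 0"
  by (rule third_colour[of _ _ "col (n + 1) 0" "col (n + 2) 0"])
    (use col_in col_neq(1)[of n] col_neq(2)[of n] col_neq(1)[of "n + 1"] col_neq(2)[of "n + 1"]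
      col_neq(1)[of "n + 2"] in \<open>auto simp: add.commute\<close>)

lemma col_mult_3: "col (n + 3 * k) 0 = col n 0"
proof (induction k rule: int_induct[where k = 0])
  case (step1 k)
  then show ?case using col_add_3[of "n + 3 * k"] by (simp add: algebra_simps)
next
  case (step2 k)
  then show ?case using col_add_3[of "n + 3 * (k - 1)"] by (simp add: algebra_simps)
qed simp

lemma col_eq_iff: "col m 0 = col n 0 \<longleftrightarrow> 3 dvd m - n"
proof
  assume eq: "col m 0 = col n 0"
  define q where "q = (m - n) div 3"
  have "m = n + (m - n) mod 3 + 3 * q" by (simp add: q_def)
  then have "col m 0 = col (n + (m - n) mod 3) 0" using col_mult_3 by metis
  moreover have "(m - n) mod 3 = 0 \<or> (m - n) mod 3 = 1 \<or> (m - n) mod 3 = 2" by presburger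
  ultimately have "(m - n) mod 3 = 0" using eq col_neq[of n] by force
  then show "3 dvd m - n" by presburger
next
  assume "3 dvd m - n"
  then obtain k where "m = n + 3 * k" by (metis add_diff_cancel_left' diff_add_cancel dvdE add.commute)
  then show "col m 0 = col n 0" by (simp add: col_mult_3)
qed

lemma vert_eq_colour:
  assumes "vert (dev d0 z) = vert (dev d0 z')"
  shows "3 dvd fst (z - z') + snd (z - z')"
proof -
  have "col (fst z + snd z) 0 = col (fst z' + snd z') 0"
    using assms col_sum[of "fst z" "snd z"] col_sum[of "fst z'" "snd z'"] by simp
  then show ?thesis unfolding col_eq_iff by (simp add: algebra_simps)
qed

text \<open>A rotation by 120 degrees that preserves colours fixes a vertex, which no rotation of darts does.\<close>

lemma no_rotation:
  assumes "dev d0 z' = rot (rot (dev d0 z))" "3 dvd fst (z' - z) + snd (z' - z)"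
  shows False
proof -
  \<comment> \<open>\<open>R\<close> is the effect of \<open>rot\<close> squared on displacements:
    by \<open>rot2_ta\<close> and \<open>rot2_tb\<close> it sends (1, 0) to (-1, -1) and (0, 1) to
    (1, 0).\<close>
  define R where "R w = (snd w - fst w, - fst w)" for w :: "int \<times> int"
  have R: "rot (rot (dev d0 (z + w))) = dev d0 (z' + R w)" for w
  proof (induction w rule: int_pair_induct)
    case 1
    then show ?case using assms(1) by (simp add: R_def zero_prod_def[symmetric])
  next
    case (2 w)
    have e: "R (w + (1, 0)) = R w + (-1, -1)" by (simp add: R_def)
    have "rot (rot (dev d0 (z + (w + (1, 0))))) = tc (rot (rot (dev d0 (z + w))))"
      using d0 dev_a[OF d0, of "z + w"] by (simp add: rot2_ta add.assoc)
    moreover have "dev d0 (z' + R (w + (1, 0))) = tc (dev d0 (z' + R w))"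
      using dev_c[OF d0, of "z' + R w"] by (simp add: e add.assoc)
    ultimately show ?case
      using d0 tc_ta_tb(2)[of "rot (rot (dev d0 (z + w)))"] tc_ta_tb(2)[of "dev d0 (z' + R w)"]
      by (metis dev_closed rot(1))
  next
    case (3 w)
    have e: "R (w + (0, 1)) = R w + (1, 0)" by (simp add: R_def)
    have "rot (rot (dev d0 (z + (w + (0, 1))))) = ta (rot (rot (dev d0 (z + w))))"
      using d0 dev_b[OF d0, of "z + w"] by (simp add: rot2_tb add.assoc)
    moreover have "dev d0 (z' + R (w + (0, 1))) = ta (dev d0 (z' + R w))"
      using dev_a[OF d0, of "z' + R w"] by (simp add: e add.assoc)
    ultimately show ?case
      using d0 translation_maps(8) by (metis dev_closed rot(1))
  qed
  \<comment> \<open>The fixed point solves \<open>w - R w = z' - z\<close>. The determinant of this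
    system is 3, and preservation of colours is exactly what makes the solution integral.\<close>
  obtain p where p: "fst (z' - z) + snd (z' - z) = 3 * p" using assms(2) by blast
  define w where "w = (p, snd (z' - z) - p)"
  have "z' + R w = z + w"
    using p by (cases z; cases z') (auto simp: R_def w_def)
  then have "rot (rot (dev d0 (z + w))) = dev d0 (z + w)" using R[of w] by simp
  then show False using rot2_neq[of "dev d0 (z + w)"] d0 by simp
qed

text \<open>Darts at one vertex differ by a power of \<open>rot\<close>. An odd power would exchange
  the two colours that alternate around the vertex, and a nontrivial even power is excluded by
  \<open>no_rotation\<close>.\<close>

lemma vert_eq_imp_dev_eq:
  assumes eq: "vert (dev d0 z) = vert (dev d0 z')"
  shows "dev d0 z = dev d0 z'"
proof -
  let ?e = "dev d0 z" and ?e' = "dev d0 z'"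
  obtain x y x' y' where z: "z = (x, y)" "z' = (x', y')" by (metis surj_pair)
  have dvd: "3 dvd (x + y) - (x' + y')" using vert_eq_colour[OF eq] z by (simp add: algebra_simps)
  have "?e' \<in> {e \<in> D. vert e = vert ?e}" using eq d0 by simp
  then obtain k where k: "k < 6" "?e' = (rot ^^ k) ?e" using rot_orbit(1)[of ?e] d0 by auto
  have c1: "c (vert (opp ?e')) = col (x' + y' + 1) 0"
    using dev_heads(1)[OF d0, of z'] col_sum[of "x' + 1" y'] z by (simp add: algebra_simps)
  consider "k = 0" | "k = 1" | "k = 2" | "k = 3" | "k = 4" | "k = 5" using k(1) by linarith
  then show ?thesis
  proof cases
    case 1
    then show ?thesis using k by simp
  next
    case 2
    then have "c (vert (opp ?e')) = col (x + y + 2) 0"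
      using k dev_heads(2)[OF d0, of z] col_sum[of "x + 1" "y + 1"] z by (simp add: algebra_simps)
    with c1 have "col (x' + y' + 1) 0 = col (x + y + 2) 0" by (rule trans[OF sym])
    then have "3 dvd (x' + y' + 1) - (x + y + 2)" by (rule col_eq_iff[THEN iffD1])
    then show ?thesis using dvd by presburger
  next
    case 3
    then have "?e' = rot (rot ?e)" using k by (simp add: numeral_eq_Suc)
    moreover have "3 dvd fst (z' - z) + snd (z' - z)" using vert_eq_colour[OF eq[symmetric]] .
    ultimately show ?thesis using no_rotation by blast
  next
    case 4
    then have "c (vert (opp ?e')) = col (x + y - 1) 0"
      using k dev_heads(4)[OF d0, of z] col_sum[of "x - 1" y] z by (simp add: algebra_simps numeral_eq_Suc)
    with c1 have "col (x' + y' + 1) 0 = col (x + y - 1) 0" by (rule trans[OF sym])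
    then have "3 dvd (x' + y' + 1) - (x + y - 1)" by (rule col_eq_iff[THEN iffD1])
    then show ?thesis using dvd by presburger
  next
    case 5
    then have "?e' = rot (rot (rot (rot ?e)))" using k by (simp add: numeral_eq_Suc)
    then have "?e = rot (rot ?e')" using rot6[of ?e] d0 by simp
    then show ?thesis using no_rotation vert_eq_colour[OF eq] by blast
  next
    case 6
    then have "c (vert (opp ?e')) = col (x + y - 1) 0"
      using k dev_heads(6)[OF d0, of z] col_sum[of x "y - 1"] z by (simp add: algebra_simps numeral_eq_Suc)
    with c1 have "col (x' + y' + 1) 0 = col (x + y - 1) 0" by (rule trans[OF sym])
    then have "3 dvd (x' + y' + 1) - (x + y - 1)" by (rule col_eq_iff[THEN iffD1])
    then show ?thesis using dvd by presburger
  qed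
qed

text \<open>Points with the same vertex carry the same dart, and a dart determines all its
  translates, so coincidences are invariant under translation.\<close>

lemma lattice_quotient_dev: "lattice_quotient nbrs (\<lambda>z. vert (dev d0 z))"
proof
  fix z z' w
  show "nbrs (vert (dev d0 z)) = (\<lambda>g. vert (dev d0 (z + g))) ` set hex_dirs"
    by (rule nbrs_dev[OF d0])
  assume eq: "vert (dev d0 z) = vert (dev d0 z')"
  then show "3 dvd fst (z - z') + snd (z - z')" by (rule vert_eq_colour)
  have "dev d0 (z + w) = dev d0 (z' + w)"
  proof (induction w rule: int_pair_induct)
    case 1
    then show ?case using vert_eq_imp_dev_eq[OF eq] by simp
  next
    case (2 w)
    show ?case
      using dev_a[OF d0, of "z + w"] dev_a[OF d0, of "z' + w"] d0
      by (simp add: add.assoc translation_eq_iff)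
  next
    case (3 w)
    show ?case
      using dev_b[OF d0, of "z + w"] dev_b[OF d0, of "z' + w"] d0
      by (simp add: add.assoc translation_eq_iff)
  qed
  then show "vert (dev d0 (z + w)) = vert (dev d0 (z' + w))" by simp
qed

end

theorem list_colourable_5:
  assumes L: "\<And>v. v \<in> vert ` D \<Longrightarrow> finite (L v) \<and> 5 \<le> card (L v)"
  shows "list_colourable nbrs (vert ` D) L"
proof (rule list_colourable_components)
  fix v assume "v \<in> vert ` D"
  then obtain d where d: "d \<in> D" "v = vert d" by blast
  interpret lattice_quotient nbrs "\<lambda>z. vert (dev d z)" by (rule lattice_quotient_dev[OF d(1)])
  let ?C = "range (\<lambda>z. vert (dev d z))"
  have C: "?C \<subseteq> vert ` D" using d by auto
  have "v \<in> ?C" using d(2) by (auto intro: range_eqI[of _ _ 0])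
  moreover have "\<forall>u\<in>?C. nbrs u \<subseteq> ?C" using nbrs by auto
  moreover have "list_colourable nbrs ?C L"
    by (rule list_colourable_5) (use C L fin finite_subset in blast)+
  ultimately show "\<exists>C\<subseteq>vert ` D. v \<in> C \<and> (\<forall>u\<in>C. nbrs u \<subseteq> C) \<and> list_colourable nbrs C L"
    using C by blast
qed (use fin nbrs_sym in auto)

end

section \<open>Lists of size six\<close>

context triangular_map
begin

lemma consecutive_heads: "d \<in> D \<Longrightarrow> vert (opp (rot d)) \<in> nbrs (vert (opp d))"
  unfolding nbrs_def using vert_next[of d] vert_next[of "next_dart d"] next_dart(1) opp(2)
  by (auto simp: rot_def intro!: exI[of _ "next_dart d"])

text \<open>Consecutive heads are adjacent, so adjacency to a fixed one spreads around the cycle.\<close>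

lemma nbrs_clique:
  assumes d: "d \<in> D"
    and no_path: "\<And>p q r. p \<in> nbrs (vert d) \<Longrightarrow> q \<in> nbrs (vert d) \<Longrightarrow> r \<in> nbrs (vert d) \<Longrightarrow>
      p \<in> nbrs q \<Longrightarrow> r \<in> nbrs q \<Longrightarrow> p = r \<or> r \<in> nbrs p"
    and pr: "p \<in> nbrs (vert d)" "r \<in> nbrs (vert d)" "p \<noteq> r"
  shows "r \<in> nbrs p"
proof -
  define h where "h k = vert (opp ((rot ^^ k) d))" for k
  have h_in: "h k \<in> nbrs (vert d)" for k
    unfolding h_def nbrs_def using d by (auto intro!: exI[of _ "(rot ^^ k) d"])
  have h_Suc: "h (Suc k) \<in> nbrs (h k)" for k
    unfolding h_def using consecutive_heads[of "(rot ^^ k) d"] d by simp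
  have adj: "h i = h (i + j) \<or> h (i + j) \<in> nbrs (h i)" for i j
  proof (induction j)
    case (Suc j)
    show ?case
    proof (cases "h i = h (i + j)")
      case True
      then show ?thesis using h_Suc[of "i + j"] by simp
    next
      case False
      then have "h i \<in> nbrs (h (i + j))" using Suc nbrs_sym by blast
      then show ?thesis using no_path[of "h i" "h (i + j)" "h (Suc (i + j))"] h_in h_Suc by simp
    qed
  qed simp
  obtain a b where ab: "p = h a" "r = h b" using pr nbrs_dart[OF d] by (auto simp: h_def)
  show ?thesis
  proof (cases "a \<le> b")
    case True
    then show ?thesis using adj[of a "b - a"] ab pr(3) by auto
  next
    case False
    then show ?thesis using adj[of b "a - b"] ab pr(3) nbrs_sym by auto
  qed
qed

text \<open>Every vertex \<open>v\<close> of the component serves as a start. If it has six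
  neighbours and no induced diamond has \<open>v\<close> as an end of its central edge,
  \<open>nbrs_clique\<close> makes the neighbourhood a clique, and seven pairwise adjacent vertices
  contradict the six colours.\<close>

theorem list_colourable_6:
  fixes c :: "'v \<Rightarrow> nat"
  assumes c: "\<And>d. d \<in> D \<Longrightarrow> c (vert d) \<noteq> c (vert (opp d))" "card (c ` vert ` D) \<le> 6"
    and L: "\<And>v. v \<in> vert ` D \<Longrightarrow> finite (L v) \<and> 6 \<le> card (L v)"
  shows "list_colourable nbrs (vert ` D) L"
proof (rule list_colourable_components)
  fix v assume v: "v \<in> vert ` D"
  then obtain d where d: "d \<in> D" "v = vert d" by blast
  define C where "C = {w. (v, w) \<in> {(a, b). b \<in> nbrs a}\<^sup>*}"
  have closed: "nbrs u \<subseteq> C" if "u \<in> C" for u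
    using that unfolding C_def by (auto intro: rtrancl_into_rtrancl)
  have vC: "v \<in> C" by (simp add: C_def)
  have CD: "C \<subseteq> vert ` D"
  proof
    fix w assume "w \<in> C"
    then have "(v, w) \<in> {(a, b). b \<in> nbrs a}\<^sup>*" by (simp add: C_def)
    then show "w \<in> vert ` D" by (induction rule: rtrancl_induct) (use v nbrs_subset in auto)
  qed
  have finC: "finite C" using CD fin finite_subset by blast
  \<comment> \<open>Connectedness supplies the order: a vertex outside \<open>Y\<close> with a
    neighbour in \<open>Y\<close> has at most five neighbours outside \<open>Y\<close>.\<close>
  have ext: "list_colourable nbrs C L" if X: "X \<subseteq> C" "v \<in> X"
    and base: "\<And>L. (\<And>u. u \<in> X \<Longrightarrow> finite (L u) \<and> 6 \<le> card (L u) + card (nbrs u - X)) \<Longrightarrow>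
      list_colourable nbrs X L" for X
  proof (rule list_colourable_extend[where X = X and k = 6])
    show "\<exists>w\<in>C - Y. card (nbrs w - Y) < 6" if Y: "X \<subseteq> Y" "Y \<subset> C" for Y
    proof -
      have "\<exists>u\<in>Y. \<exists>w\<in>C - Y. w \<in> nbrs u"
      proof (rule ccontr)
        assume no: "\<not> ?thesis"
        have "w \<in> Y" if "(v, w) \<in> {(a, b). b \<in> nbrs a}\<^sup>*" for w
          using that
        proof (induction rule: rtrancl_induct)
          case base
          then show ?case using X Y by blast
        next
          case (step y z)
          then show ?case using no closed[of y] Y by blast
        qed
        then show False using Y unfolding C_def by blast
      qed
      then obtain u w where uw: "u \<in> Y" "w \<in> C - Y" "w \<in> nbrs u" by blast
      have "nbrs w - Y \<subset> nbrs w" using uw nbrs_sym[OF uw(3)] by blast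
      then have "card (nbrs w - Y) < card (nbrs w)" by (rule psubset_card_mono[OF finite_nbrs])
      then show ?thesis using uw card_nbrs[of w] by (meson less_le_trans)
    qed
    show "u \<in> nbrs w" if "w \<in> nbrs u" for u w using that by (rule nbrs_sym)
    show "u \<notin> nbrs u" for u by (rule nbrs_irrefl)
    show "finite (L u) \<and> 6 \<le> card (L u)" if "u \<in> C" for u using L CD that by blast
  qed (use finC X closed base in auto)
  have diff: "card (nbrs u - X) + card S \<le> 6" if "S \<subseteq> nbrs u \<inter> X" for u S X
  proof -
    have "card (nbrs u - X) \<le> card (nbrs u - S)" by (rule card_mono) (use that finite_nbrs in auto)
    also have "\<dots> = card (nbrs u) - card S"
      using that finite_nbrs by (intro card_Diff_subset) (auto intro: finite_subset)
    finally have "card (nbrs u - X) \<le> card (nbrs u) - card S" .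
    moreover have "card S \<le> card (nbrs u)" by (rule card_mono) (use that finite_nbrs in auto)
    ultimately show ?thesis using card_nbrs[of u] by linarith
  qed
  have "list_colourable nbrs C L"
  proof (cases "card (nbrs v) \<le> 5")
    case True
    show ?thesis
    proof (rule ext[of "{v}"])
      fix L :: "'v \<Rightarrow> nat set"
      assume "\<And>u. u \<in> {v} \<Longrightarrow> finite (L u) \<and> 6 \<le> card (L u) + card (nbrs u - {v})"
      then have "6 \<le> card (L v) + card (nbrs v)" using nbrs_irrefl[of v] by simp
      then have "card (L v) \<noteq> 0" using True by linarith
      then obtain a where "a \<in> L v" by fastforce
      then show "list_colourable nbrs {v} L"
        unfolding list_colourable_def using nbrs_irrefl by (intro exI[of _ "\<lambda>_. a"]) auto
    qed (use vC in auto)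
  next
    case big: False
    show ?thesis
    proof (cases "\<exists>p q r. p \<in> nbrs v \<and> q \<in> nbrs v \<and> r \<in> nbrs v \<and> p \<in> nbrs q \<and> r \<in> nbrs q \<and>
        p \<noteq> r \<and> r \<notin> nbrs p")
      case True
      then obtain p q r where pqr: "p \<in> nbrs v" "q \<in> nbrs v" "r \<in> nbrs v" "p \<in> nbrs q"
        "r \<in> nbrs q" "p \<noteq> r" "r \<notin> nbrs p" by blast
      have sym: "v \<in> nbrs p" "v \<in> nbrs q" "v \<in> nbrs r" "q \<in> nbrs p" "q \<in> nbrs r" "p \<notin> nbrs r"
        using pqr nbrs_sym by blast+
      have ne: "v \<noteq> p" "v \<noteq> q" "v \<noteq> r" "p \<noteq> q" "q \<noteq> r"
        using pqr nbrs_irrefl by blast+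
      \<comment> \<open>\<open>v\<close> and \<open>q\<close> have degree three in the diamond and
        both keep three colours, but the Alon--Tarsi count for five edges leaves room for only one
        list of size three, so one colour at \<open>q\<close> is given away.\<close>
      let ?F = "\<lambda>i. [v, q, p, r] ! i" and ?f = "[3, 2, 2, 2] :: nat list"
      have four: "{..<length ?f} = {0, 1, 2, 3}" by auto
      have X: "?F ` {..<length ?f} = {v, q, p, r}" unfolding four by (auto simp: numeral_eq_Suc)
      show ?thesis
      proof (rule ext[of "{v, q, p, r}"])
        show "{v, q, p, r} \<subseteq> C" using closed[OF vC] pqr vC by auto
        fix L :: "'v \<Rightarrow> nat set"
        assume L: "\<And>u. u \<in> {v, q, p, r} \<Longrightarrow>
          finite (L u) \<and> 6 \<le> card (L u) + card (nbrs u - {v, q, p, r})"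
        show "list_colourable nbrs {v, q, p, r} L"
          unfolding X[symmetric]
        proof (rule config_list_colourable[OF diamond_choosable, where k = 6])
          show "inj_on ?F {..<length ?f}"
            unfolding four using ne pqr(6) by (auto simp: inj_on_def numeral_eq_Suc)
          show "(i, j) \<in> set [(0, 1), (0, 2), (0, 3), (1, 2), (1, 3)] \<or>
              (j, i) \<in> set [(0, 1), (0, 2), (0, 3), (1, 2), (1, 3)]"
            if "i < length ?f" "j < length ?f" "?F j \<in> nbrs (?F i)" for i j
          proof -
            have "i \<in> {0, 1, 2, 3}" "j \<in> {0, 1, 2, 3}" using that by auto
            then show ?thesis using that(3) pqr(7) sym(6) nbrs_irrefl by (auto simp: numeral_eq_Suc)
          qed
          show "?f ! i + card (nbrs (?F i) - ?F ` {..<length ?f}) \<le> 6" if "i < length ?f" for i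
          proof -
            have "card {q, p, r} = 3" "card {v, p, r} = 3" "card {v, q} = 2"
              using ne pqr(6) by auto
            moreover have "i \<in> {0, 1, 2, 3}" using that by auto
            ultimately show ?thesis
              unfolding X
              using diff[of "{q, p, r}" v "{v, q, p, r}"] diff[of "{v, p, r}" q "{v, q, p, r}"]
                diff[of "{v, q}" p "{v, q, p, r}"] diff[of "{v, q}" r "{v, q, p, r}"] pqr sym
              by (auto simp: numeral_eq_Suc)
          qed
          show "finite (L u) \<and> 6 \<le> card (L u) + card (nbrs u - ?F ` {..<length ?f})"
            if "u \<in> ?F ` {..<length ?f}" for u
            using L[of u] that unfolding X .
        qed
      qed auto
    next
      case False
      have clique: "r \<in> nbrs p" if "p \<in> nbrs v" "r \<in> nbrs v" "p \<noteq> r" for p r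
        using nbrs_clique[OF d(1), of p r] that False d(2) by blast
      have nc: "c a \<noteq> c b" if "b \<in> nbrs a" for a b using that c(1) by (auto simp: nbrs_def)
      have "inj_on c (insert v (nbrs v))"
      proof (rule inj_onI)
        fix a b assume ab: "a \<in> insert v (nbrs v)" "b \<in> insert v (nbrs v)" "c a = c b"
        show "a = b"
        proof (rule ccontr)
          assume "a \<noteq> b"
          then have "b \<in> nbrs a" using ab clique nbrs_sym by blast
          then show False using nc ab(3) by blast
        qed
      qed
      then have "card (c ` insert v (nbrs v)) = 7"
        using big card_nbrs[of v] nbrs_irrefl[of v] finite_nbrs[of v] by (simp add: card_image)
      moreover have "card (c ` insert v (nbrs v)) \<le> card (c ` vert ` D)"
      proof (rule card_mono)
        have "insert v (nbrs v) \<subseteq> vert ` D" using v nbrs_subset by blast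
        then show "c ` insert v (nbrs v) \<subseteq> c ` vert ` D" by (rule image_mono)
      qed (simp add: fin)
      ultimately show ?thesis using c(2) by simp
    qed
  qed
  then show "\<exists>C\<subseteq>vert ` D. v \<in> C \<and> (\<forall>u\<in>C. nbrs u \<subseteq> C) \<and> list_colourable nbrs C L"
    using CD vC closed by blast
qed (use fin nbrs_sym in auto)

end

section \<open>The covering of the torus by the plane\<close>

definition cov :: "complex \<Rightarrow> complex \<times> complex" where
  "cov z = (cis (Re z), cis (Im z))"

lemma continuous_on_cov [continuous_intros]: "continuous_on S cov"
  unfolding cov_def cis_conv_exp by (intro continuous_intros)

lemma cov_in_torus: "cov z \<in> torus"
  by (simp add: cov_def torus_def)

lemma torus_cov:
  assumes "p \<in> torus"
  obtains z where "cov z = p"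
proof -
  have "cmod (fst p) = 1" "cmod (snd p) = 1" using assms by (auto simp: torus_def)
  then obtain s t where "fst p = cis s" "snd p = cis t"
    by (metis cis_Arg norm_zero sgn_div_norm scaleR_one inverse_1 zero_neq_one)
  then have "cov (Complex s t) = p" by (simp add: cov_def prod_eq_iff)
  then show ?thesis by (rule that)
qed

lemma cov_add: "cov z = cov w \<Longrightarrow> cov (z + t) = cov (w + t)"
  by (simp add: cov_def flip: cis_mult)

lemma cov_diff: "cov z = cov w \<longleftrightarrow> cov (z - w) = cov 0"
  using cov_add[of z w "- w"] cov_add[of "z - w" 0 w] by auto

text \<open>Distinct points of a fibre of \<open>cov\<close> are at least \<open>2 * pi\<close>
  apart. The bound 2 is what two points of a ball of radius 1 satisfy.\<close>

lemma cov_inj_ball: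
  assumes "cov z = cov w" "dist z w < 2"
  shows "z = w"
proof -
  have *: "s = 0" if "cis s = 1" "\<bar>s\<bar> < 2" for s :: real
  proof -
    have "cos s = 1" using that(1) by (metis cis.simps(1) one_complex.simps(1))
    then obtain n :: int where n: "s = of_int n * 2 * pi" using cos_one_2pi_int by blast
    have "n = 0"
    proof (rule ccontr)
      assume "n \<noteq> 0"
      then have "1 \<le> \<bar>real_of_int n\<bar>" by linarith
      then have "2 * pi \<le> \<bar>s\<bar>" by (simp add: n abs_mult)
      then show False using that(2) pi_gt3 by linarith
    qed
    then show ?thesis using n by simp
  qed
  have c: "cov (z - w) = cov 0" using assms(1) cov_diff by blast
  have "\<bar>Re (z - w)\<bar> < 2" "\<bar>Im (z - w)\<bar> < 2"
    using assms(2) abs_Re_le_cmod[of "z - w"] abs_Im_le_cmod[of "z - w"]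
    by (simp_all only: dist_norm)
  moreover have "cis (Re (z - w)) = 1" "cis (Im (z - w)) = 1" using c by (simp_all add: cov_def)
  ultimately have "Re (z - w) = 0" "Im (z - w) = 0" using * by blast+
  then show ?thesis by (simp add: complex_eq_iff)
qed

text \<open>Both coordinates are nonzero functions on a contractible set and have continuous
  logarithms. Modulus one makes these purely imaginary, and the imaginary parts are the
  angles.\<close>

lemma lift_to_plane:
  fixes K :: "complex set"
  assumes "continuous_on K f" "contractible K" "f ` K \<subseteq> torus"
  obtains g where "continuous_on K g" "\<And>x. x \<in> K \<Longrightarrow> cov (g x) = f x"
proof -
  have n: "cmod (fst (f x)) = 1" "cmod (snd (f x)) = 1" if "x \<in> K" for x
    using assms(3) that by (auto simp: torus_def mem_Times_iff image_subset_iff)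
  have "continuous_on K (\<lambda>x. fst (f x))" "continuous_on K (\<lambda>x. snd (f x))"
    by (intro continuous_intros assms(1))+
  moreover have "\<And>x. x \<in> K \<Longrightarrow> fst (f x) \<noteq> 0" "\<And>x. x \<in> K \<Longrightarrow> snd (f x) \<noteq> 0"
    using n by (metis norm_zero zero_neq_one)+
  ultimately obtain g h where g: "continuous_on K g" "\<And>x. x \<in> K \<Longrightarrow> fst (f x) = exp (g x)"
    and h: "continuous_on K h" "\<And>x. x \<in> K \<Longrightarrow> snd (f x) = exp (h x)"
    using continuous_logarithm_on_contractible[of K "\<lambda>x. fst (f x)"]
      continuous_logarithm_on_contractible[of K "\<lambda>x. snd (f x)"] assms(2) by metis
  show ?thesis
  proof
    show "continuous_on K (\<lambda>x. Complex (Im (g x)) (Im (h x)))"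
      unfolding Complex_eq by (intro continuous_intros g h)
    show "cov (Complex (Im (g x)) (Im (h x))) = f x" if "x \<in> K" for x
    proof -
      have "Re (g x) = 0" "Re (h x) = 0" using n[OF that] g(2) h(2) that by auto
      then have "exp (g x) = cis (Im (g x))" "exp (h x) = cis (Im (h x))"
        by (simp_all add: exp_eq_polar)
      then show ?thesis using g(2) h(2) that by (simp add: cov_def prod_eq_iff)
    qed
  qed
qed

text \<open>Adding the deck translation \<open>x - f p\<close> to \<open>f\<close> gives a lift
  through \<open>x\<close>; its continuity at \<open>p\<close> provides the nearby point.\<close>

lemma lift_near:
  fixes K :: "complex set"
  assumes "continuous_on K f" "P \<subseteq> K" "p \<in> K" "p \<in> closure P" "cov x = cov (f p)" "0 < r"
  shows "\<exists>q\<in>P. \<exists>y\<in>ball x r. cov y = cov (f q)"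
proof -
  obtain s where s: "0 < s" "\<And>q. q \<in> K \<Longrightarrow> dist q p < s \<Longrightarrow> dist (f q) (f p) < r"
    using assms(1,3,6) unfolding continuous_on_iff by metis
  obtain q where q: "q \<in> P" "dist q p < s" using assms(4) s(1) unfolding closure_approachable by blast
  have "cov (f q + (x - f p)) = cov (f q)"
    using cov_add[OF assms(5), of "f q - f p"] by (simp add: algebra_simps)
  moreover have "f q + (x - f p) \<in> ball x r"
    using s(2)[of q] q assms(2) by (auto simp: dist_norm norm_minus_commute algebra_simps)
  ultimately show ?thesis using q(1) by blast
qed

text \<open>By compactness, the part of the image of \<open>K\<close> far from \<open>f k\<close>
  projects away from a neighbourhood of \<open>cov (f k)\<close>. The part near \<open>f k\<close>
  is close enough to \<open>y\<close> for \<open>cov\<close> to be injective.\<close>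

lemma single_sheet:
  fixes K :: "complex set"
  assumes "compact K" "continuous_on K f" "inj_on (cov \<circ> f) K" "k \<in> K"
  obtains r where "0 < r" "\<And>y. y \<in> ball (f k) r \<Longrightarrow> cov y \<in> cov ` f ` K \<Longrightarrow> y \<in> f ` K"
proof -
  let ?K = "{x \<in> K. f x \<notin> ball (f k) 1}"
  have K: "?K = K \<inter> f -` (- ball (f k) 1)" by auto
  have "closed (- ball (f k) 1)" by (intro closed_Compl open_ball)
  then have "closed ?K"
    unfolding K using assms(1,2) compact_imp_closed continuous_closed_preimage by blast
  moreover have "bounded ?K"
    using compact_imp_bounded[OF assms(1)] by (rule bounded_subset) auto
  ultimately have "compact ?K" by (simp add: compact_eq_bounded_closed)
  then have "compact (cov ` f ` ?K)"
    using assms(2) by (intro compact_continuous_image continuous_on_cov) (auto intro: continuous_on_subset)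
  then have "open (- (cov ` f ` ?K))" by (simp add: compact_imp_closed open_Compl)
  then have "open (cov -` (- (cov ` f ` ?K)))"
    using continuous_on_cov[of UNIV] continuous_on_open_vimage[of UNIV cov] by simp
  moreover have "cov (f k) \<notin> cov ` f ` ?K"
  proof
    assume "cov (f k) \<in> cov ` f ` ?K"
    then obtain x where "x \<in> K" "f x \<notin> ball (f k) 1" "cov (f k) = cov (f x)" by auto
    then show False using inj_onD[OF assms(3), of k x] assms(4) by auto
  qed
  then have "f k \<in> cov -` (- (cov ` f ` ?K))" by blast
  ultimately obtain r where r: "0 < r" "ball (f k) r \<subseteq> cov -` (- (cov ` f ` ?K))"
    using openE by blast
  show ?thesis
  proof (rule that[of "min r 1"])
    fix y assume y: "y \<in> ball (f k) (min r 1)" "cov y \<in> cov ` f ` K"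
    then obtain x where x: "x \<in> K" "cov y = cov (f x)" by auto
    have "f x \<in> ball (f k) 1"
    proof (rule ccontr)
      assume "f x \<notin> ball (f k) 1"
      then have "cov y \<in> cov ` f ` ?K" using x by blast
      moreover have "y \<in> ball (f k) r" using y(1) by simp
      ultimately show False using r(2) by blast
    qed
    then have "dist y (f x) < 2"
      using y(1) dist_triangle[of y "f x" "f k"] by (simp add: dist_commute)
    then have "y = f x" using cov_inj_ball x by blast
    then show "y \<in> f ` K" using x by simp
  qed (use r in auto)
qed

section \<open>The standard triangle\<close>

definition tri :: "complex set" where "tri = convex hull {0, 1, \<i>}"

lemma tri_eq: "tri = {z. 0 \<le> Re z \<and> 0 \<le> Im z \<and> Re z + Im z \<le> 1}"
proof
  show "tri \<subseteq> {z. 0 \<le> Re z \<and> 0 \<le> Im z \<and> Re z + Im z \<le> 1}"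
    unfolding tri_def convex_hull_3 by auto
  show "{z. 0 \<le> Re z \<and> 0 \<le> Im z \<and> Re z + Im z \<le> 1} \<subseteq> tri"
  proof
    fix z assume "z \<in> {z. 0 \<le> Re z \<and> 0 \<le> Im z \<and> Re z + Im z \<le> 1}"
    moreover have "z = (1 - Re z - Im z) *\<^sub>R 0 + Re z *\<^sub>R 1 + Im z *\<^sub>R \<i>"
      by (simp add: complex_eq_iff)
    ultimately show "z \<in> tri"
      unfolding tri_def convex_hull_3
      by (intro CollectI exI[of _ "1 - Re z - Im z"] exI[of _ "Re z"] exI[of _ "Im z"]) auto
  qed
qed

lemma interior_tri: "interior tri = {z. 0 < Re z \<and> 0 < Im z \<and> Re z + Im z < 1}"
proof
  show "interior tri \<subseteq> {z. 0 < Re z \<and> 0 < Im z \<and> Re z + Im z < 1}"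
  proof
    fix z assume "z \<in> interior tri"
    then obtain e where e: "0 < e" "ball z e \<subseteq> tri" unfolding mem_interior by blast
    have m: "w \<in> tri" if "norm (w - z) < e" for w
      using e(2) that by (auto simp: dist_norm norm_minus_commute)
    have "z - of_real (e / 2) \<in> tri" "z - of_real (e / 2) * \<i> \<in> tri" "z + of_real (e / 2) \<in> tri"
      using e(1) by (intro m; simp add: norm_mult)+
    then show "z \<in> {z. 0 < Re z \<and> 0 < Im z \<and> Re z + Im z < 1}" using e(1) by (auto simp: tri_eq)
  qed
  have "open {z. 0 < Re z \<and> 0 < Im z \<and> Re z + Im z < 1}"
    by (intro open_Collect_conj open_Collect_less continuous_intros)
  then show "{z. 0 < Re z \<and> 0 < Im z \<and> Re z + Im z < 1} \<subseteq> interior tri"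
    by (intro interior_maximal) (auto simp: tri_eq)
qed

lemma tri_basic: "compact tri" "convex tri" "closure (interior tri) = tri"
proof -
  show "compact tri" "convex tri" unfolding tri_def by (simp_all add: finite_imp_compact_convex_hull)
  have "Complex (1/3) (1/3) \<in> interior tri" by (simp add: interior_tri)
  then show "closure (interior tri) = tri"
    using \<open>compact tri\<close> \<open>convex tri\<close> convex_closure_interior[of tri]
    by (metis closure_closed compact_imp_closed empty_iff)
qed

text \<open>Indices are natural numbers read modulo 3, so that \<open>Suc\<close> is the cyclic
  successor and the last side needs no special treatment.\<close>

definition corner :: "nat \<Rightarrow> complex" where
  "corner k = (if k mod 3 = 0 then 0 else if k mod 3 = 1 then 1 else \<i>)"

definition side :: "nat \<Rightarrow> complex set" where
  "side k = open_segment (corner k) (corner (Suc k))"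

lemma mod3_cases:
  obtains "k mod 3 = 0" "Suc k mod 3 = 1" | "k mod 3 = 1" "Suc k mod 3 = 2" |
    "k mod (3::nat) = 2" "Suc k mod 3 = 0"
proof -
  have "(k mod 3 = 0 \<and> Suc k mod 3 = 1) \<or> (k mod 3 = 1 \<and> Suc k mod 3 = 2) \<or>
    (k mod 3 = 2 \<and> Suc k mod 3 = 0)" by presburger
  then show ?thesis using that by (elim disjE conjE) simp_all
qed

lemma corner_add_3 [simp]: "corner (k + 3) = corner k" "corner (Suc (Suc (Suc k))) = corner k"
proof -
  show 1: "corner (k + 3) = corner k" by (simp add: corner_def)
  then show "corner (Suc (Suc (Suc k))) = corner k" by (simp add: numeral_3_eq_3)
qed

lemma corner_eq_iff: "corner k = corner l \<longleftrightarrow> k mod 3 = l mod 3"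
  by (cases k rule: mod3_cases; cases l rule: mod3_cases) (simp_all add: corner_def complex_eq_iff)

lemma corner_Suc_neq: "corner k \<noteq> corner (Suc k)"
  by (cases k rule: mod3_cases) (simp_all add: corner_def complex_eq_iff)

lemma side_eq: "side k =
    (if k mod 3 = 0 then {z. 0 < Re z \<and> Re z < 1 \<and> Im z = 0}
     else if k mod 3 = 1 then {z. 0 < Re z \<and> 0 < Im z \<and> Re z + Im z = 1}
     else {z. Re z = 0 \<and> 0 < Im z \<and> Im z < 1})"
proof -
  have 0: "open_segment 0 1 = {z. 0 < Re z \<and> Re z < 1 \<and> Im z = 0}"
  proof (intro set_eqI iffI)
    fix z assume "z \<in> {z. 0 < Re z \<and> Re z < 1 \<and> Im z = 0}"
    then show "z \<in> open_segment 0 1"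
      unfolding in_segment by (auto intro!: exI[of _ "Re z"] simp: complex_eq_iff)
  qed (auto simp: in_segment)
  have 1: "open_segment 1 \<i> = {z. 0 < Re z \<and> 0 < Im z \<and> Re z + Im z = 1}"
  proof (intro set_eqI iffI)
    fix z assume "z \<in> {z. 0 < Re z \<and> 0 < Im z \<and> Re z + Im z = 1}"
    then show "z \<in> open_segment 1 \<i>"
      unfolding in_segment by (auto intro!: exI[of _ "Im z"] simp: complex_eq_iff)
  qed (auto simp: in_segment)
  have 2: "open_segment \<i> 0 = {z. Re z = 0 \<and> 0 < Im z \<and> Im z < 1}"
  proof (intro set_eqI iffI)
    fix z assume "z \<in> {z. Re z = 0 \<and> 0 < Im z \<and> Im z < 1}"
    then show "z \<in> open_segment \<i> 0"
      unfolding in_segment by (auto intro!: exI[of _ "1 - Im z"] simp: complex_eq_iff)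
  qed (auto simp: in_segment)
  show ?thesis
    by (cases k rule: mod3_cases) (simp_all add: side_def corner_def 0 1 2)
qed

lemma closed_side: "closed_segment (corner k) (corner (Suc k)) = insert (corner k) (insert (corner (Suc k)) (side k))"
  by (auto simp: side_def open_segment_def)

lemma closure_side: "closure (side k) = closed_segment (corner k) (corner (Suc k))"
  using corner_Suc_neq by (simp add: side_def)

lemma tri_cases:
  assumes "z \<in> tri"
  obtains "z \<in> interior tri" | k where "z \<in> side k" | k where "z = corner k"
proof -
  have s: "side 0 = {z. 0 < Re z \<and> Re z < 1 \<and> Im z = 0}"
    "side 1 = {z. 0 < Re z \<and> 0 < Im z \<and> Re z + Im z = 1}"
    "side 2 = {z. Re z = 0 \<and> 0 < Im z \<and> Im z < 1}" by (simp_all add: side_eq)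
  have c: "corner 0 = 0" "corner 1 = 1" "corner 2 = \<i>" by (simp_all add: corner_def)
  have "z \<in> interior tri \<or> z \<in> side 0 \<or> z \<in> side 1 \<or> z \<in> side 2 \<or>
      z = corner 0 \<or> z = corner 1 \<or> z = corner 2"
    using assms unfolding interior_tri unfolding tri_eq s c complex_eq_iff mem_Collect_eq
      zero_complex.sel one_complex.sel imaginary_unit.sel by linarith
  then show ?thesis using that by blast
qed

lemma tri_parts:
  "side k \<subseteq> tri" "corner k \<in> tri" "side k \<inter> interior tri = {}" "corner k \<notin> interior tri"
  "corner l \<notin> side k" "k mod 3 \<noteq> l mod 3 \<Longrightarrow> side k \<inter> side l = {}"
proof -
  show "side k \<subseteq> tri"
    by (cases k rule: mod3_cases) (auto simp: side_eq tri_eq)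
  show "side k \<inter> interior tri = {}"
    by (cases k rule: mod3_cases) (auto simp: side_eq interior_tri)
  show "corner k \<in> tri"
    by (cases k rule: mod3_cases) (auto simp: corner_def tri_eq)
  show "corner k \<notin> interior tri"
    by (cases k rule: mod3_cases) (auto simp: corner_def interior_tri)
  show "corner l \<notin> side k"
    by (cases k rule: mod3_cases; cases l rule: mod3_cases) (auto simp: side_eq corner_def)
  show "k mod 3 \<noteq> l mod 3 \<Longrightarrow> side k \<inter> side l = {}"
    by (cases k rule: mod3_cases; cases l rule: mod3_cases) (auto simp: side_eq)
qed

section \<open>Boundary curves and winding numbers\<close>

definition bside :: "(complex \<Rightarrow> complex) \<Rightarrow> nat \<Rightarrow> real \<Rightarrow> complex" where
  "bside f k = f \<circ> linepath (corner k) (corner (Suc k))"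

text \<open>A sum over the sides, rather than the winding number of a loop, has no preferred
  starting corner, and the contribution of a single side can be split off.\<close>

definition boundary_winding :: "(complex \<Rightarrow> complex) \<Rightarrow> complex \<Rightarrow> complex" where
  "boundary_winding f z =
     winding_number (bside f 0) z + winding_number (bside f 1) z + winding_number (bside f 2) z"

definition bloop :: "(complex \<Rightarrow> complex) \<Rightarrow> nat \<Rightarrow> real \<Rightarrow> complex" where
  "bloop f k = bside f k +++ (bside f (Suc k) +++ bside f (Suc (Suc k)))"

definition boundary :: "complex set" where
  "boundary = (\<Union>k. closed_segment (corner k) (corner (Suc k)))"

lemma corner_mod: "corner (k mod 3) = corner k" "corner (Suc (k mod 3)) = corner (Suc k)"
  by (simp_all add: corner_def mod_Suc_eq)

lemma corner_cong: "l mod 3 = k mod 3 \<Longrightarrow> corner l = corner k \<and> corner (Suc l) = corner (Suc k)"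
  using corner_mod[of l] corner_mod[of k] by simp

lemma mod3_Suc:
  "(k mod 3 = 0 \<and> Suc k mod 3 = 1 \<and> Suc (Suc k) mod 3 = 2) \<or>
   (k mod 3 = 1 \<and> Suc k mod 3 = 2 \<and> Suc (Suc k) mod 3 = 0) \<or>
   (k mod 3 = 2 \<and> Suc k mod 3 = 0 \<and> Suc (Suc k) mod (3::nat) = 1)"
proof -
  have "k mod 3 < 3" by simp
  then show ?thesis by (simp add: mod_Suc) linarith
qed

lemma bside_mod: "bside f (k mod 3) = bside f k"
  unfolding bside_def corner_mod ..

lemma boundary_eq: "boundary = tri - interior tri"
proof
  show "boundary \<subseteq> tri - interior tri"
    unfolding boundary_def closed_side using tri_parts(1-4) by blast
  show "tri - interior tri \<subseteq> boundary"
  proof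
    fix z assume z: "z \<in> tri - interior tri"
    have side: "w \<in> boundary" if "w \<in> insert (corner k) (side k)" for w k
      using that unfolding boundary_def closed_side by blast
    from z have "z \<in> tri" by blast
    then show "z \<in> boundary"
    proof (cases rule: tri_cases)
      case 1
      then show ?thesis using z by blast
    next
      case (2 k)
      then show ?thesis using side by blast
    next
      case (3 k)
      then show ?thesis using side by blast
    qed
  qed
qed

lemma boundary_three: "boundary = closed_segment (corner k) (corner (Suc k)) \<union>
    (closed_segment (corner (Suc k)) (corner (Suc (Suc k))) \<union>
     closed_segment (corner (Suc (Suc k))) (corner (Suc (Suc (Suc k)))))"
proof -
  have "closed_segment (corner l) (corner (Suc l)) \<subseteq> closed_segment (corner k) (corner (Suc k)) \<union>
    (closed_segment (corner (Suc k)) (corner (Suc (Suc k))) \<union>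
     closed_segment (corner (Suc (Suc k))) (corner (Suc (Suc (Suc k)))))" for l
  proof -
    have "l mod 3 < 3" by simp
    then have "l mod 3 = k mod 3 \<or> l mod 3 = Suc k mod 3 \<or> l mod 3 = Suc (Suc k) mod 3"
      using mod3_Suc[of k] by linarith
    then have "closed_segment (corner l) (corner (Suc l)) \<in> {closed_segment (corner k) (corner (Suc k)),
        closed_segment (corner (Suc k)) (corner (Suc (Suc k))),
        closed_segment (corner (Suc (Suc k))) (corner (Suc (Suc (Suc k))))}"
    proof (elim disjE)
      assume "l mod 3 = k mod 3"
      from corner_cong[OF this] show ?thesis by (simp only: insert_iff simp_thms)
    next
      assume "l mod 3 = Suc k mod 3"
      from corner_cong[OF this] show ?thesis by (simp only: insert_iff simp_thms)
    next
      assume "l mod 3 = Suc (Suc k) mod 3"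
      from corner_cong[OF this] show ?thesis by (simp only: insert_iff simp_thms)
    qed
    then show ?thesis by blast
  qed
  then show ?thesis unfolding boundary_def by blast
qed

lemma boundary_winding_rotate:
  "boundary_winding f z = winding_number (bside f k) z + winding_number (bside f (Suc k)) z
     + winding_number (bside f (Suc (Suc k))) z"
proof -
  have "bside f (Suc k) = bside f (Suc k mod 3)" "bside f (Suc (Suc k)) = bside f (Suc (Suc k) mod 3)"
    "bside f k = bside f (k mod 3)" by (simp_all add: bside_mod)
  moreover note mod3_Suc[of k]
  ultimately show ?thesis by (elim disjE conjE) (simp_all only: boundary_winding_def add_ac)
qed

locale embedded_triangle =
  fixes f :: "complex \<Rightarrow> complex"
  assumes cont: "continuous_on tri f" and inj: "inj_on f tri"
begin

lemma segment_subset: "closed_segment (corner k) (corner (Suc k)) \<subseteq> tri"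
  unfolding closed_side using tri_parts(1,2) by blast

lemma bside_image: "path_image (bside f k) = f ` closed_segment (corner k) (corner (Suc k))"
  by (simp add: bside_def path_image_compose)

lemma bside_ends [simp]: "pathstart (bside f k) = f (corner k)" "pathfinish (bside f k) = f (corner (Suc k))"
  by (simp_all add: bside_def pathstart_compose pathfinish_compose)

lemma arc_bside: "arc (bside f k)"
proof -
  have "simple_path (bside f k)"
    unfolding bside_def
  proof (rule simple_path_continuous_image)
    show "simple_path (linepath (corner k) (corner (Suc k)))"
      using corner_Suc_neq by (simp add: simple_path_linepath)
  qed (use cont inj segment_subset in \<open>auto intro: continuous_on_subset inj_on_subset\<close>)
  moreover have "f (corner (Suc k)) \<noteq> f (corner k)"
    using inj corner_Suc_neq tri_parts(2) by (metis inj_onD)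
  ultimately show ?thesis by (simp add: simple_path_eq_arc)
qed

lemma path_bside: "path (bside f k)"
  using arc_bside by (rule arc_imp_path)

lemma closed_side_Int:
  "closed_segment (corner k) (corner (Suc k)) \<inter> closed_segment (corner (Suc k)) (corner (Suc (Suc k)))
    = {corner (Suc k)}"
proof -
  have "k mod 3 \<noteq> Suc k mod 3" "k mod 3 \<noteq> Suc (Suc k) mod 3" "Suc k mod 3 \<noteq> Suc (Suc k) mod 3"
    using mod3_Suc[of k] by auto
  then show ?thesis
    unfolding closed_side
    using tri_parts(5)[of "Suc k" k] tri_parts(5)[of "Suc (Suc k)" k] tri_parts(5)[of k "Suc k"]
      tri_parts(6)[of k "Suc k"] corner_eq_iff[of k "Suc k"] corner_eq_iff[of k "Suc (Suc k)"]
    by auto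
qed

lemma arc_two_sides: "arc (bside f k +++ bside f (Suc k))"
proof (rule arc_join)
  have "path_image (bside f k) \<inter> path_image (bside f (Suc k)) = f ` {corner (Suc k)}"
    unfolding bside_image closed_side_Int[symmetric]
    using inj_on_image_Int[OF inj segment_subset segment_subset, of k "Suc k"] by simp
  then show "path_image (bside f k) \<inter> path_image (bside f (Suc k)) \<subseteq> {pathstart (bside f (Suc k))}"
    by simp
qed (simp_all add: arc_bside)

lemma simple_bloop: "simple_path (bloop f k)" "pathfinish (bloop f k) = pathstart (bloop f k)"
proof -
  have img: "path_image (bside f (Suc k) +++ bside f (Suc (Suc k)))
      = f ` (closed_segment (corner (Suc k)) (corner (Suc (Suc k))) \<union>
         closed_segment (corner (Suc (Suc k))) (corner k))"
    using bside_image[of "Suc (Suc k)"] by (simp add: path_image_join bside_image image_Un)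
  have "path_image (bside f k) \<inter> path_image (bside f (Suc k) +++ bside f (Suc (Suc k)))
      = f ` {corner (Suc k), corner k}"
    unfolding img bside_image[of k]
    using inj_on_image_Int[OF inj segment_subset[of k], symmetric,
        of "closed_segment (corner (Suc k)) (corner (Suc (Suc k))) \<union>
         closed_segment (corner (Suc (Suc k))) (corner k)"]
      segment_subset[of "Suc k"] segment_subset[of "Suc (Suc k)"]
      closed_side_Int[of k] closed_side_Int[of "Suc (Suc k)"]
    by (simp add: Int_Un_distrib Int_commute insert_commute)
  then show "simple_path (bloop f k)"
    unfolding bloop_def
    by (intro simple_path_join_loop arc_bside arc_two_sides) auto
  show "pathfinish (bloop f k) = pathstart (bloop f k)" by (simp add: bloop_def)
qed

lemma bloop_image: "path_image (bloop f k) = f ` boundary"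
  unfolding bloop_def boundary_three[of k]
  by (simp add: path_image_join bside_image image_Un del: corner_add_3)

lemma bloop_winding:
  assumes "z \<notin> f ` boundary"
  shows "winding_number (bloop f k) z = boundary_winding f z"
proof -
  have "z \<notin> path_image (bside f l)" for l
    using assms unfolding bside_image boundary_def by blast
  then show ?thesis
    unfolding bloop_def boundary_winding_rotate[of f z k]
    by (simp add: winding_number_join path_bside path_image_join)
qed

lemma jordan:
  "connected (inside (f ` boundary))" "connected (outside (f ` boundary))"
  "\<not> bounded (outside (f ` boundary))" "frontier (outside (f ` boundary)) = f ` boundary"
  using Jordan_inside_outside[OF simple_bloop[of 0]] unfolding bloop_image by (simp_all only: simp_thms)

text \<open>The image of the interior is open by invariance of domain, and it is closed off the
  curve because the whole image is compact. So a connected set off the curve lies in it or misses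
  it. The unbounded outside cannot lie in it, which leaves the inside.\<close>

lemma inside_boundary: "inside (f ` boundary) = f ` interior tri"
proof -
  let ?J = "f ` boundary"
  have "f ` boundary \<union> f ` interior tri = f ` tri"
    unfolding boundary_eq using interior_subset[of tri] by blast
  have disj: "f ` interior tri \<inter> ?J = {}"
    unfolding boundary_eq using inj interior_subset[of tri] by (auto dest: inj_onD)
  have op: "open (f ` interior tri)"
    using cont inj interior_subset by (intro invariance_of_domain) (auto intro: continuous_on_subset inj_on_subset)
  have con: "connected (f ` interior tri)"
    using cont interior_subset tri_basic(2)
    by (intro connected_continuous_image) (auto intro: continuous_on_subset simp: convex_connected)
  have cl: "closed (f ` tri)"
    using compact_continuous_image[OF cont tri_basic(1)] by (rule compact_imp_closed)
  have eq: "f ` interior tri = f ` tri - ?J"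
    unfolding boundary_eq using inj interior_subset[of tri] by (auto dest: inj_onD)
  have ne: "f ` interior tri \<noteq> {}"
  proof -
    have "Complex (1/3) (1/3) \<in> interior tri" by (simp add: interior_tri)
    then show ?thesis by blast
  qed
  have all_or_none: "C \<subseteq> f ` interior tri \<or> C \<inter> f ` interior tri = {}"
    if "connected C" "C \<inter> ?J = {}" for C
  proof (rule ccontr)
    assume no: "\<not> ?thesis"
    have "open (- (f ` tri))" using cl by (rule open_Compl)
    moreover have "C \<subseteq> f ` interior tri \<union> - (f ` tri)" using eq that(2) by blast
    moreover have "f ` interior tri \<inter> - (f ` tri) \<inter> C = {}" using eq by blast
    moreover have "f ` interior tri \<inter> C \<noteq> {}" using no by blast
    moreover have "- (f ` tri) \<inter> C \<noteq> {}" using no eq that(2) by blast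
    ultimately show False using connectedD[OF that(1) op] by blast
  qed
  have "outside ?J \<inter> f ` interior tri = {}"
  proof (rule ccontr)
    assume "\<not> ?thesis"
    moreover have "connected (outside ?J)" "outside ?J \<inter> ?J = {}"
      using jordan(2) outside_no_overlap by blast+
    ultimately have "outside ?J \<subseteq> f ` tri" using all_or_none eq by blast
    moreover have "bounded (f ` tri)"
      using compact_continuous_image[OF cont tri_basic(1)] by (rule compact_imp_bounded)
    ultimately show False using jordan(3) bounded_subset by blast
  qed
  then have sub: "f ` interior tri \<subseteq> inside ?J"
    using disj inside_Un_outside[of ?J] by blast
  moreover have "connected (inside ?J)" "inside ?J \<inter> ?J = {}"
    using jordan(1) inside_no_overlap by blast+
  ultimately show ?thesis using all_or_none[of "inside ?J"] ne by blast
qed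

lemma boundary_winding_inside:
  obtains s where "s = 1 \<or> s = -1" "\<And>z. z \<in> f ` interior tri \<Longrightarrow> boundary_winding f z = s"
proof -
  have *: "winding_number (bloop f 0) z = boundary_winding f z" if "z \<in> f ` interior tri" for z
    using that inside_no_overlap[of "f ` boundary"] bloop_winding unfolding inside_boundary by blast
  show ?thesis
    using simple_closed_path_winding_number_inside[OF simple_bloop(1)[of 0]]
    unfolding bloop_image inside_boundary using * that by metis
qed

lemma boundary_winding_outside:
  assumes "z \<notin> f ` tri"
  shows "boundary_winding f z = 0"
proof -
  have z: "z \<notin> f ` boundary" "z \<notin> f ` interior tri"
    using assms interior_subset[of tri] by (auto simp: boundary_eq)
  then have "z \<in> outside (path_image (bloop f 0))"
    unfolding bloop_image using inside_Un_outside[of "f ` boundary"] inside_boundary by blast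
  then have "winding_number (bloop f 0) z = 0"
    using simple_bloop[of 0] by (intro winding_number_zero_in_outside) (auto simp: simple_path_imp_path)
  then show ?thesis using bloop_winding z by simp
qed

lemma outside_near:
  assumes "z \<in> f ` boundary" "0 < r"
  shows "\<exists>y\<in>ball z r. y \<notin> f ` tri"
proof -
  have "z \<in> closure (outside (f ` boundary))"
    using jordan(4) assms(1) unfolding frontier_def by blast
  then obtain y where y: "y \<in> outside (f ` boundary)" "dist y z < r"
    using assms(2) unfolding closure_approachable by blast
  have "f ` tri = f ` boundary \<union> f ` interior tri"
    unfolding boundary_eq using interior_subset[of tri] by blast
  then have "y \<notin> f ` tri"
    using y(1) outside_no_overlap[of "f ` boundary"] inside_Int_outside[of "f ` boundary"]
      inside_boundary by blast
  then show ?thesis using y(2) by (auto simp: dist_commute)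
qed

end

text \<open>Running along \<open>g\<close> and back along \<open>h\<close> gives a closed path whose
  image is an arc. An arc has empty inside, so the winding number vanishes.\<close>

lemma winding_number_arcs_eq:
  assumes "arc g" "path h" "path_image g = path_image h" "pathstart g = pathstart h"
    "pathfinish g = pathfinish h" "z \<notin> path_image g"
  shows "winding_number g z = winding_number h z"
proof -
  let ?p = "g +++ reversepath h"
  have img: "path_image ?p = path_image g" using assms by (simp add: path_image_join)
  have "path ?p" using assms by (simp add: arc_imp_path)
  moreover have "z \<in> outside (path_image ?p)"
    unfolding img using inside_arc_empty[OF assms(1)] inside_Un_outside[of "path_image g"] assms(6) by blast
  ultimately have "winding_number ?p z = 0"
    using assms by (intro winding_number_zero_in_outside) simp_all
  moreover have "winding_number ?p z = winding_number g z - winding_number h z"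
    using assms by (simp add: winding_number_join winding_number_reversepath arc_imp_path)
  ultimately show ?thesis by simp
qed

section \<open>Lifting the faces to the plane\<close>

locale torus_triangulation =
  fixes G :: "('v, 'e) multigraph" and pos :: "'v \<Rightarrow> complex \<times> complex"
    and \<gamma> :: "'e \<Rightarrow> real \<Rightarrow> complex \<times> complex"
  assumes triangulates: "triangulates torus G pos \<gamma>" and loopless: "loopless G"
begin

abbreviation eint where "eint e \<equiv> edge_interior \<gamma> e"
abbreviation Faces where "Faces \<equiv> faces torus G pos \<gamma>"

definition drawing where "drawing = pos ` verts G \<union> (\<Union>e\<in>edges G. path_image (\<gamma> e))"

lemma finite_graph: "finite (verts G)" "finite (edges G)"
  and ends_subset: "e \<in> edges G \<Longrightarrow> ends G e \<subseteq> verts G"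
  and card_ends: "e \<in> edges G \<Longrightarrow> card (ends G e) = 2"
  using triangulates loopless
  by (auto simp: triangulates_def finite_multigraph_def loopless_def)

lemma embedded: "embedded_in torus G pos \<gamma>"
  using triangulates by (simp add: triangulates_def)

lemma inj_pos: "inj_on pos (verts G)" and pos_torus: "pos ` verts G \<subseteq> torus"
  using embedded by (simp_all add: embedded_in_def)

lemma edge_curve:
  assumes "e \<in> edges G"
  shows "simple_path (\<gamma> e)" "path_image (\<gamma> e) \<subseteq> torus"
    "{pathstart (\<gamma> e), pathfinish (\<gamma> e)} = pos ` ends G e" "eint e \<inter> pos ` verts G = {}"
  using embedded assms by (auto simp: embedded_in_def)

lemma eint_disjoint: "e \<in> edges G \<Longrightarrow> f \<in> edges G \<Longrightarrow> e \<noteq> f \<Longrightarrow> eint e \<inter> eint f = {}"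
  using embedded by (simp add: embedded_in_def)

lemma path_image_edge: "e \<in> edges G \<Longrightarrow> path_image (\<gamma> e) = eint e \<union> pos ` ends G e"
proof -
  assume e: "e \<in> edges G"
  have "{0..1 :: real} = insert 0 (insert 1 {0<..<1})" by auto
  then have "path_image (\<gamma> e) = eint e \<union> {pathstart (\<gamma> e), pathfinish (\<gamma> e)}"
    by (auto simp: path_image_def edge_interior_def pathstart_def pathfinish_def)
  then show ?thesis using edge_curve(3)[OF e] by simp
qed

lemma path_image_subset_closure:
  assumes "e \<in> edges G" "eint e \<subseteq> S" "closed S"
  shows "path_image (\<gamma> e) \<subseteq> S"
proof -
  have "continuous_on {0..1} (\<gamma> e)"
    using edge_curve(1)[OF assms(1)] by (simp add: simple_path_def path_def)
  moreover have "closure {0<..<1 :: real} = {0..1}" by simp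
  ultimately show ?thesis
    using image_closure_subset[of "{0<..<1}" "\<gamma> e" S] assms(2,3)
    by (simp add: edge_interior_def path_image_def)
qed

lemma arc_edge: "e \<in> edges G \<Longrightarrow> arc (\<gamma> e)"
proof -
  assume e: "e \<in> edges G"
  have "pathfinish (\<gamma> e) \<noteq> pathstart (\<gamma> e)"
  proof
    assume "pathfinish (\<gamma> e) = pathstart (\<gamma> e)"
    then have "pos ` ends G e = {pathstart (\<gamma> e)}" using edge_curve(3)[OF e] by simp
    moreover have "card (pos ` ends G e) = 2"
      using card_ends[OF e] inj_pos ends_subset[OF e] by (simp add: card_image inj_on_subset)
    ultimately show False by simp
  qed
  then show ?thesis using edge_curve(1)[OF e] by (simp add: simple_path_eq_arc)
qed

lemma drawing_eq: "drawing = pos ` verts G \<union> (\<Union>e\<in>edges G. eint e)"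
proof -
  have "path_image (\<gamma> e) \<subseteq> pos ` verts G \<union> eint e" if "e \<in> edges G" for e
    using path_image_edge[OF that] ends_subset[OF that] by blast
  moreover have "eint e \<subseteq> path_image (\<gamma> e)" if "e \<in> edges G" for e
    using path_image_edge[OF that] by blast
  ultimately show ?thesis unfolding drawing_def by blast
qed

lemma Faces_eq: "Faces = components (torus - drawing)"
  by (simp add: faces_def drawing_def)

lemma face_drawing: "F \<in> Faces \<Longrightarrow> F \<inter> drawing = {}" "F \<in> Faces \<Longrightarrow> F \<subseteq> torus"
  unfolding Faces_eq using in_components_subset by blast+

lemma faces_disjoint: "F \<in> Faces \<Longrightarrow> F' \<in> Faces \<Longrightarrow> F \<noteq> F' \<Longrightarrow> F \<inter> F' = {}"
  unfolding Faces_eq using components_nonoverlap by blast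

lemma torus_cases:
  assumes "x \<in> torus"
  obtains v where "v \<in> verts G" "x = pos v" | e where "e \<in> edges G" "x \<in> eint e"
    | F where "F \<in> Faces" "x \<in> F"
proof (cases "x \<in> drawing")
  case True
  then show ?thesis using that unfolding drawing_eq by blast
next
  case False
  then have "x \<in> \<Union>(components (torus - drawing))" using assms Union_components by blast
  then show ?thesis using that unfolding Faces_eq by blast
qed

text \<open>\<open>f\<close> lifts a parametrised closed face to the plane, and \<open>v\<close> and
  \<open>e\<close> name its corners and sides in cyclic order. Injectivity is required after
  projection, so the closed face is embedded in the torus itself.\<close>

definition lifted :: "(complex \<times> complex) set \<Rightarrow> (complex \<Rightarrow> complex) \<Rightarrow> (nat \<Rightarrow> 'v) \<Rightarrow> (nat \<Rightarrow> 'e) \<Rightarrow> bool"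
  where "lifted F f v e \<longleftrightarrow> F \<in> Faces \<and> continuous_on tri f \<and> inj_on (cov \<circ> f) tri \<and>
    cov ` f ` interior tri = F \<and> (\<forall>k. v (k mod 3) = v k \<and> e (k mod 3) = e k) \<and>
    (\<forall>k. v k \<in> verts G \<and> cov (f (corner k)) = pos (v k)) \<and>
    (\<forall>k. e k \<in> edges G \<and> ends G (e k) = {v k, v (Suc k)} \<and> cov ` f ` side k = eint (e k))"

text \<open>Without loops consecutive corners, hence all three, are distinct. Then the sides have
  different pairs of ends, so they are different edges even when parallel edges exist, and the parts
  of the triangle go to disjoint parts of the drawing.\<close>

lemma inj_on_triangle:
  assumes F: "F \<in> Faces" and im: "g ` interior tri = F" "inj_on g (interior tri)"
    and v: "\<And>k. v k \<in> verts G \<and> g (corner k) = pos (v k)"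
    and e: "\<And>k. e k \<in> edges G \<and> ends G (e k) = {v k, v (Suc k)} \<and> g ` side k = eint (e k) \<and> inj_on g (side k)"
  shows "inj_on g tri"
proof (rule inj_onI)
  fix x y assume xy: "x \<in> tri" "y \<in> tri" "g x = g y"
  have vS: "v k \<noteq> v (Suc k)" for k using card_ends[of "e k"] e[of k] by (auto simp: card_insert_if)
  have vmod: "v k = v l" if "k mod 3 = l mod 3" for k l
    using v[of k] v[of l] corner_eq_iff[of k l] that inj_pos by (auto dest: inj_onD)
  have vne: "v k \<noteq> v l" if "k mod 3 \<noteq> l mod 3" for k l
  proof -
    have "l mod 3 = Suc k mod 3 \<or> k mod 3 = Suc l mod 3"
      using that mod3_Suc[of k] mod3_Suc[of l] by linarith
    then show ?thesis using vS[of k] vS[of l] vmod by metis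
  qed
  have ene: "e k \<noteq> e l" if kl: "k mod 3 \<noteq> l mod 3" for k l
  proof
    assume "e k = e l"
    then have eq: "{v k, v (Suc k)} = {v l, v (Suc l)}" using e[of k] e[of l] by simp
    have "v k \<noteq> v l" using vne kl by blast
    then have "v k = v (Suc l)" "v (Suc k) = v l" using eq by (auto simp: doubleton_eq_iff)
    then have "k mod 3 = Suc l mod 3" "Suc k mod 3 = l mod 3" using vne by blast+
    then show False using mod3_Suc[of k] mod3_Suc[of l] by linarith
  qed
  have d1: "F \<inter> pos ` verts G = {}" "F \<inter> eint (e k) = {}" for k
    using face_drawing(1)[OF F] e[of k] unfolding drawing_eq by blast+
  have d2: "eint (e k) \<inter> pos ` verts G = {}" for k using edge_curve(4) e[of k] by blast
  have gI: "g z \<in> F" if "z \<in> interior tri" for z using im that by blast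
  have gS: "g z \<in> eint (e k)" if "z \<in> side k" for z k using e[of k] that by blast
  have gC: "g (corner k) \<in> pos ` verts G" for k using v[of k] by blast
  have clash: False if "a \<in> A" "b \<in> B" "A \<inter> B = {}" "a = b" for a b :: "complex \<times> complex" and A B
    using that by auto
  show "x = y"
    using xy(1)
  proof (cases rule: tri_cases)
    case 1
    show ?thesis
      using xy(2)
    proof (cases rule: tri_cases)
      case 1
      then show ?thesis using \<open>x \<in> interior tri\<close> im(2) xy(3) by (simp add: inj_onD)
    next
      case (2 k)
      then show ?thesis using clash[OF gI[OF 1] gS[OF 2] d1(2) xy(3)] by simp
    next
      case (3 k)
      then show ?thesis using clash[OF gI[OF 1] gC[of k] d1(1)] xy(3) by simp
    qed
  next
    case x: (2 k)
    show ?thesis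
      using xy(2)
    proof (cases rule: tri_cases)
      case 1
      then show ?thesis using clash[OF gI[OF 1] gS[OF x] d1(2) xy(3)[symmetric]] by simp
    next
      case (2 l)
      show ?thesis
      proof (cases "k mod 3 = l mod 3")
        case True
        then have "side k = side l" unfolding side_def using corner_cong[of k l] by simp
        then show ?thesis using e[of k] x 2 xy(3) inj_onD[of g "side k" x y] by blast
      next
        case False
        then have "eint (e k) \<inter> eint (e l) = {}" using eint_disjoint ene e by blast
        then show ?thesis using clash[OF gS[OF x] gS[OF 2]] xy(3) by simp
      qed
    next
      case (3 l)
      then show ?thesis using clash[OF gS[OF x] gC[of l] d2] xy(3) by simp
    qed
  next
    case x: (3 k)
    show ?thesis
      using xy(2)
    proof (cases rule: tri_cases)
      case 1
      then show ?thesis using clash[OF gI[OF 1] gC[of k] d1(1)] x xy(3) by simp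
    next
      case (2 l)
      then show ?thesis using clash[OF gS[OF 2] gC[of k] d2] x xy(3) by simp
    next
      case (3 l)
      then have "pos (v k) = pos (v l)" using x xy(3) v[of k] v[of l] by simp
      then have "v k = v l" using inj_pos v by (metis inj_onD)
      then have "k mod 3 = l mod 3" using vne by blast
      then show ?thesis using x 3 corner_eq_iff by simp
    qed
  qed
qed

lemma corner_range: "corner k \<in> {0, 1, \<i>}"
  by (simp add: corner_def)

lemma lifted_exists:
  assumes F: "F \<in> Faces"
  shows "\<exists>f v e. lifted F f v e"
proof -
  have "triangular_face G pos \<gamma> F" using triangulates F by (simp add: triangulates_def)
  then obtain g where g0: "continuous_on tri g \<and> (\<exists>\<psi>. homeomorphism (interior tri) F g \<psi>) \<and>
    g ` {0, 1, \<i>} \<subseteq> pos ` verts G \<and> (\<forall>p\<in>{0, 1, \<i>}. \<forall>q\<in>{0, 1, \<i>}. p \<noteq> q \<longrightarrow>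
      (\<exists>e\<in>edges G. \<exists>\<psi>. homeomorphism (open_segment p q) (eint e) g \<psi>))"
    unfolding triangular_face_def tri_def[symmetric] by (elim exE)
  note g = conjunct1[OF g0] conjunct1[OF conjunct2[OF g0]]
    conjunct1[OF conjunct2[OF conjunct2[OF g0]]]
    conjunct2[OF conjunct2[OF conjunct2[OF g0]], rule_format]
  have homeo: "h ` A = B \<and> inj_on h A" if "\<exists>\<psi>. homeomorphism A B h \<psi>"
    for A :: "complex set" and B :: "(complex \<times> complex) set" and h
  proof -
    from that obtain \<psi> where "homeomorphism A B h \<psi>" by blast
    then have "h ` A = B" "\<And>x. x \<in> A \<Longrightarrow> \<psi> (h x) = x" by (simp_all add: homeomorphism_def)
    then show ?thesis using inj_on_inverseI by blast
  qed
  have int: "g ` interior tri = F" "inj_on g (interior tri)" using homeo[OF g(2)] by auto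
  define v where "v k = the_inv_into (verts G) pos (g (corner k))" for k
  have v: "v k \<in> verts G \<and> g (corner k) = pos (v k)" for k
  proof -
    have c: "g (corner k) \<in> pos ` verts G" using g(3) corner_range[of k] by blast
    show ?thesis
      unfolding v_def using f_the_inv_into_f[OF inj_pos c] the_inv_into_into[OF inj_pos c, of "verts G"] by simp
  qed
  have ex: "\<exists>e. e \<in> edges G \<and> g ` side k = eint e \<and> inj_on g (side k)" for k
  proof -
    obtain e where "e \<in> edges G"
      "\<exists>\<psi>. homeomorphism (open_segment (corner k) (corner (Suc k))) (eint e) g \<psi>"
      using g(4)[OF corner_range corner_range corner_Suc_neq] by blast
    then show ?thesis using homeo unfolding side_def by blast
  qed
  define e where "e k = (SOME e. e \<in> edges G \<and> g ` side k = eint e \<and> inj_on g (side k))" for k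
  have e: "e k \<in> edges G \<and> g ` side k = eint (e k) \<and> inj_on g (side k)" for k
    unfolding e_def by (rule someI_ex[OF ex])
  have "side (k mod 3) = side k" for k unfolding side_def corner_mod ..
  then have per: "v (k mod 3) = v k \<and> e (k mod 3) = e k" for k
    unfolding v_def e_def corner_mod by simp
  \<comment> \<open>The image of the closed side is compact and so contains the whole curve of the
    edge, ends included. These can only be the images of the two corners.\<close>
  have ends: "ends G (e k) = {v k, v (Suc k)}" for k
  proof -
    let ?S = "g ` closed_segment (corner k) (corner (Suc k))"
    have sub: "closed_segment (corner k) (corner (Suc k)) \<subseteq> tri"
      unfolding closed_side using tri_parts(1,2) by blast
    have "closed ?S"
      using g(1) sub by (intro compact_imp_closed compact_continuous_image)
        (auto intro: continuous_on_subset)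
    moreover have S: "?S = eint (e k) \<union> {pos (v k), pos (v (Suc k))}"
      unfolding closed_side using e[of k] v by auto
    ultimately have "path_image (\<gamma> (e k)) \<subseteq> eint (e k) \<union> {pos (v k), pos (v (Suc k))}"
      using path_image_subset_closure[of "e k" ?S] e[of k] by blast
    then have sub2: "pos ` ends G (e k) \<subseteq> pos ` {v k, v (Suc k)}"
    proof -
      have ek: "e k \<in> edges G" using e[of k] by blast
      have "pos ` ends G (e k) \<subseteq> pos ` verts G" using ends_subset[OF ek] by (rule image_mono)
      then have "pos ` ends G (e k) \<inter> eint (e k) = {}" using edge_curve(4)[OF ek] by blast
      moreover have "pos ` ends G (e k) \<subseteq> path_image (\<gamma> (e k))" using path_image_edge[OF ek] by simp
      ultimately show ?thesis
        using \<open>path_image (\<gamma> (e k)) \<subseteq> eint (e k) \<union> {pos (v k), pos (v (Suc k))}\<close> by auto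
    qed
    have "ends G (e k) \<subseteq> {v k, v (Suc k)}"
    proof
      fix u assume u: "u \<in> ends G (e k)"
      then obtain w where "w \<in> {v k, v (Suc k)}" "pos u = pos w" using sub2 by blast
      moreover have "u \<in> verts G" using u ends_subset[of "e k"] e[of k] by blast
      moreover have "w \<in> verts G" using v[of k] v[of "Suc k"] calculation(1) by auto
      ultimately show "u \<in> {v k, v (Suc k)}" using inj_onD[OF inj_pos] by blast
    qed
    moreover have "card (ends G (e k)) = 2" using card_ends e by blast
    moreover have "card {v k, v (Suc k)} \<le> 2" by (simp add: card_insert_if)
    ultimately show ?thesis by (intro card_seteq) auto
  qed
  have inj: "inj_on g tri"
    by (rule inj_on_triangle[OF F int, of v e]) (use v e ends in auto)
  have "g ` tri \<subseteq> torus"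
  proof
    fix y assume "y \<in> g ` tri"
    then obtain x where x: "x \<in> tri" "y = g x" by blast
    from x(1) show "y \<in> torus"
    proof (cases rule: tri_cases)
      case 1
      then show ?thesis using int x face_drawing(2)[OF F] by blast
    next
      case (2 k)
      then have "y \<in> eint (e k)" using e[of k] x by blast
      then show ?thesis using edge_curve(2)[of "e k"] path_image_edge[of "e k"] e[of k] by blast
    next
      case (3 k)
      then show ?thesis using v[of k] x pos_torus by auto
    qed
  qed
  then obtain f where f: "continuous_on tri f" "\<And>x. x \<in> tri \<Longrightarrow> cov (f x) = g x"
    using lift_to_plane[OF g(1) convex_imp_contractible[OF tri_basic(2)]] by blast
  have im: "cov ` f ` A = g ` A" if "A \<subseteq> tri" for A
    using f(2) that by (force simp: image_iff)
  have "lifted F f v e"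
    unfolding lifted_def
  proof (intro conjI allI)
    show "inj_on (cov \<circ> f) tri" using inj f(2) by (simp add: inj_on_def)
    show "cov ` f ` interior tri = F" using im[OF interior_subset] int by simp
    show "cov ` f ` side k = eint (e k)" for k using im[OF tri_parts(1)] e[of k] by simp
    show "cov (f (corner k)) = pos (v k)" for k using f(2)[OF tri_parts(2)] v by simp
  qed (use F f(1) per v e ends in auto)
  then show ?thesis by blast
qed

end

section \<open>Orientation of lifted faces\<close>

definition mirror :: "complex \<Rightarrow> complex" where "mirror z = Complex (Im z) (Re z)"

lemma mirror_mirror [simp]: "mirror (mirror z) = z"
  by (simp add: mirror_def)

lemma mirror_linepath: "mirror (linepath a b t) = linepath (mirror a) (mirror b) t"
  by (simp add: mirror_def linepath_def complex_eq_iff)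

lemma mirror_image: "mirror ` {z. P z} = {z. P (mirror z)}"
proof (intro set_eqI iffI)
  fix w assume "w \<in> {z. P (mirror z)}"
  then show "w \<in> mirror ` {z. P z}" by (intro image_eqI[of _ _ "mirror w"]) simp_all
qed auto

text \<open>Modulo 3, doubling is negation: the mirror runs through the corners backwards. Side
  \<open>k\<close> accordingly becomes the side with index \<open>-(k + 1)\<close>, that is
  \<open>2 * k + 2\<close>.\<close>

lemma mirror_corner: "mirror (corner k) = corner (2 * k)"
proof -
  have "2 * k mod 3 = 2 * (k mod 3) mod 3" by (simp add: mod_mult_right_eq)
  then show ?thesis
    by (cases k rule: mod3_cases) (simp_all add: corner_def mirror_def complex_eq_iff)
qed

lemma mirror_tri: "mirror ` tri = tri" "mirror ` interior tri = interior tri"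
  unfolding interior_tri unfolding tri_eq mirror_image by (auto simp: mirror_def add.commute)

lemma mirror_side: "mirror ` side k = side (2 * k + 2)"
proof -
  have "mirror ` open_segment a b = open_segment (mirror a) (mirror b)" for a b
  proof -
    have inj: "inj mirror" by (metis injI mirror_mirror)
    have lin: "linear mirror" by (rule linearI) (simp_all add: mirror_def complex_eq_iff)
    show ?thesis using open_segment_linear_image[OF lin inj] by simp
  qed
  then have "mirror ` side k = open_segment (corner (2 * k)) (corner (2 * k + 2))"
    by (simp add: side_def mirror_corner)
  also have "corner (2 * k) = corner (Suc (2 * k + 2))" by (simp add: corner_eq_iff)
  finally show ?thesis unfolding side_def by (simp only: open_segment_commute)
qed

lemma mirror_boundary_winding:
  assumes "embedded_triangle f" "z \<notin> f ` boundary"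
  shows "boundary_winding (f \<circ> mirror) z = - boundary_winding f z"
proof -
  interpret embedded_triangle f by fact
  have w: "winding_number (bside (f \<circ> mirror) k) z = - winding_number (bside f (2 * k + 2)) z" for k
  proof -
    have "corner (Suc (2 * k + 2)) = corner (2 * k)" by (simp add: corner_eq_iff)
    moreover have "mirror (corner (Suc k)) = corner (2 * k + 2)" by (simp add: mirror_corner)
    moreover have "linepath a b t = linepath b a (1 - t)" for a b :: complex and t
      by (simp add: linepath_def)
    ultimately have "bside (f \<circ> mirror) k = reversepath (bside f (2 * k + 2))"
      unfolding bside_def reversepath_def by (simp only: fun_eq_iff comp_apply mirror_linepath mirror_corner) blast
    moreover have "z \<notin> path_image (bside f (2 * k + 2))"
      using assms(2) unfolding bside_image boundary_def by blast
    ultimately show ?thesis using path_bside by (simp add: winding_number_reversepath)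
  qed
  have "bside f 4 = bside f 1" "bside f 6 = bside f 0"
    using bside_mod[of f 4] bside_mod[of f 6] by simp_all
  then show ?thesis unfolding boundary_winding_def w by (simp add: numeral_eq_Suc)
qed

lemma (in embedded_triangle) interior_near:
  assumes "z \<in> f ` tri" "0 < r"
  shows "\<exists>y\<in>ball z r. y \<in> f ` interior tri"
proof -
  have "f ` closure (interior tri) \<subseteq> closure (f ` interior tri)"
  proof (rule image_closure_subset)
    show "continuous_on (closure (interior tri)) f" using cont by (simp add: tri_basic(3))
    show "f ` interior tri \<subseteq> closure (f ` interior tri)" by (rule closure_subset)
  qed simp
  then have "z \<in> closure (f ` interior tri)" using assms(1) tri_basic(3) by auto
  then obtain y where "y \<in> f ` interior tri" "dist y z < r"
    using assms(2) unfolding closure_approachable by blast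
  then show ?thesis by (intro bexI[of _ y]) (simp_all add: dist_commute)
qed

context torus_triangulation
begin

context
  fixes F f v e
  assumes lifted: "lifted F f v e"
begin

lemma lifted_face: "F \<in> Faces"
  and lifted_inj: "inj_on (cov \<circ> f) tri"
  and lifted_interior: "cov ` f ` interior tri = F"
  and lifted_mod: "v (k mod 3) = v k" "e (k mod 3) = e k"
  and lifted_vertex: "v k \<in> verts G" "cov (f (corner k)) = pos (v k)"
  and lifted_edge: "e k \<in> edges G" "ends G (e k) = {v k, v (Suc k)}" "cov ` f ` side k = eint (e k)"
  using lifted unfolding lifted_def by blast+

lemma lifted_triangle: "embedded_triangle f"
proof
  show "continuous_on tri f" using lifted unfolding lifted_def by blast
  show "inj_on f tri" using lifted_inj by (rule inj_on_imageI2)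
qed

lemma lifted_v_eq_iff: "v k = v l \<longleftrightarrow> k mod 3 = l mod 3"
proof
  assume "v k = v l"
  then have "(cov \<circ> f) (corner k) = (cov \<circ> f) (corner l)" using lifted_vertex(2) by simp
  then have "corner k = corner l" using inj_onD[OF lifted_inj] tri_parts(2) by blast
  then show "k mod 3 = l mod 3" by (simp add: corner_eq_iff)
next
  assume "k mod 3 = l mod 3"
  then show "v k = v l" using lifted_mod(1)[of k] lifted_mod(1)[of l] by simp
qed

lemma lifted_e_eq_iff: "e k = e l \<longleftrightarrow> k mod 3 = l mod 3"
proof
  assume "e k = e l"
  then have eq: "{v k, v (Suc k)} = {v l, v (Suc l)}" using lifted_edge(2)[of k] lifted_edge(2)[of l] by simp
  show "k mod 3 = l mod 3"
  proof (rule ccontr)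
    assume "k mod 3 \<noteq> l mod 3"
    then have "v k \<noteq> v l" by (simp add: lifted_v_eq_iff)
    then have "v k = v (Suc l)" "v (Suc k) = v l" using eq by (auto simp: doubleton_eq_iff)
    then have "k mod 3 = Suc l mod 3" "Suc k mod 3 = l mod 3" by (simp_all add: lifted_v_eq_iff)
    then show False using mod3_Suc[of k] mod3_Suc[of l] by linarith
  qed
next
  assume "k mod 3 = l mod 3"
  then show "e k = e l" using lifted_mod(2)[of k] lifted_mod(2)[of l] by simp
qed

lemma lifted_cases:
  assumes "x \<in> cov ` f ` tri"
  obtains "x \<in> F" | k where "x \<in> eint (e k)" | k where "x = pos (v k)"
proof -
  from assms obtain z where z: "z \<in> tri" "x = cov (f z)" by blast
  from z(1) show ?thesis
  proof (cases rule: tri_cases)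
    case 1
    then show ?thesis using that(1) lifted_interior z(2) by blast
  next
    case (2 k)
    then show ?thesis using that(2)[of k] lifted_edge(3)[of k] z(2) by blast
  next
    case (3 k)
    then show ?thesis using that(3)[of k] lifted_vertex(2)[of k] z(2) by simp
  qed
qed

lemma lifted_tri_drawing: "cov ` f ` tri \<subseteq> F \<union> drawing"
proof
  fix x assume "x \<in> cov ` f ` tri"
  then show "x \<in> F \<union> drawing"
    by (cases rule: lifted_cases) (use lifted_edge(1) lifted_vertex(1) in \<open>auto simp: drawing_eq\<close>)
qed

lemma compact_lifted: "compact (cov ` f ` tri)"
proof -
  interpret embedded_triangle f by (rule lifted_triangle)
  show ?thesis
    by (intro compact_continuous_image continuous_on_cov cont tri_basic)
qed

end

definition oriented where
  "oriented F f v e \<longleftrightarrow> lifted F f v e \<and> (\<forall>z\<in>f ` interior tri. boundary_winding f z = 1)"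

lemma lifted_mirror:
  assumes "lifted F f v e"
  shows "lifted F (f \<circ> mirror) (\<lambda>k. v (2 * k)) (\<lambda>k. e (2 * k + 2))"
proof -
  have cont: "continuous_on tri f" using assms by (simp add: lifted_def)
  have sw: "continuous_on tri mirror"
    unfolding mirror_def Complex_eq by (intro continuous_intros)
  have im: "(f \<circ> mirror) ` A = f ` mirror ` A" for A by (simp add: image_comp)
  have md: "2 * (k mod 3) mod 3 = 2 * k mod 3" "(2 * (k mod 3) + 2) mod 3 = (2 * k + 2) mod 3" for k :: nat
    by (simp add: mod_mult_right_eq) (metis mod_add_left_eq mod_mult_right_eq)
  show ?thesis
    unfolding lifted_def
  proof (intro conjI allI)
    show "continuous_on tri (f \<circ> mirror)"
      using sw cont by (intro continuous_on_compose) (simp_all add: mirror_tri)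
    show "inj_on (cov \<circ> (f \<circ> mirror)) tri"
      unfolding comp_assoc[symmetric]
    proof (rule comp_inj_on)
      show "inj_on mirror tri" by (metis inj_on_inverseI mirror_mirror)
      show "inj_on (cov \<circ> f) (mirror ` tri)" using lifted_inj[OF assms] by (simp add: mirror_tri)
    qed
    show "cov ` (f \<circ> mirror) ` interior tri = F"
      unfolding im mirror_tri by (rule lifted_interior[OF assms])
    show "v (2 * (k mod 3)) = v (2 * k)" "e (2 * (k mod 3) + 2) = e (2 * k + 2)" for k
      unfolding lifted_v_eq_iff[OF assms] lifted_e_eq_iff[OF assms] by (fact md)+
    show "cov ((f \<circ> mirror) (corner k)) = pos (v (2 * k))" for k
      using lifted_vertex[OF assms] by (simp add: mirror_corner)
    show "cov ` (f \<circ> mirror) ` side k = eint (e (2 * k + 2))" for k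
      unfolding im mirror_side by (rule lifted_edge(3)[OF assms])
    show "ends G (e (2 * k + 2)) = {v (2 * k), v (2 * Suc k)}" for k
    proof -
      have "v (Suc (2 * k + 2)) = v (2 * k)" by (simp add: lifted_v_eq_iff[OF assms])
      then show ?thesis using lifted_edge(2)[OF assms, of "2 * k + 2"] by (simp add: insert_commute)
    qed
  qed (use lifted_face[OF assms] lifted_vertex[OF assms] lifted_edge[OF assms] in auto)
qed

lemma oriented_exists:
  assumes "F \<in> Faces"
  shows "\<exists>f v e. oriented F f v e"
proof -
  obtain f v e where l: "lifted F f v e" using lifted_exists assms by blast
  interpret embedded_triangle f by (rule lifted_triangle[OF l])
  obtain s where s: "s = 1 \<or> s = -1" "\<And>z. z \<in> f ` interior tri \<Longrightarrow> boundary_winding f z = s"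
    using boundary_winding_inside by blast
  from s(1) show ?thesis
  proof
    assume "s = 1"
    then have "oriented F f v e" using l s(2) by (simp add: oriented_def)
    then show ?thesis by blast
  next
    assume "s = -1"
    have "boundary_winding (f \<circ> mirror) z = 1" if z: "z \<in> (f \<circ> mirror) ` interior tri" for z
    proof -
      have z': "z \<in> f ` interior tri" using z unfolding image_comp[symmetric] mirror_tri .
      then have "z \<notin> f ` boundary" using inside_boundary inside_no_overlap[of "f ` boundary"] by blast
      then show ?thesis
        using mirror_boundary_winding[OF lifted_triangle[OF l]] s(2)[OF z'] \<open>s = -1\<close> by simp
    qed
    then have "oriented F (f \<circ> mirror) (\<lambda>k. v (2 * k)) (\<lambda>k. e (2 * k + 2))"
      using lifted_mirror[OF l] by (simp add: oriented_def)
    then show ?thesis by blast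
  qed
qed

lemma oriented_translate:
  assumes "oriented F f v e" "cov t = cov 0"
  shows "oriented F (\<lambda>x. f x + t) v e"
proof -
  have c: "cov (f x + t) = cov (f x)" for x
    using cov_add[OF assms(2), of "f x"] by (simp add: add.commute)
  have l: "lifted F f v e" using assms(1) by (simp add: oriented_def)
  have im: "cov ` (\<lambda>x. f x + t) ` A = cov ` f ` A" for A using c by (simp add: image_image)
  have cc: "cov \<circ> (\<lambda>x. f x + t) = cov \<circ> f" using c by auto
  have l': "lifted F (\<lambda>x. f x + t) v e"
    using l unfolding lifted_def im cc c by (auto intro: continuous_intros)
  have "winding_number (bside (\<lambda>x. f x + t) k) (z + t) = winding_number (bside f k) z" for k z
    using winding_number_offset[of "bside f k" z] winding_number_offset[of "bside (\<lambda>x. f x + t) k" "z + t"]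
    by (simp add: bside_def)
  then have "boundary_winding (\<lambda>x. f x + t) (z + t) = boundary_winding f z" for z
    by (simp add: boundary_winding_def)
  then show ?thesis using l' assms(1) by (auto simp: oriented_def)
qed

end

section \<open>Oriented faces that share a side\<close>

context torus_triangulation
begin

text \<open>
  The two boundary loops share the arc over the edge, so away from that arc they differ by a loop
  that does not meet the interior of the arc; its winding number is therefore the same on both
  sides of the edge, although it is \<open>1 - 0\<close> on one side and \<open>0 - 1\<close> on the other.
\<close>

lemma oriented_unique_aligned:
  assumes o1: "oriented F f v e" and o2: "oriented F' g v' e'" and "F \<noteq> F'"
    and seg: "f ` closed_segment (corner k) (corner (Suc k)) = g ` closed_segment (corner l) (corner (Suc l))"
    and ends: "f (corner k) = g (corner l)" "f (corner (Suc k)) = g (corner (Suc l))"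
  shows False
proof -
  have lf: "lifted F f v e" "lifted F' g v' e'" using o1 o2 by (simp_all add: oriented_def)
  interpret f: embedded_triangle f by (rule lifted_triangle[OF lf(1)])
  interpret g: embedded_triangle g by (rule lifted_triangle[OF lf(2)])
  let ?P = "bside f (Suc k) +++ bside f (Suc (Suc k))" and ?Q = "bside g (Suc l) +++ bside g (Suc (Suc l))"
  let ?W = "?P +++ reversepath ?Q"
  have paths: "path ?P" "path ?Q" by (simp_all add: f.path_bside g.path_bside)
  have imP: "path_image ?P = f ` (closed_segment (corner (Suc k)) (corner (Suc (Suc k))) \<union>
      closed_segment (corner (Suc (Suc k))) (corner k))"
    using f.bside_image[of "Suc (Suc k)"] by (simp add: path_image_join f.bside_image image_Un)
  have imQ: "path_image ?Q = g ` (closed_segment (corner (Suc l)) (corner (Suc (Suc l))) \<union>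
      closed_segment (corner (Suc (Suc l))) (corner l))"
    using g.bside_image[of "Suc (Suc l)"] by (simp add: path_image_join g.bside_image image_Un)
  have W: "path ?W" "pathfinish ?W = pathstart ?W" "path_image ?W = path_image ?P \<union> path_image ?Q"
    using paths ends by (simp_all add: path_image_join)
  have wW: "winding_number ?W z = boundary_winding f z - boundary_winding g z"
    if z: "z \<notin> f ` boundary" "z \<notin> g ` boundary" for z
  proof -
    have nf: "z \<notin> path_image (bside f i)" for i using z(1) unfolding f.bside_image boundary_def by blast
    have ng: "z \<notin> path_image (bside g i)" for i using z(2) unfolding g.bside_image boundary_def by blast
    have "winding_number (bside f k) z = winding_number (bside g l) z"
      by (rule winding_number_arcs_eq[OF f.arc_bside g.path_bside])
        (use ends seg nf[of k] in \<open>simp_all only: f.bside_image g.bside_image f.bside_ends g.bside_ends not_False_eq_True\<close>)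
    moreover have "winding_number ?P z = winding_number (bside f (Suc k)) z + winding_number (bside f (Suc (Suc k))) z"
      by (rule winding_number_join[OF f.path_bside nf f.path_bside nf]) simp
    moreover have "winding_number ?Q z = winding_number (bside g (Suc l)) z + winding_number (bside g (Suc (Suc l))) z"
      by (rule winding_number_join[OF g.path_bside ng g.path_bside ng]) simp
    moreover have "winding_number ?W z = winding_number ?P z - winding_number ?Q z"
    proof -
      have "z \<notin> path_image ?P" "z \<notin> path_image ?Q"
        using nf[of "Suc k"] nf[of "Suc (Suc k)"] ng[of "Suc l"] ng[of "Suc (Suc l)"]
        by (simp_all add: path_image_join)
      moreover have "pathfinish ?P = pathfinish ?Q" using ends by simp
      ultimately have "winding_number ?W z = winding_number ?P z + winding_number (reversepath ?Q) z"
        by (intro winding_number_join) (use paths in \<open>simp_all only: path_reversepath path_image_reversepath pathstart_reversepath not_False_eq_True\<close>)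
      also have "winding_number (reversepath ?Q) z = - winding_number ?Q z"
        by (rule winding_number_reversepath) fact+
      finally show ?thesis by simp
    qed
    ultimately show ?thesis
      unfolding boundary_winding_rotate[of f z k] boundary_winding_rotate[of g z l] by simp
  qed
  have side_off: "p \<notin> closed_segment (corner (Suc i)) (corner (Suc (Suc i))) \<union>
      closed_segment (corner (Suc (Suc i))) (corner i)" if "p \<in> side i" for p i
  proof -
    have m: "i mod 3 \<noteq> Suc i mod 3" "i mod 3 \<noteq> Suc (Suc i) mod 3" using mod3_Suc[of i] by auto
    have "p \<notin> side (Suc i)" "p \<notin> side (Suc (Suc i))"
      using that tri_parts(6)[OF m(1)] tri_parts(6)[OF m(2)] by blast+
    moreover have "p \<noteq> corner j" for j using that tri_parts(5) by blast
    ultimately have "p \<notin> closed_segment (corner (Suc i)) (corner (Suc (Suc i)))"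
      "p \<notin> closed_segment (corner (Suc (Suc i))) (corner (Suc (Suc (Suc i))))"
      unfolding closed_side by blast+
    then show ?thesis by simp
  qed
  have sub: "closed_segment (corner (Suc i)) (corner (Suc (Suc i))) \<union>
      closed_segment (corner (Suc (Suc i))) (corner i) \<subseteq> tri" for i
    using f.segment_subset[of "Suc i"] f.segment_subset[of "Suc (Suc i)"] by simp
  have "midpoint (corner k) (corner (Suc k)) \<in> side k"
    unfolding side_def using corner_Suc_neq by simp
  then obtain p where p: "p \<in> side k" by blast
  have "f p \<in> f ` closed_segment (corner k) (corner (Suc k))" using p unfolding closed_side by blast
  then obtain q where q: "f p = g q" "q \<in> closed_segment (corner l) (corner (Suc l))"
    unfolding seg by blast
  have "q \<in> side l"
  proof -
    have "f p \<noteq> f (corner k)" "f p \<noteq> f (corner (Suc k))"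
      using inj_onD[OF f.inj, of p] p tri_parts(1,2,5) by blast+
    then show ?thesis using q ends unfolding closed_side by auto
  qed
  have "f p \<notin> path_image ?P"
    unfolding imP using side_off[OF p] sub p tri_parts(1) inj_on_image_mem_iff[OF f.inj] by blast
  moreover have "f p \<notin> path_image ?Q"
    unfolding imQ q(1) using side_off[OF \<open>q \<in> side l\<close>] sub \<open>q \<in> side l\<close> tri_parts(1)
      inj_on_image_mem_iff[OF g.inj] by blast
  ultimately have "f p \<in> - path_image ?W" using W(3) by blast
  moreover have "open (- path_image ?W)" using W(1) by (simp add: closed_path_image open_Compl)
  ultimately obtain r where r: "0 < r" "ball (f p) r \<subseteq> - path_image ?W" using openE by blast
  have const: "winding_number ?W constant_on ball (f p) r"
    by (rule winding_number_constant[OF W(1,2)]) (use r in auto)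
  \<comment> \<open>Each interior avoids the other closed triangle, so near the common side one
    boundary winding number is 1 where the other is 0.\<close>
  have fF: "f ` interior tri \<inter> g ` tri = {}"
  proof -
    have "F \<inter> (F' \<union> drawing) = {}"
      using faces_disjoint[OF lifted_face[OF lf(1)] lifted_face[OF lf(2)] \<open>F \<noteq> F'\<close>]
        face_drawing(1)[OF lifted_face[OF lf(1)]] by blast
    then show ?thesis using lifted_interior[OF lf(1)] lifted_tri_drawing[OF lf(2)] by blast
  qed
  have gF: "g ` interior tri \<inter> f ` tri = {}"
  proof -
    have "F' \<inter> (F \<union> drawing) = {}"
      using faces_disjoint[OF lifted_face[OF lf(1)] lifted_face[OF lf(2)] \<open>F \<noteq> F'\<close>]
        face_drawing(1)[OF lifted_face[OF lf(2)]] by blast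
    then show ?thesis using lifted_interior[OF lf(2)] lifted_tri_drawing[OF lf(1)] by blast
  qed
  have bd: "boundary \<subseteq> tri" unfolding boundary_eq by blast
  have "f p \<in> f ` tri" using p tri_parts(1) by blast
  then obtain y where y: "y \<in> ball (f p) r" "y \<in> f ` interior tri"
    using f.interior_near r(1) by blast
  have "y \<notin> g ` tri" "y \<notin> f ` boundary"
    using fF y(2) f.inside_boundary inside_no_overlap[of "f ` boundary"] by blast+
  then have "winding_number ?W y = 1"
    using wW[of y] g.boundary_winding_outside[of y] o1 y(2) bd unfolding oriented_def by auto
  have "f p \<in> g ` tri" using q(1) \<open>q \<in> side l\<close> tri_parts(1) by blast
  then obtain z where z: "z \<in> ball (f p) r" "z \<in> g ` interior tri"
    using g.interior_near r(1) by blast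
  have "z \<notin> f ` tri" "z \<notin> g ` boundary"
    using gF z(2) g.inside_boundary inside_no_overlap[of "g ` boundary"] by blast+
  then have "winding_number ?W z = - 1"
    using wW[of z] f.boundary_winding_outside[of z] o2 z(2) bd unfolding oriented_def by auto
  moreover have "winding_number ?W y = winding_number ?W z"
    using const y(1) z(1) unfolding constant_on_def by metis
  ultimately show False using \<open>winding_number ?W y = 1\<close> by simp
qed

text \<open>Along the common edge the two lifts differ by deck translations. These vary continuously
  but take discrete values, so they are one constant \<open>t\<close>. Shifting one face by
  \<open>t\<close> makes the sides coincide in the plane.\<close>

theorem oriented_unique:
  assumes o1: "oriented F f v e" and o2: "oriented F' g v' e'"
    and ve: "v k = v' l" "e k = e' l"
  shows "F = F'"
proof (rule ccontr)
  assume "F \<noteq> F'"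
  have lf: "lifted F f v e" "lifted F' g v' e'" using o1 o2 by (simp_all add: oriented_def)
  interpret f: embedded_triangle f by (rule lifted_triangle[OF lf(1)])
  interpret g: embedded_triangle g by (rule lifted_triangle[OF lf(2)])
  let ?S = "closed_segment (corner k) (corner (Suc k))" and ?T = "closed_segment (corner l) (corner (Suc l))"
  have "v k \<noteq> v (Suc k)"
    unfolding lifted_v_eq_iff[OF lf(1)] using mod3_Suc[of k] by auto
  then have vS: "v (Suc k) = v' (Suc l)"
    using lifted_edge(2)[OF lf(1), of k] lifted_edge(2)[OF lf(2), of l] ve
    by (auto simp: doubleton_eq_iff)
  have im: "cov ` f ` ?S = cov ` g ` ?T"
    unfolding closed_side using lifted_edge(3)[OF lf(1), of k] lifted_edge(3)[OF lf(2), of l]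
      lifted_vertex(2)[OF lf(1)] lifted_vertex(2)[OF lf(2)] ve vS by simp
  have injT: "inj_on (cov \<circ> g) ?T"
    using lifted_inj[OF lf(2)] g.segment_subset by (rule inj_on_subset)
  \<comment> \<open>\<open>m\<close> matches the two parametrisations of the edge:
    \<open>m x\<close> is the point of the second side over the same point of the torus.\<close>
  define m where "m x = the_inv_into ?T (cov \<circ> g) (cov (f x))" for x
  have m: "m x \<in> ?T \<and> cov (g (m x)) = cov (f x)" if "x \<in> ?S" for x
  proof -
    have "cov (f x) \<in> (cov \<circ> g) ` ?T" using im that by (auto simp: image_comp[symmetric])
    then show ?thesis
      unfolding m_def using f_the_inv_into_f[OF injT] the_inv_into_into[OF injT, of _ ?T] by fastforce
  qed
  have m_eq: "m x = y" if "x \<in> ?S" "y \<in> ?T" "cov (f x) = cov (g y)" for x y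
    using m[OF that(1)] that inj_onD[OF injT, of "m x" y] by simp
  have contf: "continuous_on ?S f" using f.cont f.segment_subset by (rule continuous_on_subset)
  have contg: "continuous_on ?T g" using g.cont g.segment_subset by (rule continuous_on_subset)
  have contm: "continuous_on ?S m"
  proof -
    have "continuous_on ((cov \<circ> g) ` ?T) (the_inv_into ?T (cov \<circ> g))"
      by (intro continuous_on_inv_into injT continuous_on_compose contg continuous_on_cov) simp
    moreover have "continuous_on ?S (\<lambda>x. cov (f x))"
      using continuous_on_compose[OF contf continuous_on_cov] by (simp add: comp_def)
    moreover have "(\<lambda>x. cov (f x)) ` ?S \<subseteq> (cov \<circ> g) ` ?T" using im by (simp add: image_image)
    ultimately show ?thesis unfolding m_def by (rule continuous_on_compose2)
  qed
  have d0: "cov (f x - g (m x)) = cov 0" if "x \<in> ?S" for x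
    using m[OF that] cov_diff by metis
  have "(\<lambda>x. f x - g (m x)) constant_on ?S"
  proof (rule continuous_discrete_range_constant)
    have "continuous_on ?S (\<lambda>x. g (m x))"
      by (rule continuous_on_compose2[OF contg contm]) (use m in auto)
    then show "continuous_on ?S (\<lambda>x. f x - g (m x))" using contf by (intro continuous_intros)
    show "\<exists>e>0. \<forall>y. y \<in> ?S \<and> f y - g (m y) \<noteq> f x - g (m x) \<longrightarrow>
        e \<le> norm (f y - g (m y) - (f x - g (m x)))" if x: "x \<in> ?S" for x
    \<comment> \<open>By \<open>cov_inj_ball\<close>, distinct values over the same point of the
      torus are at least 2 apart.\<close>
    proof (intro exI[of _ 2] conjI allI impI)
      fix y assume y: "y \<in> ?S \<and> f y - g (m y) \<noteq> f x - g (m x)"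
      then have "cov (f y - g (m y)) = cov (f x - g (m x))" using d0 x by simp
      then show "2 \<le> norm (f y - g (m y) - (f x - g (m x)))"
        using y cov_inj_ball by (metis dist_norm not_less)
    qed simp
  qed simp
  then obtain t where t: "\<And>x. x \<in> ?S \<Longrightarrow> f x - g (m x) = t" unfolding constant_on_def by blast
  have kS: "corner k \<in> ?S" "corner (Suc k) \<in> ?S" "corner l \<in> ?T" "corner (Suc l) \<in> ?T" by simp_all
  have t0: "cov t = cov 0" using d0[OF kS(1)] t[OF kS(1)] by simp
  have ft: "f x = g (m x) + t" if "x \<in> ?S" for x using t[OF that] by (simp add: algebra_simps)
  have mS: "m ` ?S = ?T"
  proof
    show "?T \<subseteq> m ` ?S"
    proof
      fix y assume y: "y \<in> ?T"
      then have "cov (g y) \<in> cov ` f ` ?S" unfolding im by (intro imageI)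
      then obtain x where "x \<in> ?S" "cov (f x) = cov (g y)" by (elim imageE) simp
      then show "y \<in> m ` ?S" using m_eq y by blast
    qed
  qed (use m in auto)
  have mk: "m (corner k) = corner l" "m (corner (Suc k)) = corner (Suc l)"
    by (rule m_eq[OF kS(1) kS(3)], simp only: lifted_vertex(2)[OF lf(1)] lifted_vertex(2)[OF lf(2)] ve)
      (rule m_eq[OF kS(2) kS(4)], simp only: lifted_vertex(2)[OF lf(1)] lifted_vertex(2)[OF lf(2)] vS)
  show False
  proof (rule oriented_unique_aligned[OF o1 oriented_translate[OF o2 t0] \<open>F \<noteq> F'\<close>])
    have "f ` ?S = (\<lambda>x. g (m x) + t) ` ?S" using ft by (rule image_cong[OF refl])
    also have "\<dots> = (\<lambda>x. g x + t) ` m ` ?S" by (simp add: image_image)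
    finally show "f ` ?S = (\<lambda>x. g x + t) ` ?T" unfolding mS .
    show "f (corner k) = g (corner l) + t" "f (corner (Suc k)) = g (corner (Suc l)) + t"
      using ft kS mk by simp_all
  qed
qed

end

section \<open>Incidence of edges, darts and faces\<close>

lemma open_vimage_cov: "closed Z \<Longrightarrow> open (cov -` (- Z))"
  using continuous_on_cov[of UNIV] continuous_on_open_vimage[of UNIV cov] by (simp add: open_Compl)

context torus_triangulation
begin

definition chart where
  "chart F = (SOME c. oriented F (fst c) (fst (snd c)) (snd (snd c)))"

definition ff where "ff F = fst (chart F)"
definition fv where "fv F = fst (snd (chart F))"
definition fe where "fe F = snd (snd (chart F))"

lemma oriented_chart: "F \<in> Faces \<Longrightarrow> oriented F (ff F) (fv F) (fe F)"
proof -
  assume "F \<in> Faces"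
  then obtain f v e where "oriented F f v e" using oriented_exists by blast
  then have "\<exists>c. oriented F (fst c) (fst (snd c)) (snd (snd c))"
    by (intro exI[of _ "(f, v, e)"]) simp
  then show ?thesis unfolding ff_def fv_def fe_def chart_def by (rule someI_ex)
qed

lemma lifted_chart: "F \<in> Faces \<Longrightarrow> lifted F (ff F) (fv F) (fe F)"
  using oriented_chart by (simp add: oriented_def)

lemma face_side_unique:
  assumes "F \<in> Faces" "F' \<in> Faces" "fv F k = fv F' l" "fe F k = fe F' l"
  shows "F = F' \<and> k mod 3 = l mod 3"
proof -
  have "F = F'" using oriented_unique[OF oriented_chart oriented_chart] assms by blast
  then show ?thesis using assms lifted_v_eq_iff[OF lifted_chart] by blast
qed

text \<open>With no loops, an edge together with one of its ends is an oriented edge; keeping the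
  edge name separates parallel edges.\<close>

definition darts where "darts = {(v, e). e \<in> edges G \<and> v \<in> ends G e}"

lemma finite_darts: "finite darts"
proof (rule finite_subset)
  show "darts \<subseteq> verts G \<times> edges G" using ends_subset by (auto simp: darts_def)
qed (use finite_graph in simp)

lemma face_darts: "F \<in> Faces \<Longrightarrow> (fv F k, fe F k) \<in> darts"
  using lifted_edge[OF lifted_chart, of F k] by (simp add: darts_def)

text \<open>Every face owns its first dart by \<open>face_side_unique\<close>, and there are only
  finitely many darts.\<close>

lemma finite_Faces: "finite Faces"
proof (rule inj_on_finite)
  show "inj_on (\<lambda>F. (fv F 0, fe F 0)) Faces"
    using face_side_unique[of _ _ 0 0] by (auto intro: inj_onI)
  show "(\<lambda>F. (fv F 0, fe F 0)) ` Faces \<subseteq> darts" using face_darts by blast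
qed (rule finite_darts)

abbreviation closed_face where "closed_face F \<equiv> cov ` ff F ` tri"

lemma closed_face_cases:
  assumes F: "F \<in> Faces" and x: "x \<in> closed_face F"
  obtains "x \<in> F" | k where "x \<in> eint (fe F k)" | k where "x = pos (fv F k)"
  using lifted_cases[OF lifted_chart[OF F] x] that by blast

lemma closed_closed_face: "F \<in> Faces \<Longrightarrow> closed (closed_face F)"
  using compact_lifted[OF lifted_chart] by (rule compact_imp_closed)

lemma face_subset: "F \<in> Faces \<Longrightarrow> F \<subseteq> closed_face F"
proof -
  assume F: "F \<in> Faces"
  have "cov ` ff F ` interior tri \<subseteq> cov ` ff F ` tri" by (intro image_mono interior_subset)
  then show ?thesis using lifted_interior[OF lifted_chart[OF F]] by simp
qed

lemma closed_path_edge: "e \<in> edges G \<Longrightarrow> closed (path_image (\<gamma> e))"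
  using edge_curve(1) by (simp add: closed_simple_path_image)

lemma closed_pos: "U \<subseteq> verts G \<Longrightarrow> closed (pos ` U)"
  using finite_graph(1) by (meson finite_imageI finite_imp_closed finite_subset)

lemma face_notin:
  assumes "x \<in> F" "F \<in> Faces"
  shows "x \<notin> pos ` verts G" "f \<in> edges G \<Longrightarrow> x \<notin> path_image (\<gamma> f)"
    "F' \<in> Faces \<Longrightarrow> F' \<noteq> F \<Longrightarrow> x \<notin> closed_face F'"
proof -
  have d: "x \<notin> drawing" using face_drawing(1)[OF assms(2)] assms(1) by blast
  then show "x \<notin> pos ` verts G" "f \<in> edges G \<Longrightarrow> x \<notin> path_image (\<gamma> f)"
    unfolding drawing_def by blast+
  show "x \<notin> closed_face F'" if "F' \<in> Faces" "F' \<noteq> F"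
    using lifted_tri_drawing[OF lifted_chart[OF that(1)]] faces_disjoint[OF that(1) assms(2) that(2)]
      assms(1) d by blast
qed

lemma eint_notin:
  assumes "x \<in> eint e" "e \<in> edges G"
  shows "x \<notin> pos ` verts G" "f \<in> edges G \<Longrightarrow> f \<noteq> e \<Longrightarrow> x \<notin> path_image (\<gamma> f)"
    "F \<in> Faces \<Longrightarrow> e \<notin> range (fe F) \<Longrightarrow> x \<notin> closed_face F" "F \<in> Faces \<Longrightarrow> x \<notin> F"
proof -
  show p: "x \<notin> pos ` verts G" using edge_curve(4)[OF assms(2)] assms(1) by blast
  show "x \<notin> path_image (\<gamma> f)" if "f \<in> edges G" "f \<noteq> e"
  proof -
    have "x \<notin> pos ` ends G f" using p ends_subset[OF that(1)] by blast
    moreover have "x \<notin> eint f" using eint_disjoint[OF that(1) assms(2) that(2)] assms(1) by blast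
    ultimately show ?thesis unfolding path_image_edge[OF that(1)] by blast
  qed
  show n: "x \<notin> F" if "F \<in> Faces" for F
    using face_drawing(1)[OF that] assms unfolding drawing_eq by blast
  show "x \<notin> closed_face F" if F: "F \<in> Faces" "e \<notin> range (fe F)"
  proof
    assume "x \<in> closed_face F"
    from closed_face_cases[OF F(1) this] show False
    proof cases
      case 1
      then show ?thesis using n F(1) by blast
    next
      case (2 k)
      have "fe F k \<noteq> e" using F(2) by blast
      then show ?thesis
        using eint_disjoint[OF lifted_edge(1)[OF lifted_chart[OF F(1)]] assms(2)] 2 assms(1) by blast
    next
      case (3 k)
      then show ?thesis using p lifted_vertex(1)[OF lifted_chart[OF F(1)]] by blast
    qed
  qed
qed

lemma pos_notin:
  assumes "v \<in> verts G"
  shows "e \<in> edges G \<Longrightarrow> v \<notin> ends G e \<Longrightarrow> pos v \<notin> path_image (\<gamma> e)"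
    "F \<in> Faces \<Longrightarrow> v \<notin> range (fv F) \<Longrightarrow> pos v \<notin> closed_face F"
    "u \<in> verts G \<Longrightarrow> u \<noteq> v \<Longrightarrow> pos v \<noteq> pos u"
proof -
  show u: "pos v \<noteq> pos u" if "u \<in> verts G" "u \<noteq> v" for u
    using inj_onD[OF inj_pos _ assms that(1)] that(2) by blast
  have i: "pos v \<notin> eint e" if "e \<in> edges G" for e using edge_curve(4)[OF that] assms by blast
  show "pos v \<notin> path_image (\<gamma> e)" if e: "e \<in> edges G" "v \<notin> ends G e"
  proof -
    have "pos v \<notin> pos ` ends G e" using u ends_subset[OF e(1)] e(2) by blast
    then show ?thesis unfolding path_image_edge[OF e(1)] using i[OF e(1)] by blast
  qed
  show "pos v \<notin> closed_face F" if F: "F \<in> Faces" "v \<notin> range (fv F)"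
  proof
    assume "pos v \<in> closed_face F"
    from closed_face_cases[OF F(1) this] show False
    proof cases
      case 1
      then show ?thesis using face_notin(1)[OF _ F(1)] assms by blast
    next
      case (2 k)
      then show ?thesis using i[OF lifted_edge(1)[OF lifted_chart[OF F(1)]]] by blast
    next
      case (3 k)
      then have "fv F k = v" using u[OF lifted_vertex(1)[OF lifted_chart[OF F(1)], of k]] by blast
      then show ?thesis using F(2) by blast
    qed
  qed
qed

lemma real_line_interior:
  fixes U :: "complex set"
  assumes "open U" "U \<noteq> {}"
  shows "\<not> U \<subseteq> range of_real"
proof
  assume sub: "U \<subseteq> range of_real"
  obtain u r where ur: "u \<in> U" "0 < r" "ball u r \<subseteq> U" using assms openE by (metis ex_in_conv)
  have "u + of_real (r / 2) * \<i> \<in> ball u r" using ur(2) by (simp add: dist_norm norm_mult)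
  then obtain a b where ab: "u + of_real (r / 2) * \<i> = of_real a" "u = of_real b" using sub ur by blast
  have "Im (u + of_real (r / 2) * \<i>) = 0" "Im u = 0" unfolding ab(1) unfolding ab(2) by simp_all
  then show False using ur(2) by simp
qed

text \<open>An arc contains no open disc, and a single Jordan domain is no neighbourhood of a boundary point.\<close>

theorem two_faces:
  assumes e: "e \<in> edges G"
  shows "\<exists>F\<in>Faces. \<exists>F'\<in>Faces. F \<noteq> F' \<and> e \<in> range (fe F) \<and> e \<in> range (fe F')"
proof (rule ccontr)
  assume none: "\<not> ?thesis"
  define x where "x = \<gamma> e (1 / 2)"
  have x: "x \<in> eint e" unfolding x_def edge_interior_def by (intro imageI) simp
  \<comment> \<open>\<open>Z\<close> is closed and avoids \<open>x\<close>, so near a lift of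
    \<open>x\<close> the projection meets only \<open>e\<close> and the faces that have
    \<open>e\<close> as a side.\<close>
  define Z where "Z = (\<Union>f\<in>edges G - {e}. path_image (\<gamma> f)) \<union>
    (\<Union>F\<in>{F \<in> Faces. e \<notin> range (fe F)}. closed_face F) \<union> pos ` verts G"
  have "closed Z"
    unfolding Z_def using finite_graph finite_Faces
    by (intro closed_Un closed_UN closed_pos) (auto intro: closed_path_edge closed_closed_face)
  note op = open_vimage_cov[OF this]
  have "x \<notin> Z"
    unfolding Z_def using eint_notin[OF x e] by blast
  have near: "y \<in> eint e \<or> (\<exists>F\<in>Faces. e \<in> range (fe F) \<and> y \<in> F)" if "y \<in> torus" "y \<notin> Z" for y
    using that(1)
  proof (cases rule: torus_cases)
    case (1 v)
    then show ?thesis using that(2) unfolding Z_def by blast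
  next
    case (2 f)
    then have "y \<in> path_image (\<gamma> f)" unfolding path_image_edge[OF 2(1)] by blast
    then have "f = e" using that(2) 2(1) unfolding Z_def by blast
    then show ?thesis using 2 by blast
  next
    case (3 F)
    then have "y \<in> closed_face F" using face_subset by blast
    then have "e \<in> range (fe F)" using that(2) 3(1) unfolding Z_def by blast
    then show ?thesis using 3 by blast
  qed
  show False
  proof (cases "\<exists>F\<in>Faces. e \<in> range (fe F)")
    case True
    then obtain F k where F: "F \<in> Faces" "fe F k = e" by blast
    have only: "F' = F" if "F' \<in> Faces" "e \<in> range (fe F')" for F'
      using none F that by blast
    note l = lifted_chart[OF F(1)]
    interpret embedded_triangle "ff F" by (rule lifted_triangle[OF l])
    have ee: "eint e = cov ` ff F ` side k" using lifted_edge(3)[OF l, of k] F(2) by simp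
    then obtain p where p: "p \<in> side k" "x = cov (ff F p)" using x by blast
    have pt: "p \<in> tri" using p(1) tri_parts(1) by blast
    have pb: "p \<in> boundary" using p(1) tri_parts(1,3)[of k] unfolding boundary_eq by blast
    obtain r where r: "0 < r" "\<And>y. y \<in> ball (ff F p) r \<Longrightarrow> cov y \<in> closed_face F \<Longrightarrow> y \<in> ff F ` tri"
      using single_sheet[OF tri_basic(1) cont lifted_inj[OF l] pt] by blast
    have "ff F p \<in> cov -` (- Z)" using p(2) \<open>x \<notin> Z\<close> by simp
    then obtain s where s: "0 < s" "ball (ff F p) s \<subseteq> cov -` (- Z)" using op openE by blast
    obtain y where y: "y \<in> ball (ff F p) (min r s)" "y \<notin> ff F ` tri"
      using outside_near[of "ff F p" "min r s"] pb r(1) s(1) by auto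
    have "cov y \<notin> Z" using y(1) s(2) by auto
    then have "cov y \<in> eint e \<or> cov y \<in> F" using near[OF cov_in_torus] only by blast
    then have "cov y \<in> closed_face F"
    proof
      assume "cov y \<in> eint e"
      then show ?thesis unfolding ee using tri_parts(1)[of k] by blast
    next
      assume "cov y \<in> F"
      then show ?thesis using face_subset[OF F(1)] by blast
    qed
    then show False using r(2) y by simp
  next
    case False
    obtain z where z: "cov z = x"
      using torus_cov[of x] x edge_curve(2)[OF e] path_image_edge[OF e] by blast
    have "z \<in> cov -` (- Z)" using z \<open>x \<notin> Z\<close> by simp
    then obtain s where s: "0 < s" "ball z s \<subseteq> cov -` (- Z)" using op openE by blast
    let ?B = "ball z (min s 1)"
    have B: "cov y \<in> path_image (\<gamma> e)" if "y \<in> ?B" for y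
    proof -
      have "cov y \<notin> Z" using that s(2) by auto
      then show ?thesis using near[OF cov_in_torus] False path_image_edge[OF e] by blast
    qed
    have arc: "continuous_on {0..1} (\<gamma> e)" "inj_on (\<gamma> e) {0..1}"
      using arc_edge[OF e] by (simp_all add: arc_def path_def)
    define h where "h = the_inv_into {0..1} (\<gamma> e)"
    have h: "continuous_on (path_image (\<gamma> e)) h" "inj_on h (path_image (\<gamma> e))"
      unfolding h_def path_image_def
      by (rule continuous_on_inv_into[OF arc(1) _ arc(2)]) (auto intro: inj_on_the_inv_into[OF arc(2)])
    \<comment> \<open>With no face at \<open>e\<close>, a ball would project injectively into the
      arc, and the parameter of the arc would embed it in the real line.\<close>
    let ?g = "\<lambda>y. of_real (h (cov y)) :: complex"
    have "continuous_on ?B (\<lambda>y. h (cov y))"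
      by (rule continuous_on_compose2[OF h(1) continuous_on_cov]) (use B in auto)
    then have "continuous_on ?B ?g" by (rule continuous_on_of_real)
    moreover have "inj_on ?g ?B"
    proof (rule inj_onI)
      fix a b assume ab: "a \<in> ?B" "b \<in> ?B" "?g a = ?g b"
      then have "h (cov a) = h (cov b)" by simp
      then have "cov a = cov b" using inj_onD[OF h(2)] B ab by blast
      moreover have "dist a b < 2"
        using ab(1,2) dist_triangle[of a b z] by (simp add: dist_commute)
      ultimately show "a = b" by (rule cov_inj_ball)
    qed
    ultimately have "open (?g ` ?B)" by (intro invariance_of_domain) simp_all
    moreover have "?g ` ?B \<noteq> {}" using s(1) by simp
    ultimately show False using real_line_interior by blast
  qed
qed

text \<open>By \<open>face_side_unique\<close> the two faces at \<open>e\<close> cannot traverse it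
  from the same end, so together they account for both darts.\<close>

lemma dart_face:
  assumes "(u, e) \<in> darts"
  obtains F k where "F \<in> Faces" "fv F k = u" "fe F k = e"
proof -
  have e: "e \<in> edges G" "u \<in> ends G e" using assms by (auto simp: darts_def)
  obtain F F' where FF: "F \<in> Faces" "F' \<in> Faces" "F \<noteq> F'" "e \<in> range (fe F)" "e \<in> range (fe F')"
    using two_faces[OF e(1)] by blast
  then obtain k l where "e = fe F k" "e = fe F' l" by blast
  with FF have F: "F \<in> Faces" "F' \<in> Faces" "F \<noteq> F'" "fe F k = e" "fe F' l = e" by simp_all
  have ne: "fv F k \<noteq> fv F' l" using face_side_unique[OF F(1,2), of k l] F(3-5) by auto
  have E: "ends G e = {fv F k, fv F (Suc k)}"
    using lifted_edge(2)[OF lifted_chart[OF F(1)], of k] unfolding F(4) .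
  have "ends G e = {fv F' l, fv F' (Suc l)}"
    using lifted_edge(2)[OF lifted_chart[OF F(2)], of l] unfolding F(5) .
  then have "fv F' l \<in> {fv F k, fv F (Suc k)}" unfolding E by simp
  then have "u = fv F k \<or> u = fv F' l" using e(2) ne unfolding E by auto
  then show ?thesis
  proof
    assume "u = fv F k"
    then show ?thesis using that[OF F(1) _ F(4)] by simp
  next
    assume "u = fv F' l"
    then show ?thesis using that[OF F(2) _ F(5)] by simp
  qed
qed

definition opp where "opp d = ((THE w. ends G (snd d) = {fst d, w}), snd d)"

definition next_dart where
  "next_dart d = (SOME d'. \<exists>F\<in>Faces. \<exists>k. d = (fv F k, fe F k) \<and> d' = (fv F (Suc k), fe F (Suc k)))"

lemma next_dart_eq:
  assumes F: "F \<in> Faces"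
  shows "next_dart (fv F k, fe F k) = (fv F (Suc k), fe F (Suc k))"
  unfolding next_dart_def
proof (rule some_equality)
  fix d' assume "\<exists>F'\<in>Faces. \<exists>l. (fv F k, fe F k) = (fv F' l, fe F' l) \<and> d' = (fv F' (Suc l), fe F' (Suc l))"
  then obtain F' l where l: "F' \<in> Faces" "fv F k = fv F' l" "fe F k = fe F' l"
    "d' = (fv F' (Suc l), fe F' (Suc l))" by blast
  then have "F = F'" "k mod 3 = l mod 3" using face_side_unique[OF F] by blast+
  moreover from this(2) have "Suc k mod 3 = Suc l mod 3" by (metis mod_Suc_eq)
  ultimately show "d' = (fv F (Suc k), fe F (Suc k))"
    using l(4) lifted_v_eq_iff[OF lifted_chart[OF F]] lifted_e_eq_iff[OF lifted_chart[OF F]] by simp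
qed (use F in blast)

lemma opp_eq: "e \<in> edges G \<Longrightarrow> ends G e = {u, w} \<Longrightarrow> opp (u, e) = (w, e)"
  unfolding opp_def using card_ends[of e] by (auto intro!: the_equality simp: doubleton_eq_iff)

lemma opp_dart:
  assumes "d \<in> darts"
  shows "opp d \<in> darts" "opp (opp d) = d" "fst (opp d) \<noteq> fst d" "ends G (snd d) = {fst d, fst (opp d)}"
proof -
  obtain u e where d: "d = (u, e)" by (cases d)
  have e: "e \<in> edges G" "u \<in> ends G e" using assms d by (auto simp: darts_def)
  obtain a b where ab: "ends G e = {a, b}" "a \<noteq> b" using card_ends[OF e(1)] by (auto simp: card_2_iff)
  define w where "w = (if u = a then b else a)"
  have w: "ends G e = {u, w}" "u \<noteq> w" using ab e(2) by (auto simp: w_def)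
  then have o: "opp (u, e) = (w, e)" "opp (w, e) = (u, e)"
    using opp_eq[OF e(1)] by (auto simp: insert_commute)
  then show "opp d \<in> darts" "opp (opp d) = d" "fst (opp d) \<noteq> fst d"
    "ends G (snd d) = {fst d, fst (opp d)}"
    using w e unfolding d o by (simp_all add: darts_def o)
qed

lemma opp_face: "F \<in> Faces \<Longrightarrow> opp (fv F k, fe F k) = (fv F (Suc k), fe F k)"
  by (rule opp_eq[OF lifted_edge(1,2)[OF lifted_chart]])

end

context torus_triangulation
begin

lemma next_dart:
  assumes "d \<in> darts"
  shows "next_dart d \<in> darts" "next_dart (next_dart (next_dart d)) = d" "fst (next_dart d) = fst (opp d)"
proof -
  obtain F k where F: "F \<in> Faces" "d = (fv F k, fe F k)"
    using dart_face[of "fst d" "snd d"] assms by (metis prod.collapse)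
  show "next_dart d \<in> darts" unfolding F(2) next_dart_eq[OF F(1)] by (rule face_darts[OF F(1)])
  have "Suc (Suc (Suc k)) mod 3 = k mod 3" by (metis mod_add_self2 numeral_3_eq_3 add_Suc_right add_0_right)
  then show "next_dart (next_dart (next_dart d)) = d"
    unfolding F(2) next_dart_eq[OF F(1)]
    using lifted_v_eq_iff[OF lifted_chart[OF F(1)]] lifted_e_eq_iff[OF lifted_chart[OF F(1)]] by simp
  show "fst (next_dart d) = fst (opp d)"
    unfolding F(2) next_dart_eq[OF F(1)] opp_face[OF F(1)] by simp
qed

section \<open>The cyclic order of darts around a vertex\<close>

definition spin where "spin d = opp (next_dart (next_dart d))"

lemma spin_face: "F \<in> Faces \<Longrightarrow> spin (fv F k, fe F k) = (fv F k, fe F (Suc (Suc k)))"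
proof -
  assume F: "F \<in> Faces"
  have "Suc (Suc (Suc k)) mod 3 = k mod 3" by (metis mod_add_self2 numeral_3_eq_3 add_Suc_right add_0_right)
  then have "fv F (Suc (Suc (Suc k))) = fv F k" using lifted_v_eq_iff[OF lifted_chart[OF F]] by simp
  then show ?thesis unfolding spin_def next_dart_eq[OF F] opp_face[OF F] by simp
qed

lemma spin_inj: "inj_on spin darts"
proof (rule inj_onI)
  fix d d' assume d: "d \<in> darts" "d' \<in> darts" "spin d = spin d'"
  then have "opp (spin d) = opp (spin d')" by simp
  then have "next_dart (next_dart d) = next_dart (next_dart d')"
    unfolding spin_def using opp_dart(2) next_dart(1) d by simp
  then have "next_dart (next_dart (next_dart d)) = next_dart (next_dart (next_dart d'))" by simp
  then show "d = d'" using next_dart(2) d by simp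
qed

definition left_face where
  "left_face d = (SOME F. F \<in> Faces \<and> (\<exists>k. d = (fv F k, fe F k)))"

lemma left_face_eq: "F \<in> Faces \<Longrightarrow> left_face (fv F k, fe F k) = F"
  unfolding left_face_def using face_side_unique by (intro some_equality) blast+

lemma left_face:
  assumes "d \<in> darts"
  obtains k where "left_face d \<in> Faces" "d = (fv (left_face d) k, fe (left_face d) k)"
proof -
  obtain F k where F: "F \<in> Faces" "d = (fv F k, fe F k)"
    using dart_face[of "fst d" "snd d"] assms by (metis prod.collapse)
  then show ?thesis using that[of k] left_face_eq[OF F(1)] by simp
qed

text \<open>The vertex itself is left out, so that sectors of different cycles are disjoint and fill
  a punctured neighbourhood.\<close>

definition sector where "sector Q = (\<Union>d\<in>Q. eint (snd d) \<union> left_face d)"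

definition off_sector where
  "off_sector Q = (\<Union>F\<in>Faces - left_face ` Q. closed_face F) \<union>
     (\<Union>f\<in>edges G - snd ` Q. path_image (\<gamma> f)) \<union> pos ` verts G"

lemma closed_off_sector: "closed (off_sector Q)"
  unfolding off_sector_def using finite_graph finite_Faces
  by (intro closed_Un closed_UN closed_pos) (auto intro: closed_path_edge closed_closed_face)

text \<open>Both faces at an edge of the sector belong to it: one is the left face of a dart in
  \<open>Q\<close>, the other the left face of its predecessor under \<open>spin\<close>. Hence the
  closures removed in \<open>off_sector\<close> stay away from the sector.\<close>

lemma sector_iff:
  assumes Q: "Q \<subseteq> darts" "\<And>d. d \<in> Q \<Longrightarrow> fst d = v" "spin ` Q = Q" and x: "x \<in> torus"
  shows "x \<in> sector Q \<longleftrightarrow> x \<notin> off_sector Q"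
proof
  assume n: "x \<notin> off_sector Q"
  from x show "x \<in> sector Q"
  proof (cases rule: torus_cases)
    case (1 u)
    then show ?thesis using n unfolding off_sector_def by blast
  next
    case (2 f)
    then have "x \<in> path_image (\<gamma> f)" unfolding path_image_edge[OF 2(1)] by blast
    then have "f \<in> snd ` Q" using n 2(1) unfolding off_sector_def by blast
    then show ?thesis using 2(2) unfolding sector_def by blast
  next
    case (3 F)
    then have "x \<in> closed_face F" using face_subset by blast
    then have "F \<in> left_face ` Q" using n 3(1) unfolding off_sector_def by blast
    then show ?thesis using 3(2) unfolding sector_def by blast
  qed
next
  assume "x \<in> sector Q"
  then obtain d where d: "d \<in> Q" "x \<in> eint (snd d) \<or> x \<in> left_face d" unfolding sector_def by blast
  have dD: "d \<in> darts" using d(1) Q(1) by blast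
  from d(2) show "x \<notin> off_sector Q"
  proof
    assume xF: "x \<in> left_face d"
    obtain k where "left_face d \<in> Faces" using left_face[OF dD] by blast
    note n = face_notin[OF xF this]
    have "x \<notin> closed_face F" if "F \<in> Faces - left_face ` Q" for F
      using n(3)[of F] that d(1) by blast
    then show ?thesis using n(1,2) unfolding off_sector_def by blast
  next
    assume xe: "x \<in> eint (snd d)"
    have e: "snd d \<in> edges G" using dD by (auto simp: darts_def)
    note n = eint_notin[OF xe e]
    have "x \<notin> closed_face F" if F: "F \<in> Faces - left_face ` Q" for F
    proof
      assume "x \<in> closed_face F"
      then obtain k where k: "snd d = fe F k" using n(3)[of F] F by blast
      have FF: "F \<in> Faces" using F by blast
      have "fst d \<in> ends G (snd d)" using dD by (auto simp: darts_def)
      then have "fst d = fv F k \<or> fst d = fv F (Suc k)"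
        using lifted_edge(2)[OF lifted_chart[OF FF], of k] unfolding k by simp
      then have "\<exists>d'\<in>Q. left_face d' = F"
      proof
        assume "fst d = fv F k"
        then have "d = (fv F k, fe F k)" using k by (simp add: prod_eq_iff)
        then show ?thesis using left_face_eq[OF FF] d(1) by blast
      next
        \<comment> \<open>Here \<open>F\<close> lies on the other side of the edge. Its dart
          starting at \<open>fst d\<close> is sent to \<open>d\<close> by \<open>spin\<close>, so it
          belongs to \<open>Q\<close> as well.\<close>
        assume *: "fst d = fv F (Suc k)"
        have "Suc (Suc (Suc k)) mod 3 = k mod 3" by (metis mod_add_self2 numeral_3_eq_3 add_Suc_right add_0_right)
        then have "fe F (Suc (Suc (Suc k))) = fe F k" using lifted_e_eq_iff[OF lifted_chart[OF FF]] by simp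
        then have "spin (fv F (Suc k), fe F (Suc k)) = d"
          using spin_face[OF FF, of "Suc k"] * k by (simp add: prod_eq_iff)
        moreover obtain d' where "d' \<in> Q" "spin d' = d" using Q(3) d(1) by (metis imageE)
        ultimately have "spin (fv F (Suc k), fe F (Suc k)) = spin d'" by simp
        then have "(fv F (Suc k), fe F (Suc k)) = d'"
          by (rule inj_onD[OF spin_inj]) (use face_darts[OF FF] Q(1) \<open>d' \<in> Q\<close> in auto)
        then show ?thesis using left_face_eq[OF FF] \<open>d' \<in> Q\<close> by blast
      qed
      then show False using F by blast
    qed
    moreover have "x \<notin> path_image (\<gamma> f)" if "f \<in> edges G - snd ` Q" for f
      using n(2)[of f] that d(1) by blast
    ultimately show ?thesis using n(1) unfolding off_sector_def by blast
  qed
qed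

lemma open_sector:
  assumes "Q \<subseteq> darts" "\<And>d. d \<in> Q \<Longrightarrow> fst d = v" "spin ` Q = Q"
  shows "open (cov -` sector Q)"
proof -
  have "cov -` sector Q = cov -` (- off_sector Q)"
    using sector_iff[OF assms cov_in_torus] by blast
  then show ?thesis using open_vimage_cov[OF closed_off_sector] by simp
qed

lemma sector_near:
  assumes "d \<in> darts" "cov x = pos (fst d)" "0 < r"
  shows "\<exists>y\<in>ball x r. cov y \<in> eint (snd d)"
proof -
  obtain k where F: "left_face d \<in> Faces" "d = (fv (left_face d) k, fe (left_face d) k)"
    using left_face[OF assms(1)] by blast
  let ?f = "ff (left_face d)"
  note l = lifted_chart[OF F(1)]
  have d: "fst d = fv (left_face d) k" "snd d = fe (left_face d) k" using F(2) by (metis fst_conv snd_conv)+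
  interpret embedded_triangle ?f by (rule lifted_triangle[OF l])
  have "corner k \<in> closure (side k)" unfolding closure_side by simp
  moreover have "cov x = cov (?f (corner k))" using assms(2) lifted_vertex(2)[OF l, of k] d(1) by simp
  ultimately obtain q y where "q \<in> side k" "y \<in> ball x r" "cov y = cov (?f q)"
    using lift_near[OF cont tri_parts(1) tri_parts(2) _ _ assms(3)] by blast
  then have "cov y \<in> cov ` ?f ` side k" by blast
  then have "cov y \<in> eint (snd d)" unfolding lifted_edge(3)[OF l] d(2) .
  then show ?thesis using \<open>y \<in> ball x r\<close> by blast
qed

text \<open>The sectors of different cycles of edges at \<open>v\<close> would disconnect a punctured disc around \<open>v\<close>.\<close>

theorem one_cycle:
  assumes Q: "Q \<subseteq> {d \<in> darts. fst d = v}" "Q \<noteq> {}" and closed: "\<And>d. d \<in> Q \<Longrightarrow> spin d \<in> Q"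
  shows "Q = {d \<in> darts. fst d = v}"
proof (rule ccontr)
  assume ne: "Q \<noteq> {d \<in> darts. fst d = v}"
  define D where "D = {d \<in> darts. fst d = v}"
  define R where "R = D - Q"
  have R: "R \<noteq> {}" using Q(1) ne unfolding R_def D_def by blast
  have fin: "finite D" unfolding D_def using finite_darts by simp
  have QD: "Q \<subseteq> D" "R \<subseteq> D" "Q \<inter> R = {}" "Q \<union> R = D" "D \<subseteq> darts"
    using Q(1) unfolding R_def D_def by blast+
  have spinD: "spin d \<in> D" if dD: "d \<in> D" for d
  proof -
    have d: "d \<in> darts" "fst d = v" using dD by (auto simp: D_def)
    obtain F k where F: "F \<in> Faces" "d = (fv F k, fe F k)"
      using dart_face[of "fst d" "snd d"] d by (metis prod.collapse)
    have "fst (spin d) = fst d" unfolding F(2) spin_face[OF F(1)] by simp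
    moreover have "spin d \<in> darts" unfolding spin_def using d(1) opp_dart(1) next_dart(1) by blast
    ultimately show ?thesis using d by (simp add: D_def)
  qed
  have inj: "inj_on spin D" using spin_inj QD(5) by (rule inj_on_subset)
  have sQ: "spin ` Q = Q"
    by (rule endo_inj_surj) (use fin QD closed inj finite_subset inj_on_subset in blast)+
  have "spin ` D = D"
    by (rule endo_inj_surj) (use fin spinD inj in blast)+
  then have sR: "spin ` R = R"
    unfolding R_def using inj_on_image_set_diff[OF inj, of D Q] QD(1) sQ by auto
  obtain d0 where d0: "d0 \<in> Q" using Q(2) by blast
  then have "d0 \<in> darts" "fst d0 = v" using QD by (auto simp: D_def)
  then have v: "v \<in> verts G" using ends_subset[of "snd d0"] by (auto simp: darts_def)
  obtain x where x: "cov x = pos v" using torus_cov v pos_torus by blast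
  \<comment> \<open>Off the closed set \<open>Z\<close> only \<open>pos v\<close> and the edges and
    faces at \<open>v\<close> remain.\<close>
  define Z where "Z = (\<Union>f\<in>{f \<in> edges G. v \<notin> ends G f}. path_image (\<gamma> f)) \<union>
    (\<Union>F\<in>{F \<in> Faces. v \<notin> range (fv F)}. closed_face F) \<union> pos ` (verts G - {v})"
  have "closed Z"
    unfolding Z_def using finite_graph finite_Faces
    by (intro closed_Un closed_UN closed_pos) (auto intro: closed_path_edge closed_closed_face)
  moreover have "pos v \<notin> Z"
    unfolding Z_def using pos_notin[OF v] by blast
  then have "x \<in> cov -` (- Z)" using x by simp
  ultimately obtain r where r: "0 < r" "ball x r \<subseteq> cov -` (- Z)"
    using open_vimage_cov openE by metis
  \<comment> \<open>The radius is at most 1, so \<open>x\<close> is the only point of the ball over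
    \<open>pos v\<close>; the punctured ball therefore avoids all vertices.\<close>
  let ?B = "ball x (min r 1) - {x}"
  have inB: "cov y \<in> sector Q \<union> sector R" if y: "y \<in> ?B" for y
  proof -
    have nZ: "cov y \<notin> Z" using y r(2) by auto
    have ne: "cov y \<noteq> pos v"
    proof
      assume "cov y = pos v"
      then have "cov y = cov x" using x by simp
      moreover have "dist y x < 2" using y by (auto simp: dist_commute)
      ultimately have "y = x" by (rule cov_inj_ball)
      then show False using y by simp
    qed
    have sec: "sector Q \<union> sector R = sector D" using QD(4) unfolding sector_def by blast
    have "cov y \<in> sector D"
    proof (cases rule: torus_cases[OF cov_in_torus[of y]])
      case (1 u)
      then show ?thesis using ne nZ unfolding Z_def by blast
    next
      case (2 f)
      then have "cov y \<in> path_image (\<gamma> f)" unfolding path_image_edge[OF 2(1)] by blast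
      then have "v \<in> ends G f" using nZ 2(1) unfolding Z_def by blast
      then have "(v, f) \<in> D" using 2(1) by (simp add: D_def darts_def)
      then show ?thesis using 2(2) unfolding sector_def by force
    next
      case (3 F)
      then have "cov y \<in> closed_face F" using face_subset by blast
      then obtain k where k: "v = fv F k" using nZ 3(1) unfolding Z_def by blast
      then have "(fv F k, fe F k) \<in> D" using face_darts[OF 3(1)] by (simp add: D_def)
      then show ?thesis using 3 left_face_eq[OF 3(1), of k] unfolding sector_def by force
    qed
    then show ?thesis using sec by blast
  qed
  have disj: "sector Q \<inter> sector R = {}"
  proof (rule ccontr)
    assume "\<not> ?thesis"
    then obtain y d d' where y: "d \<in> Q" "d' \<in> R" "y \<in> eint (snd d) \<union> left_face d"
      "y \<in> eint (snd d') \<union> left_face d'" unfolding sector_def by blast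
    have dd: "d \<in> darts" "d' \<in> darts" "fst d = v" "fst d' = v" "d \<noteq> d'"
      using y(1,2) QD by (auto simp: D_def)
    then have e: "snd d \<in> edges G" "snd d' \<in> edges G" "snd d \<noteq> snd d'"
      by (auto simp: darts_def prod_eq_iff)
    obtain k where F: "left_face d \<in> Faces" "d = (fv (left_face d) k, fe (left_face d) k)"
      using left_face[OF dd(1)] by blast
    obtain k' where F': "left_face d' \<in> Faces" "d' = (fv (left_face d') k', fe (left_face d') k')"
      using left_face[OF dd(2)] by blast
    have "left_face d \<noteq> left_face d'"
    proof
      assume eq: "left_face d = left_face d'"
      have "fv (left_face d) k = fv (left_face d) k'"
        using F(2) F'(2) dd(3,4) eq by (metis fst_conv)
      then have "k mod 3 = k' mod 3" using lifted_v_eq_iff[OF lifted_chart[OF F(1)]] by blast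
      then have "fe (left_face d) k = fe (left_face d) k'"
        using lifted_e_eq_iff[OF lifted_chart[OF F(1)]] by blast
      then show False using F(2) F'(2) e(3) eq by (metis snd_conv)
    qed
    then have "left_face d \<inter> left_face d' = {}" using faces_disjoint F(1) F'(1) by blast
    moreover have "eint (snd d) \<inter> eint (snd d') = {}" using eint_disjoint e by blast
    moreover have "eint (snd d) \<inter> left_face d' = {}" using eint_notin(4)[OF _ e(1) F'(1)] by blast
    moreover have "eint (snd d') \<inter> left_face d = {}" using eint_notin(4)[OF _ e(2) F(1)] by blast
    ultimately show False using y(3,4) by blast
  qed
  have meets: "\<exists>y\<in>?B. cov y \<in> sector S" if S: "S \<subseteq> D" "S \<noteq> {}" for S
  proof -
    obtain d where d: "d \<in> S" using S(2) by blast
    then have dd: "d \<in> darts" "fst d = v" using S(1) by (auto simp: D_def)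
    then obtain y where y: "y \<in> ball x (min r 1)" "cov y \<in> eint (snd d)"
      using sector_near[of d x "min r 1"] x r(1) by auto
    have "snd d \<in> edges G" using dd by (auto simp: darts_def)
    then have "cov y \<noteq> pos v" using y(2) edge_curve(4)[of "snd d"] v by blast
    then have "y \<noteq> x" using x by auto
    then show ?thesis using y d unfolding sector_def by blast
  qed
  have "connected ?B"
    by (rule connected_open_delete) simp_all
  moreover have "open (cov -` sector Q)" "open (cov -` sector R)"
    using sQ sR QD by (intro open_sector[of _ v]; auto simp: D_def)+
  moreover have "?B \<subseteq> cov -` sector Q \<union> cov -` sector R" using inB by blast
  moreover have "cov -` sector Q \<inter> cov -` sector R \<inter> ?B = {}" using disj by blast
  moreover have "cov -` sector Q \<inter> ?B \<noteq> {}" "cov -` sector R \<inter> ?B \<noteq> {}"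
    using meets[OF QD(1) Q(2)] meets[OF QD(2) R] by blast+
  ultimately show False using connectedD by blast
qed

end

section \<open>The choice number of a 6-regular triangulation\<close>

locale torus_triangulation_6 = torus_triangulation G pos \<gamma>
  for G :: "('v, 'e) multigraph" and pos :: "'v \<Rightarrow> complex \<times> complex"
    and \<gamma> :: "'e \<Rightarrow> real \<Rightarrow> complex \<times> complex" +
  assumes regular: "regular 6 G"
begin

lemma card_darts_at: "v \<in> verts G \<Longrightarrow> card {d \<in> darts. fst d = v} = 6"
proof -
  assume v: "v \<in> verts G"
  have "{e \<in> edges G. ends G e = {v}} = {}" using card_ends by fastforce
  then have "degree G v = card {e \<in> edges G. v \<in> ends G e}"
    unfolding degree_def by (simp only: card.empty add_0_right)
  then have "card {e \<in> edges G. v \<in> ends G e} = 6"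
    using regular v by (simp add: regular_def)
  moreover have "{d \<in> darts. fst d = v} = Pair v ` {e \<in> edges G. v \<in> ends G e}"
    by (auto simp: darts_def)
  ultimately show ?thesis by (simp add: card_image inj_on_def)
qed

lemma fst_darts: "fst ` darts = verts G"
proof
  show "fst ` darts \<subseteq> verts G" using ends_subset by (force simp: darts_def)
  show "verts G \<subseteq> fst ` darts"
  proof
    fix v assume "v \<in> verts G"
    then have "card {d \<in> darts. fst d = v} \<noteq> 0" using card_darts_at by simp
    then have "{d \<in> darts. fst d = v} \<noteq> {}" by (metis card.empty)
    then show "v \<in> fst ` darts" by blast
  qed
qed

sublocale map: triangular_map darts fst opp next_dart
proof
  show "Q = {d \<in> darts. fst d = v}" if "Q \<subseteq> {d \<in> darts. fst d = v}" "Q \<noteq> {}"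
    "\<And>d. d \<in> Q \<Longrightarrow> opp (next_dart (next_dart d)) \<in> Q" for Q v
    using that by (intro one_cycle) (simp_all add: spin_def)
  show "card {e \<in> darts. fst e = fst d} = 6" if "d \<in> darts" for d
    using card_darts_at fst_darts that by blast
qed (use finite_darts opp_dart next_dart in auto)

lemma proper_coloring_iff:
  "proper_coloring G c \<longleftrightarrow> (\<forall>d\<in>darts. c (fst d) \<noteq> c (fst (opp d)))"
proof
  assume p: "proper_coloring G c"
  show "\<forall>d\<in>darts. c (fst d) \<noteq> c (fst (opp d))"
  proof
    fix d assume d: "d \<in> darts"
    then have "snd d \<in> edges G" by (auto simp: darts_def)
    then show "c (fst d) \<noteq> c (fst (opp d))"
      using p opp_dart(4)[OF d] unfolding proper_coloring_def by blast
  qed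
next
  assume p: "\<forall>d\<in>darts. c (fst d) \<noteq> c (fst (opp d))"
  show "proper_coloring G c"
    unfolding proper_coloring_def
  proof (intro ballI allI impI)
    fix e u v assume e: "e \<in> edges G" "ends G e = {u, v}"
    then have "(u, e) \<in> darts" by (simp add: darts_def)
    then show "c u \<noteq> c v" using p opp_eq[OF e] by fastforce
  qed
qed

text \<open>Replacing every list by a sublist of exactly \<open>k\<close> colours reduces infinite
  lists to the finite case.\<close>

lemma choosableI:
  assumes "\<And>L. (\<And>v. v \<in> verts G \<Longrightarrow> finite (L v) \<and> k \<le> card (L v)) \<Longrightarrow>
    list_colourable map.nbrs (verts G) L"
  shows "choosable k G"
  unfolding choosable_def
proof (intro allI impI)
  fix L :: "'v \<Rightarrow> nat set"
  assume L: "\<forall>v\<in>verts G. infinite (L v) \<or> k \<le> card (L v)"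
  have "\<forall>v\<in>verts G. \<exists>K\<subseteq>L v. finite K \<and> card K = k"
  proof
    fix v assume "v \<in> verts G"
    then consider "infinite (L v)" | "k \<le> card (L v)" using L by blast
    then show "\<exists>K\<subseteq>L v. finite K \<and> card K = k"
    proof cases
      case 1
      then show ?thesis using infinite_arbitrarily_large by blast
    next
      case 2
      then show ?thesis using obtain_subset_with_card_n by metis
    qed
  qed
  then obtain K where K: "\<And>v. v \<in> verts G \<Longrightarrow> K v \<subseteq> L v \<and> finite (K v) \<and> card (K v) = k" by metis
  have "list_colourable map.nbrs (verts G) K" by (rule assms) (use K in auto)
  then obtain c where c: "\<And>v. v \<in> verts G \<Longrightarrow> c v \<in> K v"
    "\<And>u v. u \<in> verts G \<Longrightarrow> v \<in> verts G \<Longrightarrow> v \<in> map.nbrs u \<Longrightarrow> c u \<noteq> c v"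
    unfolding list_colourable_def by blast
  have "proper_coloring G c"
    unfolding proper_coloring_iff
  proof
    fix d assume d: "d \<in> darts"
    have "fst d \<in> verts G" "fst (opp d) \<in> verts G"
      using fst_darts d opp_dart(1)[OF d] by blast+
    moreover have "fst (opp d) \<in> map.nbrs (fst d)" unfolding map.nbrs_def using d by blast
    ultimately show "c (fst d) \<noteq> c (fst (opp d))" by (rule c(2))
  qed
  then show "list_choosable G L" unfolding list_choosable_def using c(1) K by blast
qed

lemma choosable_7: "choosable 7 G"
proof (rule choosableI)
  fix L :: "'v \<Rightarrow> nat set"
  assume L: "\<And>v. v \<in> verts G \<Longrightarrow> finite (L v) \<and> 7 \<le> card (L v)"
  show "list_colourable map.nbrs (verts G) L"
  proof (rule list_colourable_degenerate[where k = 7])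
    show "card (map.nbrs v) < 7" for v using map.card_nbrs[of v] by simp
    show "u \<in> map.nbrs v" if "v \<in> map.nbrs u" for u v using that by (rule map.nbrs_sym)
    show "v \<notin> map.nbrs v" for v by (rule map.nbrs_irrefl)
    show "map.nbrs v \<subseteq> verts G" for v using map.nbrs_subset fst_darts by blast
  qed (use L finite_graph in auto)
qed

lemma choosable_6:
  assumes "proper_coloring G c" "card (c ` verts G) \<le> 6"
  shows "choosable 6 G"
proof (rule choosableI)
  fix L :: "'v \<Rightarrow> nat set"
  assume L: "\<And>v. v \<in> verts G \<Longrightarrow> finite (L v) \<and> 6 \<le> card (L v)"
  show "list_colourable map.nbrs (verts G) L"
    unfolding fst_darts[symmetric]
    by (rule map.list_colourable_6[of c]) (use assms L in \<open>auto simp: proper_coloring_iff fst_darts\<close>)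
qed

lemma choosable_5:
  assumes "proper_coloring G c" "card (c ` verts G) \<le> 3"
  shows "choosable 5 G"
proof (rule choosableI)
  interpret three_coloured_map darts fst opp next_dart c
    by unfold_locales (use assms in \<open>auto simp: proper_coloring_iff fst_darts\<close>)
  fix L :: "'v \<Rightarrow> nat set"
  assume L: "\<And>v. v \<in> verts G \<Longrightarrow> finite (L v) \<and> 5 \<le> card (L v)"
  show "list_colourable map.nbrs (verts G) L"
    unfolding fst_darts[symmetric] by (rule list_colourable_5) (use L in \<open>simp add: fst_darts\<close>)
qed

lemma colours_ge_3:
  assumes c: "proper_coloring G c" and "verts G \<noteq> {}"
  shows "3 \<le> card (c ` verts G)"
proof -
  obtain d where d: "d \<in> darts" using assms(2) fst_darts by blast
  let ?x = "fst d" and ?y = "fst (next_dart d)" and ?z = "fst (next_dart (next_dart d))"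
  have n: "next_dart d \<in> darts" "next_dart (next_dart d) \<in> darts" using d next_dart(1) by blast+
  have "c ?x \<noteq> c ?y" "c ?y \<noteq> c ?z" "c ?z \<noteq> c ?x"
    using c d n next_dart(2,3) unfolding proper_coloring_iff by metis+
  then have "card {c ?x, c ?y, c ?z} = 3" by simp
  moreover have "{c ?x, c ?y, c ?z} \<subseteq> c ` verts G" using fst_darts d n by blast
  then have "card {c ?x, c ?y, c ?z} \<le> card (c ` verts G)"
    using finite_graph by (intro card_mono) simp_all
  ultimately show ?thesis by simp
qed

lemma obtain_optimal_coloring:
  obtains c where "proper_coloring G c" "card (c ` verts G) \<le> chromatic_number G"
proof -
  obtain c :: "'v \<Rightarrow> nat" where c: "inj_on c (verts G)"
    using finite_imp_inj_to_nat_seg[OF finite_graph(1)] by blast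
  have "proper_coloring G c"
    unfolding proper_coloring_iff
  proof
    fix d assume d: "d \<in> darts"
    have "fst d \<in> verts G" "fst (opp d) \<in> verts G"
      using fst_darts d opp_dart(1)[OF d] by blast+
    then show "c (fst d) \<noteq> c (fst (opp d))" using inj_onD[OF c] opp_dart(3)[OF d] by metis
  qed
  then have "\<exists>k. \<exists>c. proper_coloring G c \<and> card (c ` verts G) \<le> k" by blast
  then have "\<exists>c. proper_coloring G c \<and> card (c ` verts G) \<le> chromatic_number G"
    unfolding chromatic_number_def by (rule LeastI_ex)
  then show ?thesis using that by blast
qed

lemma choice_number_le: "choosable k G \<Longrightarrow> choice_number G \<le> k"
  unfolding choice_number_def by (rule Least_le)

lemma choice_number_bound: "choice_number G \<le> chromatic_number G + 2"
proof (cases "verts G = {}")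
  case True
  have "choosable 0 G"
    by (rule choosableI) (simp add: True list_colourable_def)
  then show ?thesis using choice_number_le by fastforce
next
  case False
  obtain c where c: "proper_coloring G c" "card (c ` verts G) \<le> chromatic_number G"
    by (rule obtain_optimal_coloring)
  consider "chromatic_number G \<le> 3" | "chromatic_number G = 4" | "5 \<le> chromatic_number G" by linarith
  then show ?thesis
  proof cases
    case 1
    then have "choice_number G \<le> 5" using choosable_5[OF c(1)] c(2) choice_number_le by simp
    moreover have "3 \<le> chromatic_number G" using colours_ge_3[OF c(1) False] c(2) by simp
    ultimately show ?thesis by simp
  next
    case 2
    then have "choice_number G \<le> 6" using choosable_6[OF c(1)] c(2) choice_number_le by simp
    then show ?thesis using 2 by simp
  next
    case 3
    then show ?thesis using choice_number_le[OF choosable_7] by simp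
  qed
qed

end

theorem theorem1p2:
  fixes G :: "('v, 'e) multigraph"
    and pos :: "'v \<Rightarrow> complex \<times> complex"
    and \<gamma> :: "'e \<Rightarrow> real \<Rightarrow> complex \<times> complex"
  assumes "triangulates torus G pos \<gamma>"
    and "loopless G"
    and "regular 6 G"
  shows "int (choice_number G) - int (chromatic_number G) \<le> 2"
proof -
  interpret torus_triangulation_6 G pos \<gamma>
    by unfold_locales (use assms in auto)
  show ?thesis using choice_number_bound by simp
qed

end
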